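(* For every $s>\frac12$ there exist two constants $a_s\in(0,1)$ and $K_s>0$ such that for every $\alpha\ge 0$, all $0<\epsilon\ll 1$ and all $u_0\in H^s_+$ with $\|u_0\|_{H^s}=\epsilon$, the solution $u$ of $$i\partial_t u+\epsilon^{\alpha}\partial_x^2u=\Pi(|u|^2u),\qquad u(0,\cdot)=u_0$$ satisfies $$\sup_{|t|\le a_s\epsilon^{-(4-\alpha)}}\|u(t)\|_{H^s}\le K_s\,\epsilon\quad\text{if }\alpha\in[0,2],\qquad \sup_{|t|\le a_s\epsilon^{-2}}\|u(t)\|_{H^s}\le K_s\,\epsilon\quad\text{if }\alpha>2 .$$ Moreover, if $\alpha>2$ and $s\ge 1$, the time interval $[-\frac{a_s}{\epsilon^2},\frac{a_s}{\epsilon^2}]$ is maximal in the following sense: for every $0<\epsilon\ll1$ there exists $u_0^{\epsilon}\in C^\infty_+$ with $\|u_0^\epsilon\|_{H^s}\simeq\epsilon$ such that, for every $\beta>0$, the solution $u$ of the same equation with $u(0)=u_0^\epsilon$ satisfies, as $\epsilon\to0^+$, $$\sup_{|t|\le \epsilon^{-(2+\beta)}}\|u(t)\|_{H^s}\gtrsim \epsilon\,|\ln\epsilon|^{1/2}\gg\epsilon .$$ (The family $(u_0^\epsilon)_\epsilon$ does not depend on $\beta$; for each $\beta$ the lower bound holds for all sufficiently small $\epsilon$.)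
   Context: $\mathbb S^1=\mathbb R/2\pi\mathbb Z$. $\Pi$ is the Szegő projector $\Pi(\sum_{k\in\mathbb Z}u_ke^{ikx})=\sum_{k\ge0}u_ke^{ikx}$ on $L^2(\mathbb S^1)$. $L^2_+=\Pi(L^2(\mathbb S^1))$, $H^s_+=H^s(\mathbb S^1)\cap L^2_+$, $C^\infty_+=C^\infty(\mathbb S^1)\cap L^2_+$, with $\|u\|_{H^s}^2=\sum_k(1+k^2)^s|u_k|^2$. For $u_0\in H^s_+$, $s\ge\frac12$, the solution is the unique global solution $u\in C(\mathbb R,H^s_+)$. Note that the same $\epsilon$ is the parameter in the equation and the size of the data. "$0<\epsilon\ll1$" means $0<\epsilon<\epsilon_0$ for some threshold $\epsilon_0$ depending on the fixed parameters ($s,\alpha$). $A\simeq B$ means $c^{-1}B\le A\le cB$ and $A\gtrsim B$ means $A\ge cB$, with a constant $c>0$ independent of $\epsilon$ (it may depend on $s,\alpha$); $A\gg B$ means $A/B\to\infty$ as $\epsilon\to0^+$. *)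

theory Defs
  imports "HOL-Analysis.Analysis"
begin

text \<open>
  A function on the circle is a \<open>2\<pi>\<close>-periodic function on the real line.  Elements of
  \<open>L\<^sup>2\<close> and its subspaces are given by Borel representatives; two representatives of the same
  element agree almost everywhere, and all notions below respect this identification.
\<close>

definition periodic_2pi :: "(real \<Rightarrow> complex) \<Rightarrow> bool" where
  "periodic_2pi f \<longleftrightarrow> (\<forall>x. f (x + 2 * pi) = f x)"

definition L2_circle :: "(real \<Rightarrow> complex) set" where
  "L2_circle = {f. f \<in> borel_measurable borel \<and> periodic_2pi f \<and>
     set_integrable lborel {0..2*pi} (\<lambda>x. (cmod (f x))\<^sup>2)}"

text \<open>Normalised so that \<open>f = (\<Sum>k. f\<^sub>k e\<^sup>i\<^sup>k\<^sup>x)\<close>.\<close>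

definition fourier_coeff :: "(real \<Rightarrow> complex) \<Rightarrow> int \<Rightarrow> complex" where
  "fourier_coeff f k =
     (LINT x:{0..2*pi}|lborel. f x * cis (- (of_int k * x))) / of_real (2 * pi)"

text \<open>\<open>is_szego f g\<close> says that \<open>g\<close> is a representative of the projection of \<open>f\<close>, i.e. the series
  \<open>\<Sum>k\<ge>0. f\<^sub>k e\<^sup>i\<^sup>k\<^sup>x\<close> converges to \<open>g\<close> in \<open>L\<^sup>2\<close>.  Such \<open>g\<close> exists for each \<open>f\<close> in \<open>L\<^sup>2\<close>
  (Riesz-Fischer) and is unique almost everywhere.\<close>

definition is_szego :: "(real \<Rightarrow> complex) \<Rightarrow> (real \<Rightarrow> complex) \<Rightarrow> bool" where
  "is_szego f g \<longleftrightarrow> g \<in> L2_circle \<and>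
     (\<lambda>N. LINT x:{0..2*pi}|lborel.
        (cmod (g x - (\<Sum>k\<le>N. fourier_coeff f (int k) * cis (real k * x))))\<^sup>2) \<longlonglongrightarrow> 0"

definition szego :: "(real \<Rightarrow> complex) \<Rightarrow> (real \<Rightarrow> complex)" where
  "szego f = (SOME g. is_szego f g)"

definition L2_plus :: "(real \<Rightarrow> complex) set" where
  "L2_plus = {g. \<exists>f\<in>L2_circle. is_szego f g}"

definition Hs_circle :: "real \<Rightarrow> (real \<Rightarrow> complex) set" where
  "Hs_circle s = {f \<in> L2_circle.
     (\<lambda>k::int. (1 + (of_int k)\<^sup>2) powr s * (cmod (fourier_coeff f k))\<^sup>2) summable_on UNIV}"

definition Hs_norm :: "real \<Rightarrow> (real \<Rightarrow> complex) \<Rightarrow> real" where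
  "Hs_norm s f =
     sqrt (\<Sum>\<^sub>\<infinity>k::int. (1 + (of_int k)\<^sup>2) powr s * (cmod (fourier_coeff f k))\<^sup>2)"

definition Hs_plus :: "real \<Rightarrow> (real \<Rightarrow> complex) set" where
  "Hs_plus s = Hs_circle s \<inter> L2_plus"

definition xderiv :: "(real \<Rightarrow> complex) \<Rightarrow> (real \<Rightarrow> complex)" where
  "xderiv f = (\<lambda>x. vector_derivative f (at x))"

definition Cinf_circle :: "(real \<Rightarrow> complex) set" where
  "Cinf_circle = {f. periodic_2pi f \<and> (\<forall>n x. (xderiv ^^ n) f differentiable (at x))}"

definition Cinf_plus :: "(real \<Rightarrow> complex) set" where
  "Cinf_plus = Cinf_circle \<inter> L2_plus"

definition circle_pairing :: "(real \<Rightarrow> complex) \<Rightarrow> (real \<Rightarrow> complex) \<Rightarrow> complex" where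
  "circle_pairing f \<phi> = (LINT x:{0..2*pi}|lborel. f x * \<phi> x)"

text \<open>
  \<open>nls_szego_solution s \<nu> u0 u\<close>: \<open>u\<close> is in \<open>C(\<real>, H\<^sup>s\<^sub>+)\<close>, has initial value \<open>u0\<close>, and satisfies
  \<open>i \<partial>\<^sub>t u + \<nu> \<partial>\<^sub>x\<^sup>2 u = \<Pi>(|u|\<^sup>2 u)\<close> at every time in the sense of distributions on the circle:
  the equation is tested against smooth periodic functions of \<open>x\<close>, the two derivatives
  in \<open>x\<close> being moved to the test function.
\<close>

definition nls_szego_solution ::
  "real \<Rightarrow> real \<Rightarrow> (real \<Rightarrow> complex) \<Rightarrow> (real \<Rightarrow> real \<Rightarrow> complex) \<Rightarrow> bool" where
  "nls_szego_solution s \<nu> u0 u \<longleftrightarrow>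
     (\<forall>t. u t \<in> Hs_plus s) \<and>
     (\<forall>t\<^sub>0. ((\<lambda>t. Hs_norm s (\<lambda>x. u t x - u t\<^sub>0 x)) \<longlongrightarrow> 0) (at t\<^sub>0)) \<and>
     (AE x in lborel. u 0 x = u0 x) \<and>
     (\<forall>\<phi>\<in>Cinf_circle. \<forall>t. \<exists>d.
        ((\<lambda>\<tau>. circle_pairing (u \<tau>) \<phi>) has_vector_derivative d) (at t) \<and>
        \<i> * d + of_real \<nu> * circle_pairing (u t) (xderiv (xderiv \<phi>)) =
          circle_pairing (szego (\<lambda>x. of_real ((cmod (u t x))\<^sup>2) * u t x)) \<phi>)"

text \<open>Extended-real valued, so that no boundedness has to be presupposed.\<close>

definition sup_Hs_norm :: "real \<Rightarrow> real \<Rightarrow> (real \<Rightarrow> real \<Rightarrow> complex) \<Rightarrow> ereal" where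
  "sup_Hs_norm s T u = (SUP t\<in>{-T..T}. ereal (Hs_norm s (u t)))"

end

theory Submission
  imports Defs "HOL-Real_Asymp.Real_Asymp"
begin

text \<open>Write \<open>u = \<Sum>k\<ge>0. u\<^sub>k e^(ikx)\<close> and \<open>\<nu> = \<epsilon> powr \<alpha>\<close>.  The equation becomes the system
\<open>i u\<^sub>k' = \<nu> k\<^sup>2 u\<^sub>k + \<Sum> u\<^sub>a cnj u\<^sub>b u\<^sub>c\<close>, the sum running over \<open>k + b = a + c\<close>, and everything below
is done on this system (\<open>solution_seq_solution\<close>), for a given solution.  Since frequencies are nonnegative,
\<open>k \<le> a + c\<close>, so the weight of \<open>k\<close> can be moved to \<open>a\<close> or \<open>c\<close>; with the embedding
\<open>h\<^sup>s \<subseteq> l\<^sup>1\<close> for \<open>s > 1/2\<close>, this gives the basic quartic estimate \<open>quartic_bound\<close>.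

\<^emph>\<open>Long time bounds.\<close>  The square of the norm, \<open>E = \<Sum> wt\<^sub>k |u\<^sub>k|\<^sup>2\<close>, satisfies \<open>|E'| \<le> C E\<^sup>2\<close>, which
keeps \<open>E\<close> of size \<open>\<epsilon>\<^sup>2\<close> up to times of order \<open>1 / \<epsilon>\<^sup>2\<close>; that is all that is claimed for \<open>\<alpha> \<ge> 2\<close>.  For
\<open>\<alpha> < 2\<close> the dispersion helps.  The quadruples have phase
\<open>\<Phi> = k\<^sup>2 - a\<^sup>2 + b\<^sup>2 - c\<^sup>2 = 2 (k - a) (k - c)\<close>; those with \<open>\<Phi> = 0\<close> contribute only real numbers to the
quartic form whose imaginary part is \<open>E'/2\<close>, hence nothing.  For the others \<open>|\<Phi>| \<ge> 1\<close>, and adding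
to \<open>E\<close> the quartic correction with coefficients \<open>1/(\<nu> \<Phi>)\<close> cancels the quartic part of \<open>E'\<close>.  What
remains is sextic and carries a factor \<open>1/\<nu>\<close>: \<open>E\<close> changes by at most \<open>C (\<epsilon>^4 + t \<epsilon>^6) / \<nu>\<close>, which is small
compared with \<open>\<epsilon>\<^sup>2\<close> up to times of order \<open>\<nu> / \<epsilon>^4 = \<epsilon> powr (- (4 - \<alpha>))\<close> (\<open>energy_growth_normal_form\<close>).  To have
finite sums only, the system is cut at frequency \<open>N\<close>; the error tends to zero uniformly on compact
time intervals, by a Dini argument (\<open>seq_solution_uniform_tail\<close>).

\<^emph>\<open>Growth.\<close>  After the scaling \<open>u(t) = \<epsilon> v(\<epsilon>\<^sup>2 t)\<close> the dispersion coefficient is \<open>\<epsilon> powr (\<alpha> - 2)\<close>, and for \<open>\<alpha> > 2\<close> the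
equation is a small perturbation of the cubic Szego equation.  The latter has the solution of
Gerard and Grellier with datum \<open>z + d\<close>, \<open>z = e^(ix)\<close>, of the form \<open>b + c z / (1 - p z)\<close>.  At a time of order \<open>1/d\<close> its pole
comes within a distance of order \<open>d\<^sup>2\<close> of the circle, and its \<open>H\<^sup>1\<close> norm is then of order \<open>1/d\<close>, whereas
its \<open>l\<^sup>1\<close> norm never exceeds 4.  Because the trilinear term is Lipschitz in \<open>l\<^sup>1\<close>, a Gronwall
argument in \<open>l\<^sup>1\<close> (\<open>l1_perturbation\<close>) bounds the error by \<open>\<epsilon> powr (\<alpha> - 2) exp (C/d) / d^4\<close> up to a constant.  With
\<open>d = |ln \<epsilon>| powr (- 1/2)\<close> this is smaller than every power of \<open>d\<close>, the time \<open>1/d\<close> is below \<open>\<epsilon> powr (- \<beta>)\<close> for every \<open>\<beta> > 0\<close>, and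
the norm has reached \<open>\<epsilon>/d = \<epsilon> |ln \<epsilon>| powr (1/2)\<close>.
\<close>

section \<open>Quartic sums over frequency quadruples\<close>

definition wt :: "real \<Rightarrow> nat \<Rightarrow> real" where
  "wt s k = (1 + (real k)\<^sup>2) powr s"

text \<open>The norm of \<open>h\<^sup>s\<close> restricted to the frequencies up to \<open>N\<close>.\<close>

definition l2w :: "real \<Rightarrow> nat \<Rightarrow> (nat \<Rightarrow> complex) \<Rightarrow> real" where
  "l2w s N x = L2_set (\<lambda>k. wt (s/2) k * cmod (x k)) {..N}"

definition l1 :: "nat \<Rightarrow> (nat \<Rightarrow> complex) \<Rightarrow> real" where
  "l1 N x = (\<Sum>k\<le>N. cmod (x k))"

text \<open>The interactions \<open>k + b = a + c\<close>: the frequencies \<open>a\<close> and \<open>c\<close>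
enter the product unconjugated, \<open>b\<close> conjugated, and \<open>k\<close> is the outgoing one.  The outgoing frequency
is not cut in \<open>trip\<close>, so that \<open>cub N x\<close> has all coefficients, at nonnegative frequencies, of the cubic
term of a trigonometric polynomial.\<close>

definition trip :: "nat \<Rightarrow> nat \<Rightarrow> (nat \<times> nat \<times> nat) set" where
  "trip N k = {(a, b, c). a \<le> N \<and> b \<le> N \<and> c \<le> N \<and> k + b = a + c}"

definition quad :: "nat \<Rightarrow> (nat \<times> nat \<times> nat \<times> nat) set" where
  "quad N = Sigma {..N} (trip N)"

definition cub :: "nat \<Rightarrow> (nat \<Rightarrow> complex) \<Rightarrow> nat \<Rightarrow> complex" where
  "cub N x k = (\<Sum>(a, b, c)\<in>trip N k. x a * cnj (x b) * x c)"

lemma wt_pos [simp]: "wt s k > 0"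
proof -
  have "1 + (real k)\<^sup>2 > 0" by (simp add: add_pos_nonneg)
  then show ?thesis by (simp add: wt_def)
qed

lemma wt_nonneg [simp]: "wt s k \<ge> 0"
  using wt_pos[of s k] by linarith

lemma wt_add: "wt (r + s) k = wt r k * wt s k"
  by (simp add: wt_def powr_add)

lemma wt_half: "wt (s/2) k * wt (s/2) k = wt s k"
  by (simp flip: wt_add)

lemma l2w_power2: "(l2w s N x)\<^sup>2 = (\<Sum>k\<le>N. wt s k * (cmod (x k))\<^sup>2)"
  by (simp add: l2w_def L2_set_def sum_nonneg power_mult_distrib power2_eq_square mult_ac flip: wt_half[of s])

lemma l2w_nonneg [simp]: "l2w s N x \<ge> 0" and l1_nonneg [simp]: "l1 N x \<ge> 0"
  by (simp_all add: l2w_def L2_set_nonneg l1_def sum_nonneg)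

lemma finite_trip [simp]: "finite (trip N k)"
proof (rule finite_subset)
  show "trip N k \<subseteq> {..N} \<times> {..N} \<times> {..N}" by (auto simp: trip_def)
qed auto

lemma finite_quad [simp]: "finite (quad N)"
  by (simp add: quad_def)

lemma quad_iff: "(k, a, b, c) \<in> quad N \<longleftrightarrow> k \<le> N \<and> a \<le> N \<and> b \<le> N \<and> c \<le> N \<and> k + b = a + c"
  by (auto simp: quad_def trip_def)

lemma sum_trip_quad:
  "(\<Sum>k\<le>N. \<Sum>(a, b, c)\<in>trip N k. f k a b c) = (\<Sum>(k, a, b, c)\<in>quad N. f k a b c)"
  unfolding quad_def by (subst sum.Sigma) (auto simp: case_prod_unfold)

lemma sum_quad_mono:
  fixes f g :: "nat \<Rightarrow> nat \<Rightarrow> nat \<Rightarrow> nat \<Rightarrow> real"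
  assumes "\<And>k a b c. (k, a, b, c) \<in> A \<Longrightarrow> f k a b c \<le> g k a b c"
  shows "(\<Sum>(k, a, b, c)\<in>A. f k a b c) \<le> (\<Sum>(k, a, b, c)\<in>A. g k a b c)"
  using assms by (intro sum_mono) auto

text \<open>For fixed \<open>b\<close> and \<open>c\<close> each of \<open>k\<close> and \<open>a\<close> determines the other, so Cauchy-Schwarz costs nothing.\<close>

lemma young_pair:
  fixes W X :: "nat \<Rightarrow> real"
  assumes "\<And>k. W k \<ge> 0" "\<And>k. X k \<ge> 0"
  shows "(\<Sum>(k, a)\<in>{(k, a). k \<le> N \<and> a \<le> N \<and> k + b = a + c}. W k * X a)
           \<le> L2_set W {..N} * L2_set X {..N}"
proof -
  let ?A = "{(k, a). k \<le> N \<and> a \<le> N \<and> k + b = a + c}"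
  have fin: "finite ?A" by (rule finite_subset[of _ "{..N} \<times> {..N}"]) auto
  have "(\<Sum>(k, a)\<in>?A. W k * X a) = (\<Sum>i\<in>?A. \<bar>W (fst i)\<bar> * \<bar>X (snd i)\<bar>)"
    using assms by (auto intro!: sum.cong)
  also have "\<dots> \<le> L2_set (\<lambda>i. W (fst i)) ?A * L2_set (\<lambda>i. X (snd i)) ?A"
    by (rule L2_set_mult_ineq)
  also have "\<dots> \<le> L2_set W {..N} * L2_set X {..N}"
  proof (rule mult_mono)
    have "(\<Sum>i\<in>?A. (W (fst i))\<^sup>2) = (\<Sum>k\<in>fst ` ?A. (W k)\<^sup>2)"
      by (subst sum.reindex) (auto simp: inj_on_def)
    also have "\<dots> \<le> (\<Sum>k\<le>N. (W k)\<^sup>2)" by (rule sum_mono2) auto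
    finally show "L2_set (\<lambda>i. W (fst i)) ?A \<le> L2_set W {..N}" by (simp add: L2_set_def)
    have "(\<Sum>i\<in>?A. (X (snd i))\<^sup>2) = (\<Sum>k\<in>snd ` ?A. (X k)\<^sup>2)"
      by (subst sum.reindex) (auto simp: inj_on_def)
    also have "\<dots> \<le> (\<Sum>k\<le>N. (X k)\<^sup>2)" by (rule sum_mono2) auto
    finally show "L2_set (\<lambda>i. X (snd i)) ?A \<le> L2_set X {..N}" by (simp add: L2_set_def)
  qed (auto simp: L2_set_nonneg)
  finally show ?thesis .
qed

text \<open>Young's inequality \<open>l\<^sup>2 * l\<^sup>1 * l\<^sup>1 \<subseteq> l\<^sup>2\<close>, in dual form: two factors are measured in \<open>l\<^sup>2\<close>, the remaining two
are summed last.\<close>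

lemma young_quad:
  fixes W X Y Z :: "nat \<Rightarrow> real"
  assumes "\<And>k. W k \<ge> 0" "\<And>k. X k \<ge> 0" "\<And>k. Y k \<ge> 0" "\<And>k. Z k \<ge> 0"
  shows "(\<Sum>(k, a, b, c)\<in>quad N. W k * X a * Y b * Z c)
           \<le> L2_set W {..N} * L2_set X {..N} * (\<Sum>b\<le>N. Y b) * (\<Sum>c\<le>N. Z c)"
proof -
  let ?A = "\<lambda>b c. {(k, a). k \<le> N \<and> a \<le> N \<and> k + b = a + c}"
  have fin: "finite {p. fst p \<le> N \<and> snd p \<le> N \<and> fst p + b = snd p + c}" for b c
    by (rule finite_subset[of _ "{..N} \<times> {..N}"]) auto
  have "(\<Sum>(k, a, b, c)\<in>quad N. W k * X a * Y b * Z c)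
      = (\<Sum>((b, c), (k, a))\<in>Sigma ({..N} \<times> {..N}) (\<lambda>(b, c). ?A b c). Y b * Z c * (W k * X a))"
    by (rule sum.reindex_bij_witness[of _ "\<lambda>((b, c), (k, a)). (k, a, b, c)" "\<lambda>(k, a, b, c). ((b, c), (k, a))"])
       (auto simp: quad_iff mult_ac)
  also have "\<dots> = (\<Sum>(b, c)\<in>{..N} \<times> {..N}. Y b * Z c * (\<Sum>(k, a)\<in>?A b c. W k * X a))"
    by (subst sum.Sigma[symmetric]) (use fin in \<open>auto simp: case_prod_unfold sum_distrib_left intro!: sum.cong\<close>)
  also have "\<dots> \<le> (\<Sum>(b, c)\<in>{..N} \<times> {..N}. Y b * Z c * (L2_set W {..N} * L2_set X {..N}))"
  proof (intro sum_mono)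
    fix p assume "p \<in> {..N} \<times> {..N}"
    obtain b c where p: "p = (b, c)" by (cases p)
    show "(case p of (b, c) \<Rightarrow> Y b * Z c * (\<Sum>(k, a)\<in>?A b c. W k * X a))
      \<le> (case p of (b, c) \<Rightarrow> Y b * Z c * (L2_set W {..N} * L2_set X {..N}))"
      using assms young_pair[of W X N b c] by (auto simp: p intro!: mult_left_mono)
  qed
  also have "\<dots> = (\<Sum>b\<le>N. Y b) * (\<Sum>c\<le>N. Z c) * (L2_set W {..N} * L2_set X {..N})"
    by (simp only: sum_product sum.cartesian_product case_prod_unfold sum_distrib_right[symmetric])
  finally show ?thesis by (simp add: mult_ac)
qed

text \<open>Here nonnegativity of all frequencies is essential: \<open>k = a - b + c \<le> a + c\<close>, so the frequency \<open>b\<close> of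
the conjugated factor never has to carry the weight.\<close>

lemma wt_subadd:
  assumes "s \<ge> 0" "k \<le> a + c"
  shows "wt (s/2) k \<le> 2 powr s * (wt (s/2) a + wt (s/2) c)"
proof -
  define m where "m = max a c"
  have "(real k)\<^sup>2 \<le> (2 * real m)\<^sup>2"
    using assms by (intro power_mono) (auto simp: m_def)
  then have "1 + (real k)\<^sup>2 \<le> 4 * (1 + (real m)\<^sup>2)" by (simp add: power2_eq_square)
  then have "wt (s/2) k \<le> (4 * (1 + (real m)\<^sup>2)) powr (s/2)"
    unfolding wt_def using assms by (intro powr_mono2) auto
  also have "\<dots> = (2 powr 2) powr (s/2) * wt (s/2) m"
    unfolding wt_def by (subst powr_mult) auto
  also have "\<dots> = 2 powr s * wt (s/2) m" by (simp only: powr_powr) simp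
  also have "\<dots> \<le> 2 powr s * (wt (s/2) a + wt (s/2) c)"
    by (intro mult_left_mono) (auto simp: m_def max_def)
  finally show ?thesis .
qed

text \<open>The weight \<open>wt s k\<close> is split into two halves.  One stays on \<open>w\<close>, the other goes to \<open>x\<close> or to \<open>z\<close>;
the two factors without weight are measured in \<open>l\<^sup>1\<close>.\<close>

lemma quartic_l1:
  assumes s: "s \<ge> 0"
  shows "(\<Sum>(k, a, b, c)\<in>quad N. wt s k * cmod (w k) * cmod (x a) * cmod (y b) * cmod (z c))
      \<le> 2 powr s * l2w s N w * l1 N y * (l2w s N x * l1 N z + l2w s N z * l1 N x)"
proof -
  let ?W = "\<lambda>u k. wt (s/2) k * cmod (u k)"
  have "(\<Sum>(k, a, b, c)\<in>quad N. wt s k * cmod (w k) * cmod (x a) * cmod (y b) * cmod (z c))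
      \<le> (\<Sum>(k, a, b, c)\<in>quad N. 2 powr s * (?W w k * ?W x a * cmod (y b) * cmod (z c))
                             + 2 powr s * (?W w k * ?W z c * cmod (y b) * cmod (x a)))"
  proof (rule sum_quad_mono)
    fix k a b c assume "(k, a, b, c) \<in> quad N"
    then have "k \<le> a + c" by (auto simp: quad_iff)
    then have *: "wt (s/2) k \<le> 2 powr s * (wt (s/2) a + wt (s/2) c)" by (rule wt_subadd[OF s])
    have "wt s k * cmod (w k) * cmod (x a) * cmod (y b) * cmod (z c)
       = wt (s/2) k * (wt (s/2) k * cmod (w k) * cmod (x a) * cmod (y b) * cmod (z c))"
      by (simp flip: wt_half[of s])
    also have "\<dots> \<le> 2 powr s * (wt (s/2) a + wt (s/2) c) * (wt (s/2) k * cmod (w k) * cmod (x a) * cmod (y b) * cmod (z c))"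
      by (rule mult_right_mono[OF *]) auto
    finally show "wt s k * cmod (w k) * cmod (x a) * cmod (y b) * cmod (z c)
      \<le> 2 powr s * (?W w k * ?W x a * cmod (y b) * cmod (z c))
         + 2 powr s * (?W w k * ?W z c * cmod (y b) * cmod (x a))"
      by (simp add: algebra_simps)
  qed
  also have "\<dots> = 2 powr s * (\<Sum>(k, a, b, c)\<in>quad N. ?W w k * ?W x a * cmod (y b) * cmod (z c))
               + 2 powr s * (\<Sum>(k, a, b, c)\<in>quad N. ?W w k * ?W z c * cmod (y b) * cmod (x a))"
    by (simp add: case_prod_unfold sum.distrib sum_distrib_left)
  also have "(\<Sum>(k, a, b, c)\<in>quad N. ?W w k * ?W z c * cmod (y b) * cmod (x a))
       = (\<Sum>(k, a, b, c)\<in>quad N. ?W w k * ?W z a * cmod (y b) * cmod (x c))"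
    by (rule sum.reindex_bij_witness[of _ "\<lambda>(k, a, b, c). (k, c, b, a)" "\<lambda>(k, a, b, c). (k, c, b, a)"])
       (auto simp: quad_iff)
  also have "2 powr s * (\<Sum>(k, a, b, c)\<in>quad N. ?W w k * ?W x a * cmod (y b) * cmod (z c))
     + 2 powr s * (\<Sum>(k, a, b, c)\<in>quad N. ?W w k * ?W z a * cmod (y b) * cmod (x c))
     \<le> 2 powr s * (l2w s N w * l2w s N x * l1 N y * l1 N z) + 2 powr s * (l2w s N w * l2w s N z * l1 N y * l1 N x)"
    unfolding l2w_def l1_def
    by (intro add_mono mult_left_mono young_quad) auto
  finally show ?thesis by (simp add: algebra_simps)
qed

lemma summable_wt: 
  assumes "s > 1/2" shows "summable (wt (-s))"
proof (rule summable_comparison_test')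
  show "summable (\<lambda>n. real n powr (- 2 * s))" using assms by (subst summable_real_powr_iff) auto
  fix n :: nat assume n: "n \<ge> 1"
  have "wt (-s) n = (1 + (real n)\<^sup>2) powr (-s)" by (simp add: wt_def)
  also have "\<dots> \<le> ((real n)\<^sup>2) powr (-s)" using n assms by (intro powr_mono2') auto
  also have "\<dots> = real n powr (- 2 * s)" using n by (simp add: powr_powr flip: powr_numeral)
  finally show "norm (wt (-s) n) \<le> real n powr (- 2 * s)" by simp
qed

text \<open>The norm of the embedding of \<open>h\<^sup>s\<close> into \<open>l\<^sup>1\<close>, finite for \<open>s > 1/2\<close>.\<close>

definition emb :: "real \<Rightarrow> real" where
  "emb s = sqrt (\<Sum>k. wt (-s) k)"

lemma emb_nonneg: "s > 1/2 \<Longrightarrow> emb s \<ge> 0"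
  unfolding emb_def by (simp add: suminf_nonneg summable_wt)

lemma l1_le_l2w:
  assumes s: "s > 1/2" shows "l1 N x \<le> emb s * l2w s N x"
proof -
  have "l1 N x = (\<Sum>k\<le>N. \<bar>wt (-s/2) k\<bar> * \<bar>wt (s/2) k * cmod (x k)\<bar>)"
  proof -
    have "wt (-s/2) k * wt (s/2) k = 1" for k
      using wt_add[of "-s/2" "s/2" k] by (simp add: wt_def add_nonneg_eq_0_iff)
    then show ?thesis
      unfolding l1_def by (intro sum.cong) (auto simp: abs_mult mult.assoc[symmetric])
  qed
  also have "\<dots> \<le> L2_set (wt (-s/2)) {..N} * l2w s N x"
    unfolding l2w_def by (rule L2_set_mult_ineq)
  also have "L2_set (wt (-s/2)) {..N} = sqrt (\<Sum>k\<le>N. wt (-s) k)"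
    using wt_half[of "-s"] by (simp add: L2_set_def power2_eq_square)
  also have "\<dots> * l2w s N x \<le> emb s * l2w s N x"
    unfolding emb_def by (intro mult_right_mono real_sqrt_le_mono sum_le_suminf summable_wt s) auto
  finally show ?thesis .
qed

text \<open>The constant of the quartic estimate.\<close>

definition qc :: "real \<Rightarrow> real" where
  "qc s = 2 * 2 powr s * (emb s)\<^sup>2"

lemma qc_nonneg: "qc s \<ge> 0" by (simp add: qc_def)

text \<open>By duality this contains the algebra property of \<open>H\<^sup>s\<close>; \<open>w\<close> is later either the solution itself
or its cubic term.\<close>

lemma quartic_bound:
  assumes s: "s > 1/2"
  shows "(\<Sum>(k, a, b, c)\<in>quad N. wt s k * cmod (w k) * cmod (x a) * cmod (y b) * cmod (z c))
      \<le> qc s * l2w s N w * l2w s N x * l2w s N y * l2w s N z"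
proof -
  note e = emb_nonneg[OF s]
  have "(\<Sum>(k, a, b, c)\<in>quad N. wt s k * cmod (w k) * cmod (x a) * cmod (y b) * cmod (z c))
     \<le> 2 powr s * l2w s N w * l1 N y * (l2w s N x * l1 N z + l2w s N z * l1 N x)"
    using s by (intro quartic_l1) auto
  also have "\<dots> \<le> 2 powr s * l2w s N w * (emb s * l2w s N y) *
      (l2w s N x * (emb s * l2w s N z) + l2w s N z * (emb s * l2w s N x))"
    by (intro mult_mono add_mono l1_le_l2w s) (auto simp: e)
  also have "\<dots> = qc s * l2w s N w * l2w s N x * l2w s N y * l2w s N z"
    by (simp add: qc_def power2_eq_square algebra_simps)
  finally show ?thesis .
qed

text \<open>Convolution in \<open>l\<^sup>1\<close>: the outgoing frequency is determined by the three others.\<close>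

lemma trip_l1:
  fixes X Y Z :: "nat \<Rightarrow> real"
  assumes "\<And>k. X k \<ge> 0" "\<And>k. Y k \<ge> 0" "\<And>k. Z k \<ge> 0"
  shows "(\<Sum>(k, a, b, c)\<in>quad N. X a * Y b * Z c) \<le> (\<Sum>a\<le>N. X a) * (\<Sum>b\<le>N. Y b) * (\<Sum>c\<le>N. Z c)"
proof -
  have "(\<Sum>(k, a, b, c)\<in>quad N. X a * Y b * Z c) = (\<Sum>(a, b, c)\<in>snd ` quad N. X a * Y b * Z c)"
    by (subst sum.reindex) (auto simp: inj_on_def quad_iff case_prod_unfold)
  also have "\<dots> \<le> (\<Sum>(a, b, c)\<in>{..N} \<times> {..N} \<times> {..N}. X a * Y b * Z c)"
    using assms by (intro sum_mono2) (auto simp: quad_iff)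
  also have "\<dots> = (\<Sum>a\<le>N. X a) * (\<Sum>b\<le>N. Y b) * (\<Sum>c\<le>N. Z c)"
    by (simp only: sum.cartesian_product' prod.case sum_distrib_left[symmetric] sum_distrib_right[symmetric] mult.assoc)
  finally show ?thesis .
qed

section \<open>Fourier coefficients on the circle\<close>

text \<open>Lebesgue measure on one period as a measure of its own, so that the library of a finite measure
applies to the set integrals over \<open>[0, 2\<pi>]\<close>.\<close>

definition circ :: "real measure" where
  "circ = restrict_space lborel {0..2*pi}"

lemma integral_circ: "(LINT x:{0..2*pi}|lborel. f x) = integral\<^sup>L circ f"
  for f :: "real \<Rightarrow> 'a::{banach, second_countable_topology}"
  unfolding circ_def set_lebesgue_integral_def by (subst integral_restrict_space) auto

lemma integrable_circ: "set_integrable lborel {0..2*pi} f \<longleftrightarrow> integrable circ f"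
  for f :: "real \<Rightarrow> 'a::{banach, second_countable_topology}"
  unfolding circ_def set_integrable_def by (subst integrable_restrict_space) auto

lemma measurable_circ: "f \<in> borel_measurable borel \<Longrightarrow> f \<in> borel_measurable circ"
  unfolding circ_def by (intro measurable_restrict_space1) auto

lemma emeasure_circ: "emeasure circ (space circ) = ennreal (2 * pi)"
  by (simp add: circ_def emeasure_restrict_space space_restrict_space)

interpretation circ: finite_measure circ
  by standard (simp add: emeasure_circ)

lemma measure_circ: "measure circ (space circ) = 2 * pi"
  by (simp add: measure_def emeasure_circ)

lemma fourier_coeff_circ:
  "fourier_coeff f k = (\<integral>x. f x * cis (- (of_int k * x)) \<partial>circ) / of_real (2 * pi)"
  by (simp add: fourier_coeff_def integral_circ)

lemma cis_measurable [measurable]: "(\<lambda>x. cis (r * x)) \<in> borel_measurable borel"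
  by (intro borel_measurable_continuous_onI continuous_intros)

lemma cis_measurable_circ [measurable]:
  "(\<lambda>x. cis (r * x)) \<in> borel_measurable circ" "(\<lambda>x. cis (- (r * x))) \<in> borel_measurable circ"
  using measurable_circ[OF cis_measurable, of r] measurable_circ[OF cis_measurable, of "- r"] by auto

lemma integrable_times_cis:
  assumes "integrable circ f"
  shows "integrable circ (\<lambda>x. f x * cis (- (of_int k * x)))"
  by (rule Bochner_Integration.integrable_bound[OF assms]) (use assms in \<open>auto simp: norm_mult\<close>)

definition sq_int :: "(real \<Rightarrow> complex) \<Rightarrow> bool" where
  "sq_int f \<longleftrightarrow> f \<in> borel_measurable circ \<and> integrable circ (\<lambda>x. (cmod (f x))\<^sup>2)"

lemma L2_circle_sq_int: "f \<in> L2_circle \<Longrightarrow> sq_int f"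
  by (simp add: L2_circle_def sq_int_def integrable_circ measurable_circ)

lemma sq_int_bounded:
  assumes "f \<in> borel_measurable circ" "\<And>x. cmod (f x) \<le> B"
  shows "sq_int f"
  unfolding sq_int_def
proof safe
  show "integrable circ (\<lambda>x. (cmod (f x))\<^sup>2)"
  proof (rule circ.integrable_const_bound[of _ "B\<^sup>2"])
    show "AE x in circ. norm ((cmod (f x))\<^sup>2) \<le> B\<^sup>2"
      using assms(2) by (auto intro!: power_mono)
  qed (use assms(1) in measurable)
qed fact

lemma sq_int_integrable:
  assumes "sq_int f" shows "integrable circ f"
proof (rule Bochner_Integration.integrable_bound)
  show "integrable circ (\<lambda>x. 1 + (cmod (f x))\<^sup>2)"
    using assms by (auto simp: sq_int_def)
  have "t \<le> 1 + t\<^sup>2" if "t \<ge> 0" for t :: real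
  proof (cases "t \<le> 1")
    case False then have "1 * t \<le> t * t" by (intro mult_right_mono) auto
    then show ?thesis by (simp add: power2_eq_square)
  qed (simp add: add_increasing2)
  then have "cmod (f x) \<le> \<bar>1 + (cmod (f x))\<^sup>2\<bar>" for x
    using norm_ge_zero abs_ge_self order_trans by blast
  then show "AE x in circ. norm (f x) \<le> norm (1 + (cmod (f x))\<^sup>2)" by simp
  show "f \<in> borel_measurable circ" using assms by (simp add: sq_int_def)
qed

lemma sq_int_diff:
  assumes "sq_int f" "sq_int g" shows "sq_int (\<lambda>x. f x - g x)"
  unfolding sq_int_def
proof safe
  have [measurable]: "f \<in> borel_measurable circ" "g \<in> borel_measurable circ"
    using assms by (auto simp: sq_int_def)
  show "(\<lambda>x. f x - g x) \<in> borel_measurable circ" by measurable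
  show "integrable circ (\<lambda>x. (cmod (f x - g x))\<^sup>2)"
  proof (rule Bochner_Integration.integrable_bound)
    show "integrable circ (\<lambda>x. 2 * (cmod (f x))\<^sup>2 + 2 * (cmod (g x))\<^sup>2)"
      using assms by (auto simp: sq_int_def)
    have "(cmod (f x - g x))\<^sup>2 \<le> 2 * (cmod (f x))\<^sup>2 + 2 * (cmod (g x))\<^sup>2" for x
    proof -
      have "(cmod (f x - g x))\<^sup>2 \<le> (cmod (f x) + cmod (g x))\<^sup>2"
        by (intro power_mono norm_triangle_ineq4) auto
      also have "\<dots> \<le> 2 * (cmod (f x))\<^sup>2 + 2 * (cmod (g x))\<^sup>2"
        using sum_squares_bound[of "cmod (f x)" "cmod (g x)"] by (simp add: power2_sum)
      finally show ?thesis .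
    qed
    then show "AE x in circ. norm ((cmod (f x - g x))\<^sup>2) \<le> norm (2 * (cmod (f x))\<^sup>2 + 2 * (cmod (g x))\<^sup>2)"
      by auto
  qed measurable
qed

lemma fourier_coeff_diff:
  assumes "integrable circ f" "integrable circ g"
  shows "fourier_coeff (\<lambda>x. f x - g x) k = fourier_coeff f k - fourier_coeff g k"
  using integrable_times_cis[OF assms(1), of k] integrable_times_cis[OF assms(2), of k]
  by (simp add: fourier_coeff_circ left_diff_distrib diff_divide_distrib)

lemma fourier_coeff_sum:
  assumes "\<And>i. i \<in> I \<Longrightarrow> integrable circ (f i)"
  shows "fourier_coeff (\<lambda>x. \<Sum>i\<in>I. f i x) k = (\<Sum>i\<in>I. fourier_coeff (f i) k)"
  using integrable_times_cis[OF assms, of _ k]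
  by (simp add: fourier_coeff_circ sum_distrib_right sum_divide_distrib)

text \<open>A form of the Cauchy-Schwarz inequality with a free parameter \<open>l\<close>, from the pointwise bound
\<open>|f| \<le> l + |f|\<^sup>2 / l\<close>; it is enough to pass to limits in \<open>L\<^sup>2\<close>.\<close>

lemma fourier_coeff_bound:
  assumes "sq_int f" "l > 0"
  shows "cmod (fourier_coeff f k) \<le> l + (\<integral>x. (cmod (f x))\<^sup>2 \<partial>circ) / (2 * pi * l)"
proof -
  have sq: "integrable circ (\<lambda>x. (cmod (f x))\<^sup>2)" using assms by (simp add: sq_int_def)
  have "cmod (\<integral>x. f x * cis (- (of_int k * x)) \<partial>circ) \<le> (\<integral>x. norm (f x * cis (- (of_int k * x))) \<partial>circ)"
    by (rule integral_norm_bound)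
  also have "\<dots> = (\<integral>x. cmod (f x) \<partial>circ)" by (simp add: norm_mult)
  also have "\<dots> \<le> (\<integral>x. l + (cmod (f x))\<^sup>2 / l \<partial>circ)"
  proof (rule integral_mono)
    show "integrable circ (\<lambda>x. cmod (f x))" using sq_int_integrable[OF assms(1)] by simp
    show "integrable circ (\<lambda>x. l + (cmod (f x))\<^sup>2 / l)" using sq by simp
    fix x show "cmod (f x) \<le> l + (cmod (f x))\<^sup>2 / l"
    proof (cases "cmod (f x) \<le> l")
      case False
      then have "l * cmod (f x) \<le> cmod (f x) * cmod (f x)" by (intro mult_right_mono) auto
      then show ?thesis using assms(2) by (simp add: field_simps power2_eq_square add_increasing)
    qed (use assms(2) in \<open>simp add: add_increasing2\<close>)
  qed
  also have "\<dots> = 2 * pi * l + (\<integral>x. (cmod (f x))\<^sup>2 \<partial>circ) / l"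
    using sq by (simp add: measure_circ)
  finally have "cmod (\<integral>x. f x * cis (- (of_int k * x)) \<partial>circ) / (2 * pi)
     \<le> (2 * pi * l + (\<integral>x. (cmod (f x))\<^sup>2 \<partial>circ) / l) / (2 * pi)"
    by (rule divide_right_mono) simp
  also have "\<dots> = l + (\<integral>x. (cmod (f x))\<^sup>2 \<partial>circ) / (2 * pi * l)"
    using assms(2) by (simp add: field_simps)
  finally show ?thesis
    by (simp add: fourier_coeff_circ norm_divide norm_mult)
qed

lemma fourier_coeff_L2_limit:
  assumes f: "sq_int f" and h: "\<And>n. sq_int (h n)"
    and lim: "(\<lambda>n. \<integral>x. (cmod (f x - h n x))\<^sup>2 \<partial>circ) \<longlonglongrightarrow> 0"
  shows "(\<lambda>n. fourier_coeff (h n) k) \<longlonglongrightarrow> fourier_coeff f k"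
proof (rule LIMSEQ_I)
  fix r :: real assume r: "r > 0"
  define l where "l = r / 2"
  have l: "l > 0" using r by (simp add: l_def)
  obtain n0 where n0: "\<And>n. n \<ge> n0 \<Longrightarrow> \<bar>\<integral>x. (cmod (f x - h n x))\<^sup>2 \<partial>circ\<bar> < 2 * pi * l * l"
    using LIMSEQ_D[OF lim, of "2 * pi * l * l"] l by auto
  show "\<exists>no. \<forall>n\<ge>no. norm (fourier_coeff (h n) k - fourier_coeff f k) < r"
  proof (intro exI allI impI)
    fix n assume "n0 \<le> n"
    from n0[OF this] have "(\<integral>x. (cmod (f x - h n x))\<^sup>2 \<partial>circ) / (2 * pi * l) < l"
      using l by (simp add: field_simps)
    moreover have "cmod (fourier_coeff (\<lambda>x. f x - h n x) k) \<le> l + (\<integral>x. (cmod (f x - h n x))\<^sup>2 \<partial>circ) / (2 * pi * l)"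
      by (intro fourier_coeff_bound sq_int_diff f h l)
    ultimately have "cmod (fourier_coeff f k - fourier_coeff (h n) k) < l + l"
      using f h by (simp add: fourier_coeff_diff sq_int_integrable)
    then show "norm (fourier_coeff (h n) k - fourier_coeff f k) < r"
      by (simp add: l_def norm_minus_commute)
  qed
qed

lemma L2_limit_uniform:
  assumes f: "f \<in> borel_measurable circ" and h: "\<And>n. h n \<in> borel_measurable circ"
    and bd: "\<And>n x. cmod (f x - h n x) \<le> e n" and e: "e \<longlonglongrightarrow> 0"
  shows "(\<lambda>n. \<integral>x. (cmod (f x - h n x))\<^sup>2 \<partial>circ) \<longlonglongrightarrow> 0"
proof (rule Lim_null_comparison)
  note [measurable] = f h
  show "\<forall>\<^sub>F n in sequentially. norm (\<integral>x. (cmod (f x - h n x))\<^sup>2 \<partial>circ) \<le> 2 * pi * (e n)\<^sup>2"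
  proof (rule always_eventually, rule allI)
    fix n
    have sq: "(cmod (f x - h n x))\<^sup>2 \<le> (e n)\<^sup>2" for x using bd by (intro power_mono) auto
    have "(\<integral>x. (cmod (f x - h n x))\<^sup>2 \<partial>circ) \<le> (\<integral>x. (e n)\<^sup>2 \<partial>circ)"
      by (rule integral_mono) (auto intro!: sq circ.integrable_const_bound[of _ "(e n)\<^sup>2"])
    then show "norm (\<integral>x. (cmod (f x - h n x))\<^sup>2 \<partial>circ) \<le> 2 * pi * (e n)\<^sup>2"
      by (simp add: measure_circ)
  qed
  show "(\<lambda>n. 2 * pi * (e n)\<^sup>2) \<longlonglongrightarrow> 0" by (rule tendsto_eq_intros e refl | simp)+
qed

lemma has_vector_derivative_cis_mult:
  "((\<lambda>x. cis (r * x)) has_vector_derivative (\<i> * of_real r * cis (r * x))) (at x within S)"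
proof -
  have "((\<lambda>z. exp (\<i> * of_real r * z)) has_field_derivative
      (\<i> * of_real r * exp (\<i> * of_real r * of_real x))) (at (of_real x))"
    by (auto intro!: derivative_eq_intros)
  from has_vector_derivative_real_field[OF this, of S] show ?thesis
    by (simp add: cis_conv_exp mult_ac)
qed

lemma integral_cis_circ:
  fixes j :: int
  shows "(\<integral>x. cis (of_int j * x) \<partial>circ) = (if j = 0 then of_real (2 * pi) else 0)"
proof (cases "j = 0")
  case True then show ?thesis by (simp add: measure_circ scaleR_conv_of_real)
next
  case False
  define F where "F = (\<lambda>x::real. cis (of_int j * x) / (\<i> * of_int j))"
  have "(F has_vector_derivative (\<i> * of_real (of_int j) * cis (of_int j * x)) / (\<i> * of_int j)) (at x within {0..2*pi})" for x
    unfolding F_def by (intro has_vector_derivative_divide has_vector_derivative_cis_mult)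
  then have "(F has_vector_derivative cis (of_int j * x)) (at x within {0..2*pi})" for x
    using False by simp
  then have "(LBINT x. indicator {0..2*pi} x *\<^sub>R cis (of_int j * x)) = F (2*pi) - F 0"
    by (intro integral_FTC_Icc continuous_intros) auto
  also have "F (2*pi) = F 0"
    using cis_multiple_2pi[of "of_int j"] by (simp add: F_def mult_ac)
  finally show ?thesis using False
    by (simp flip: integral_circ add: set_lebesgue_integral_def)
qed

lemma fourier_coeff_monomial:
  "fourier_coeff (\<lambda>x. c * cis (of_int j * x)) k = (if j = k then c else 0)"
proof -
  have "(\<lambda>x. c * cis (of_int j * x) * cis (- (of_int k * x))) = (\<lambda>x. c * cis (of_int (j - k) * x))"
    by (auto simp: cis_mult algebra_simps)
  then show ?thesis by (simp add: fourier_coeff_circ integral_cis_circ del: of_int_diff)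
qed

lemma monomial_integrable: "integrable circ (\<lambda>x. c * cis (r * x))"
  by (rule sq_int_integrable, rule sq_int_bounded[of _ "cmod c"]) (auto simp: norm_mult)

lemma trig_sum_measurable: "(\<lambda>x. \<Sum>k\<in>I. c k * cis (real k * x)) \<in> borel_measurable circ"
  by measurable

lemma trig_sum_sq_int: "sq_int (\<lambda>x. \<Sum>k\<in>I. c k * cis (real k * x))"
  by (rule sq_int_bounded[of _ "\<Sum>k\<in>I. cmod (c k)"])
     (auto simp: norm_mult intro!: order_trans[OF norm_sum])

lemma fourier_coeff_trig_sum:
  assumes "finite I"
  shows "fourier_coeff (\<lambda>x. \<Sum>k\<in>I. c k * cis (real k * x)) j
           = (if j \<ge> 0 \<and> nat j \<in> I then c (nat j) else 0)"
proof -
  have "fourier_coeff (\<lambda>x. \<Sum>k\<in>I. c k * cis (real k * x)) j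
      = (\<Sum>k\<in>I. fourier_coeff (\<lambda>x. c k * cis (real k * x)) j)"
    by (intro fourier_coeff_sum monomial_integrable)
  also have "\<dots> = (\<Sum>k\<in>I. if int k = j then c k else 0)"
    using fourier_coeff_monomial[of _ "int _" j] by (intro sum.cong refl) simp
  also have "\<dots> = (\<Sum>k\<in>I. if j \<ge> 0 \<and> nat j = k then c k else 0)"
    by (intro sum.cong) auto
  also have "\<dots> = (if j \<ge> 0 \<and> nat j \<in> I then c (nat j) else 0)"
    using assms by (cases "j \<ge> 0") (auto simp: sum.delta)
  finally show ?thesis .
qed

section \<open>Absolutely convergent Fourier series and the cubic term\<close>

text \<open>Absolutely summable coefficients: the Wiener algebra of the circle, restricted to nonnegative
frequencies.\<close>

abbreviation ell1 :: "(nat \<Rightarrow> complex) \<Rightarrow> bool" where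
  "ell1 c \<equiv> summable (\<lambda>k. cmod (c k))"

abbreviation l1_norm :: "(nat \<Rightarrow> complex) \<Rightarrow> real" where
  "l1_norm c \<equiv> (\<Sum>k. cmod (c k))"

abbreviation fcoeffs :: "(real \<Rightarrow> complex) \<Rightarrow> nat \<Rightarrow> complex" where
  "fcoeffs f \<equiv> (\<lambda>k. fourier_coeff f (int k))"

definition fser :: "(nat \<Rightarrow> complex) \<Rightarrow> real \<Rightarrow> complex" where
  "fser c x = (\<Sum>k. c k * cis (real k * x))"

lemma fser_partial_error:
  assumes "ell1 c"
  shows "cmod (fser c x - (\<Sum>k\<le>N. c k * cis (real k * x))) \<le> l1_norm c - (\<Sum>k\<le>N. cmod (c k))"
proof -
  have sn: "summable (\<lambda>k. norm (c k * cis (real k * x)))" using assms by (simp add: norm_mult)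
  note s = summable_norm_cancel[OF sn]
  have "fser c x - (\<Sum>k\<le>N. c k * cis (real k * x)) = (\<Sum>k. c (k + Suc N) * cis (real (k + Suc N) * x))"
    unfolding fser_def by (subst suminf_minus_initial_segment[OF s]) (simp add: lessThan_Suc_atMost)
  also have "cmod \<dots> \<le> (\<Sum>k. norm (c (k + Suc N) * cis (real (k + Suc N) * x)))"
    by (rule summable_norm) (use sn in \<open>subst summable_iff_shift\<close>)
  also have "\<dots> = l1_norm (\<lambda>k. c (k + Suc N))" by (simp add: norm_mult)
  also have "\<dots> = l1_norm c - (\<Sum>k\<le>N. cmod (c k))"
    by (subst suminf_minus_initial_segment[OF assms]) (simp add: lessThan_Suc_atMost)
  finally show ?thesis .
qed

lemma l1_tail_tendsto:
  assumes "ell1 c"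
  shows "(\<lambda>N. l1_norm c - (\<Sum>k\<le>N. cmod (c k))) \<longlonglongrightarrow> 0"
  using tendsto_diff[OF tendsto_const summable_LIMSEQ'[OF assms], of "\<Sum>k. cmod (c k)"] by simp

lemma fser_bound:
  assumes "ell1 c"
  shows "cmod (fser c x) \<le> l1_norm c"
  unfolding fser_def by (rule order_trans[OF summable_norm]) (use assms in \<open>auto simp: norm_mult\<close>)

lemma trig_sum_bound:
  assumes "ell1 c"
  shows "cmod (\<Sum>k\<le>N. c k * cis (real k * x)) \<le> l1_norm c"
proof -
  have "cmod (\<Sum>k\<le>N. c k * cis (real k * x)) \<le> (\<Sum>k\<le>N. cmod (c k))"
    by (rule order_trans[OF norm_sum]) (simp add: norm_mult)
  also have "\<dots> \<le> l1_norm c" by (intro sum_le_suminf assms) auto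
  finally show ?thesis .
qed

lemma fser_measurable: "fser c \<in> borel_measurable borel"
proof -
  have "(\<lambda>x. \<Sum>k. c k * cis (real k * x)) \<in> borel_measurable borel"
    using cis_measurable by measurable
  then show ?thesis by (simp add: fser_def[abs_def])
qed

lemma fser_sq_int: "ell1 c \<Longrightarrow> sq_int (fser c)"
  by (intro sq_int_bounded[OF _ fser_bound] measurable_circ fser_measurable)

lemma fser_periodic: "periodic_2pi (fser c)"
proof -
  have "cis (real k * (x + 2 * pi)) = cis (real k * x)" for k x
    using cis_multiple_2pi[of "real k"] by (simp add: ring_distribs cis_mult[symmetric] mult_ac)
  then show ?thesis by (simp add: periodic_2pi_def fser_def)
qed

lemma fser_L2_circle:
  assumes "ell1 c" shows "fser c \<in> L2_circle"
  using fser_sq_int[OF assms] fser_periodic by (auto simp: L2_circle_def sq_int_def integrable_circ fser_measurable)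

lemma fser_L2_limit:
  assumes "ell1 c"
  shows "(\<lambda>N. \<integral>x. (cmod (fser c x - (\<Sum>k\<le>N. c k * cis (real k * x))))\<^sup>2 \<partial>circ) \<longlonglongrightarrow> 0"
  by (rule L2_limit_uniform[OF _ _ fser_partial_error[OF assms] l1_tail_tendsto[OF assms]])
     (simp_all add: measurable_circ trig_sum_measurable fser_measurable)

lemma fourier_coeff_fser:
  assumes "ell1 c"
  shows "fourier_coeff (fser c) j = (if j \<ge> 0 then c (nat j) else 0)"
proof -
  have "(\<lambda>N. fourier_coeff (\<lambda>x. \<Sum>k\<le>N. c k * cis (real k * x)) j) \<longlonglongrightarrow> fourier_coeff (fser c) j"
    by (rule fourier_coeff_L2_limit[OF fser_sq_int trig_sum_sq_int fser_L2_limit]) (rule assms)+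
  moreover have "\<forall>\<^sub>F N in sequentially. fourier_coeff (\<lambda>x. \<Sum>k\<le>N. c k * cis (real k * x)) j
      = (if j \<ge> 0 then c (nat j) else 0)"
    using eventually_ge_at_top[of "nat j"] by eventually_elim (auto simp: fourier_coeff_trig_sum)
  then have "(\<lambda>N. fourier_coeff (\<lambda>x. \<Sum>k\<le>N. c k * cis (real k * x)) j) \<longlonglongrightarrow> (if j \<ge> 0 then c (nat j) else 0)"
    by (rule tendsto_eventually)
  ultimately show ?thesis by (rule LIMSEQ_unique)
qed

lemma is_szego_L2_limit:
  assumes "is_szego f g"
  shows "sq_int g"
    "(\<lambda>N. \<integral>x. (cmod (g x - (\<Sum>k\<le>N. fourier_coeff f (int k) * cis (real k * x))))\<^sup>2 \<partial>circ) \<longlonglongrightarrow> 0"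
  using assms by (simp_all add: is_szego_def L2_circle_sq_int integral_circ)

text \<open>Convergence in \<open>L\<^sup>2\<close> implies convergence of each coefficient, and those of the partial sums are
eventually constant.\<close>

lemma fourier_coeff_is_szego:
  assumes "is_szego f g"
  shows "fourier_coeff g j = (if j \<ge> 0 then fourier_coeff f j else 0)"
proof -
  let ?S = "\<lambda>N x. \<Sum>k\<le>N. fourier_coeff f (int k) * cis (real k * x)"
  have "(\<lambda>N. fourier_coeff (?S N) j) \<longlonglongrightarrow> fourier_coeff g j"
    using is_szego_L2_limit[OF assms] by (intro fourier_coeff_L2_limit trig_sum_sq_int)
  moreover have "\<forall>\<^sub>F N in sequentially. fourier_coeff (?S N) j = (if j \<ge> 0 then fourier_coeff f j else 0)"
    using eventually_ge_at_top[of "nat j"] by eventually_elim (auto simp: fourier_coeff_trig_sum)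
  then have "(\<lambda>N. fourier_coeff (?S N) j) \<longlonglongrightarrow> (if j \<ge> 0 then fourier_coeff f j else 0)"
    by (rule tendsto_eventually)
  ultimately show ?thesis by (rule LIMSEQ_unique)
qed

lemma L2_limit_unique_AE:
  assumes f: "sq_int f" and g: "sq_int g" and h: "\<And>n. sq_int (h n)"
    and "(\<lambda>n. \<integral>x. (cmod (f x - h n x))\<^sup>2 \<partial>circ) \<longlonglongrightarrow> 0"
    and "(\<lambda>n. \<integral>x. (cmod (g x - h n x))\<^sup>2 \<partial>circ) \<longlonglongrightarrow> 0"
  shows "AE x in circ. f x = g x"
proof -
  have int: "integrable circ (\<lambda>x. (cmod (f x - g x))\<^sup>2)"
      "integrable circ (\<lambda>x. (cmod (f x - h n x))\<^sup>2)" "integrable circ (\<lambda>x. (cmod (g x - h n x))\<^sup>2)" for n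
    using sq_int_diff f g h by (auto simp: sq_int_def)
  have "(\<integral>x. (cmod (f x - g x))\<^sup>2 \<partial>circ)
      \<le> 2 * (\<integral>x. (cmod (f x - h n x))\<^sup>2 \<partial>circ) + 2 * (\<integral>x. (cmod (g x - h n x))\<^sup>2 \<partial>circ)" for n
  proof -
    have "(cmod (f x - g x))\<^sup>2 \<le> 2 * (cmod (f x - h n x))\<^sup>2 + 2 * (cmod (g x - h n x))\<^sup>2" for x
    proof -
      have "cmod (f x - g x) \<le> cmod (f x - h n x) + cmod (g x - h n x)"
        using norm_triangle_ineq4[of "f x - h n x" "g x - h n x"] by simp
      then have "(cmod (f x - g x))\<^sup>2 \<le> (cmod (f x - h n x) + cmod (g x - h n x))\<^sup>2"
        by (intro power_mono) auto
      also have "\<dots> \<le> 2 * (cmod (f x - h n x))\<^sup>2 + 2 * (cmod (g x - h n x))\<^sup>2"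
        using sum_squares_bound[of "cmod (f x - h n x)" "cmod (g x - h n x)"] by (simp add: power2_sum)
      finally show ?thesis .
    qed
    then have "(\<integral>x. (cmod (f x - g x))\<^sup>2 \<partial>circ) 
      \<le> (\<integral>x. 2 * (cmod (f x - h n x))\<^sup>2 + 2 * (cmod (g x - h n x))\<^sup>2 \<partial>circ)"
      using int by (intro integral_mono) auto
    then show ?thesis using int by simp
  qed
  moreover have "(\<lambda>n. 2 * (\<integral>x. (cmod (f x - h n x))\<^sup>2 \<partial>circ) + 2 * (\<integral>x. (cmod (g x - h n x))\<^sup>2 \<partial>circ)) \<longlonglongrightarrow> 2 * 0 + 2 * 0"
    by (intro tendsto_intros assms)
  ultimately have "(\<integral>x. (cmod (f x - g x))\<^sup>2 \<partial>circ) \<le> 0"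
    by (intro LIMSEQ_le_const[where X = "\<lambda>n. 2 * (\<integral>x. (cmod (f x - h n x))\<^sup>2 \<partial>circ) + 2 * (\<integral>x. (cmod (g x - h n x))\<^sup>2 \<partial>circ)"]) auto
  then have "(\<integral>x. (cmod (f x - g x))\<^sup>2 \<partial>circ) = 0"
    by (intro antisym) auto
  then have "AE x in circ. (cmod (f x - g x))\<^sup>2 = 0"
    by (subst (asm) integral_nonneg_eq_0_iff_AE[OF int(1)]) auto
  then show ?thesis by eventually_elim auto
qed

text \<open>Membership in \<open>L\<^sup>2\<^sub>+\<close> means that the partial sums converge in \<open>L\<^sup>2\<close>.  When they also converge uniformly
the two limits agree almost everywhere.\<close>

lemma L2_plus_AE_fser:
  assumes g: "g \<in> L2_plus" and s: "ell1 (fcoeffs g)"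
  shows "AE x in circ. g x = fser (fcoeffs g) x"
proof -
  obtain f where f: "is_szego f g" using g by (auto simp: L2_plus_def)
  have "fourier_coeff f (int k) = fourier_coeff g (int k)" for k
    using fourier_coeff_is_szego[OF f] by simp
  then have "(\<lambda>N. \<integral>x. (cmod (g x - (\<Sum>k\<le>N. fourier_coeff g (int k) * cis (real k * x))))\<^sup>2 \<partial>circ) \<longlonglongrightarrow> 0"
    using is_szego_L2_limit(2)[OF f] by simp
  then show ?thesis
    by (intro L2_limit_unique_AE[OF _ fser_sq_int trig_sum_sq_int _ fser_L2_limit] is_szego_L2_limit(1)[OF f] s)
qed

lemma fourier_coeff_L2_plus_neg: "g \<in> L2_plus \<Longrightarrow> j < 0 \<Longrightarrow> fourier_coeff g j = 0"
  by (auto simp: L2_plus_def fourier_coeff_is_szego)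

lemma is_szego_fser:
  assumes "ell1 (fcoeffs f)"
  shows "is_szego f (fser (fcoeffs f))"
  using fser_L2_circle[OF assms] fser_L2_limit[OF assms] by (simp add: is_szego_def integral_circ)

text \<open>The projection is given by a choice operator; for summable coefficients the Fourier series itself is an
admissible choice, so the choice is a genuine projection.\<close>

lemma fourier_coeff_szego:
  assumes "ell1 (fcoeffs f)"
  shows "fourier_coeff (szego f) (int k) = fourier_coeff f (int k)"
proof -
  have "is_szego f (szego f)"
    unfolding szego_def by (rule someI[of "is_szego f"], rule is_szego_fser[OF assms])
  then show ?thesis by (simp add: fourier_coeff_is_szego)
qed

lemma cnj_measurable [measurable]: "cnj \<in> borel_measurable borel"
  by (intro borel_measurable_continuous_onI continuous_intros)

lemma cmod_cubic_diff:
  fixes u v :: complex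
  assumes "cmod u \<le> B" "cmod v \<le> B"
  shows "cmod (u * cnj u * u - v * cnj v * v) \<le> 3 * B\<^sup>2 * cmod (u - v)"
proof -
  have B: "B \<ge> 0" using assms norm_ge_zero order_trans by blast
  have "u * cnj u * u - v * cnj v * v = (u - v) * cnj u * u + v * cnj (u - v) * u + v * cnj v * (u - v)"
    by (simp add: algebra_simps)
  also have "cmod \<dots> \<le> cmod ((u - v) * cnj u * u) + cmod (v * cnj (u - v) * u) + cmod (v * cnj v * (u - v))"
    by (intro norm_triangle_le add_mono order_refl norm_triangle_ineq)
  also have "\<dots> = cmod u * cmod u * cmod (u - v) + cmod v * cmod u * cmod (u - v) + cmod v * cmod v * cmod (u - v)"
    by (simp add: norm_mult mult_ac del: complex_cnj_diff)
  also have "\<dots> \<le> B * B * cmod (u - v) + B * B * cmod (u - v) + B * B * cmod (u - v)"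
    by (intro add_mono mult_right_mono mult_mono assms B) auto
  finally show ?thesis by (simp add: power2_eq_square algebra_simps)
qed

lemma fourier_coeff_cubic_trig:
  fixes c :: "nat \<Rightarrow> complex"
  defines "S \<equiv> \<lambda>N x. \<Sum>k\<le>N. c k * cis (real k * x)"
  shows "fourier_coeff (\<lambda>x. S N x * cnj (S N x) * S N x) (int k) = cub N c k"
proof -
  let ?I = "{..N} \<times> {..N} \<times> {..N}"
  have "S N x * cnj (S N x) * S N x = 
     (\<Sum>(a, b, d)\<in>?I. c a * cnj (c b) * c d * cis (of_int (int a - int b + int d) * x))" for x
  proof -
    have "S N x * cnj (S N x) * S N x = (\<Sum>a\<le>N. \<Sum>b\<le>N. \<Sum>d\<le>N. (c a * cis (real a * x)) * cnj (c b * cis (real b * x)) * (c d * cis (real d * x)))"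
    proof -
      have "S N x * Y = (\<Sum>a\<le>N. c a * cis (real a * x) * Y)"
        "cnj (S N x) * Y = (\<Sum>b\<le>N. cnj (c b * cis (real b * x)) * Y)" for Y
        by (simp_all only: S_def cnj_sum sum_distrib_right)
      from this(1)[of "cnj (S N x) * S N x"] this(2)[of "S N x"]
      have "S N x * cnj (S N x) * S N x
          = (\<Sum>a\<le>N. c a * cis (real a * x) * (\<Sum>b\<le>N. cnj (c b * cis (real b * x)) * S N x))"
        by (simp only: mult.assoc)
      then show ?thesis by (simp only: S_def sum_distrib_left mult.assoc)
    qed
    also have "\<dots> = (\<Sum>a\<le>N. \<Sum>b\<le>N. \<Sum>d\<le>N. c a * cnj (c b) * c d * cis (of_int (int a - int b + int d) * x))"
    proof (intro sum.cong refl)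
      fix a b d
      have "cis (of_int (int a - int b + int d) * x) = cis (real a * x) * cis (- (real b * x)) * cis (real d * x)"
        by (simp add: cis_mult algebra_simps)
      then show "(c a * cis (real a * x)) * cnj (c b * cis (real b * x)) * (c d * cis (real d * x))
        = c a * cnj (c b) * c d * cis (of_int (int a - int b + int d) * x)"
        by (simp add: cis_cnj mult_ac)
    qed
    finally show ?thesis by (simp add: sum.cartesian_product')
  qed
  then have "fourier_coeff (\<lambda>x. S N x * cnj (S N x) * S N x) (int k)
     = fourier_coeff (\<lambda>x. \<Sum>p\<in>?I. (case p of (a, b, d) \<Rightarrow> c a * cnj (c b) * c d * cis (of_int (int a - int b + int d) * x))) (int k)"
    by simp
  also have "\<dots> = (\<Sum>p\<in>?I. fourier_coeff (\<lambda>x. case p of (a, b, d) \<Rightarrow> c a * cnj (c b) * c d * cis (of_int (int a - int b + int d) * x)) (int k))"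
    by (rule fourier_coeff_sum) (auto simp: case_prod_unfold intro!: monomial_integrable)
  also have "\<dots> = (\<Sum>p\<in>?I. case p of (a, b, d) \<Rightarrow> if int a - int b + int d = int k then c a * cnj (c b) * c d else 0)"
    by (intro sum.cong refl) (auto simp only: case_prod_unfold fourier_coeff_monomial)
  also have "\<dots> = (\<Sum>p\<in>trip N k. case p of (a, b, d) \<Rightarrow> c a * cnj (c b) * c d)"
    by (rule sum.mono_neutral_cong_right) (auto simp: trip_def split: if_splits)
  finally show ?thesis by (simp add: cub_def)
qed

text \<open>The cubic convolution of an infinite sequence is obtained as the limit of its finite truncations, which
avoids triple series altogether.  The limit exists because \<open>z \<mapsto> |z|\<^sup>2 z\<close> is Lipschitz on bounded sets and
the partial sums converge uniformly.\<close>

lemma cub_tendsto: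
  assumes s: "ell1 c"
  shows "(\<lambda>N. cub N c k) \<longlonglongrightarrow> fourier_coeff (\<lambda>x. fser c x * cnj (fser c x) * fser c x) (int k)"
proof -
  define S where "S = (\<lambda>N x. \<Sum>k\<le>N. c k * cis (real k * x))"
  define A where "A = l1_norm c"
  define e where "e N = 3 * A\<^sup>2 * (l1_norm c - (\<Sum>k\<le>N. cmod (c k)))" for N
  have [measurable]: "S N \<in> borel_measurable circ" "fser c \<in> borel_measurable circ" for N
    by (simp_all add: S_def trig_sum_measurable measurable_circ fser_measurable)
  have bS: "cmod (S N x) \<le> A" and bf: "cmod (fser c x) \<le> A" for N x
    unfolding S_def A_def using trig_sum_bound fser_bound s by auto
  have A0: "A \<ge> 0" using bf[of 0] norm_ge_zero order_trans by blast
  have b3: "cmod (z * cnj z * z) \<le> A * A * A" if "cmod z \<le> A" for z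
    using that A0 by (auto simp: norm_mult intro!: mult_mono)
  have e: "e \<longlonglongrightarrow> 0"
    unfolding e_def using tendsto_mult_left[OF l1_tail_tendsto[OF s], of "3 * A\<^sup>2"] by simp
  have bd: "cmod (fser c x * cnj (fser c x) * fser c x - S N x * cnj (S N x) * S N x) \<le> e N" for N x
  proof -
    have "cmod (fser c x * cnj (fser c x) * fser c x - S N x * cnj (S N x) * S N x) \<le> 3 * A\<^sup>2 * cmod (fser c x - S N x)"
      by (rule cmod_cubic_diff[OF bf bS])
    also have "\<dots> \<le> e N" unfolding e_def S_def
      by (rule mult_left_mono[OF fser_partial_error[OF s]]) simp
    finally show ?thesis .
  qed
  have "(\<lambda>N. fourier_coeff (\<lambda>x. S N x * cnj (S N x) * S N x) (int k)) \<longlonglongrightarrow> fourier_coeff (\<lambda>x. fser c x * cnj (fser c x) * fser c x) (int k)"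
  proof (rule fourier_coeff_L2_limit)
    show "sq_int (\<lambda>x. fser c x * cnj (fser c x) * fser c x)" by (rule sq_int_bounded[OF _ b3[OF bf]]) measurable
    show "sq_int (\<lambda>x. S N x * cnj (S N x) * S N x)" for N by (rule sq_int_bounded[OF _ b3[OF bS]]) measurable
    show "(\<lambda>N. \<integral>x. (cmod (fser c x * cnj (fser c x) * fser c x - S N x * cnj (S N x) * S N x))\<^sup>2 \<partial>circ) \<longlonglongrightarrow> 0"
      by (rule L2_limit_uniform[OF _ _ bd e]) measurable
  qed
  then show ?thesis by (simp only: S_def fourier_coeff_cubic_trig)
qed

lemma sum_cub_le_l1: "(\<Sum>k\<le>M. cmod (cub M c k)) \<le> (l1 M c) ^ 3"
proof -
  have "(\<Sum>k\<le>M. cmod (cub M c k)) \<le> (\<Sum>k\<le>M. \<Sum>(a, b, d)\<in>trip M k. cmod (c a) * cmod (c b) * cmod (c d))"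
    unfolding cub_def by (intro sum_mono order_trans[OF norm_sum]) (auto simp: norm_mult case_prod_unfold)
  also have "\<dots> = (\<Sum>(k, a, b, d)\<in>quad M. cmod (c a) * cmod (c b) * cmod (c d))" by (rule sum_trip_quad)
  also have "\<dots> \<le> (\<Sum>a\<le>M. cmod (c a)) * (\<Sum>b\<le>M. cmod (c b)) * (\<Sum>d\<le>M. cmod (c d))"
    by (rule trip_l1) auto
  finally show ?thesis by (simp add: l1_def power3_eq_cube)
qed

text \<open>Summability of the coefficients of the cubic term, which makes its projection meaningful.\<close>

lemma summable_cub_limit:
  assumes s: "ell1 c" and F: "\<And>k. (\<lambda>N. cub N c k) \<longlonglongrightarrow> F k"
  shows "ell1 F"
proof (rule summableI_nonneg_bounded[where x = "l1_norm c ^ 3"])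
  fix n
  show "(\<Sum>k<n. cmod (F k)) \<le> l1_norm c ^ 3"
  proof (rule LIMSEQ_le_const2)
    show "(\<lambda>N. \<Sum>k<n. cmod (cub N c k)) \<longlonglongrightarrow> (\<Sum>k<n. cmod (F k))"
      by (intro tendsto_intros F)
    show "\<exists>M. \<forall>N\<ge>M. (\<Sum>k<n. cmod (cub N c k)) \<le> l1_norm c ^ 3"
    proof (intro exI allI impI)
      fix N assume "n \<le> N"
      then have "(\<Sum>k<n. cmod (cub N c k)) \<le> (\<Sum>k\<le>N. cmod (cub N c k))" by (intro sum_mono2) auto
      also have "\<dots> \<le> (l1 N c) ^ 3" by (rule sum_cub_le_l1)
      also have "\<dots> \<le> l1_norm c ^ 3"
        unfolding l1_def by (intro power_mono sum_le_suminf s sum_nonneg) auto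
      finally show "(\<Sum>k<n. cmod (cub N c k)) \<le> l1_norm c ^ 3" .
    qed
  qed
qed auto

lemma cub_tendsto_szego:
  assumes g: "g \<in> L2_plus" and s: "ell1 (fcoeffs g)"
  shows "(\<lambda>N. cub N (fcoeffs g) k)
     \<longlonglongrightarrow> fourier_coeff (szego (\<lambda>x. of_real ((cmod (g x))\<^sup>2) * g x)) (int k)"
proof -
  let ?c = "\<lambda>k. fourier_coeff g (int k)"
  let ?G = "\<lambda>x. of_real ((cmod (g x))\<^sup>2) * g x"
  have [measurable]: "g \<in> borel_measurable circ"
    using g by (auto simp: L2_plus_def is_szego_def L2_circle_def measurable_circ)
  have [measurable]: "fser ?c \<in> borel_measurable circ" by (simp add: measurable_circ fser_measurable)
  have "(\<integral>x. ?G x * cis (- (of_int j * x)) \<partial>circ)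
      = (\<integral>x. fser ?c x * cnj (fser ?c x) * fser ?c x * cis (- (of_int j * x)) \<partial>circ)" for j
  proof (rule integral_cong_AE)
    show "AE x in circ. ?G x * cis (- (of_int j * x)) = fser ?c x * cnj (fser ?c x) * fser ?c x * cis (- (of_int j * x))"
      using L2_plus_AE_fser[OF g s]
    proof eventually_elim
      case (elim x)
      have "of_real ((cmod (g x))\<^sup>2) * g x = g x * cnj (g x) * g x" by (simp only: complex_norm_square)
      then show ?case using elim by simp
    qed
  qed measurable
  then have "fourier_coeff ?G j = fourier_coeff (\<lambda>x. fser ?c x * cnj (fser ?c x) * fser ?c x) j" for j
    unfolding fourier_coeff_circ by (rule arg_cong)
  then have lim: "(\<lambda>N. cub N ?c k) \<longlonglongrightarrow> fourier_coeff ?G (int k)" for k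
    using cub_tendsto[OF s] by simp
  then have "ell1 (\<lambda>k. fourier_coeff ?G (int k))"
    by (rule summable_cub_limit[OF s])
  then show ?thesis using lim by (simp add: fourier_coeff_szego)
qed

section \<open>The equation for the Fourier coefficients\<close>

definition hs_seq :: "real \<Rightarrow> (nat \<Rightarrow> complex) \<Rightarrow> bool" where
  "hs_seq s x \<longleftrightarrow> summable (\<lambda>k. wt s k * (cmod (x k))\<^sup>2)"

definition hs_norm :: "real \<Rightarrow> (nat \<Rightarrow> complex) \<Rightarrow> real" where
  "hs_norm s x = sqrt (\<Sum>k. wt s k * (cmod (x k))\<^sup>2)"

lemma l2w_le_hs_norm: "hs_seq s x \<Longrightarrow> l2w s N x \<le> hs_norm s x"
  unfolding hs_norm_def hs_seq_def
  by (rule real_le_rsqrt) (auto simp: l2w_power2 intro!: sum_le_suminf)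

lemma hs_norm_nonneg: "hs_seq s x \<Longrightarrow> hs_norm s x \<ge> 0"
  using l2w_le_hs_norm l2w_nonneg order_trans by blast

lemma l2w_tendsto:
  assumes "hs_seq s x" shows "(\<lambda>N. l2w s N x) \<longlonglongrightarrow> hs_norm s x"
proof -
  have "l2w s N x = sqrt (\<Sum>k\<le>N. wt s k * (cmod (x k))\<^sup>2)" for N
    by (simp flip: l2w_power2)
  then show ?thesis
    using summable_LIMSEQ'[OF assms[unfolded hs_seq_def]]
    by (simp add: hs_norm_def) (intro tendsto_intros)
qed

lemma l2w_mono: "M \<le> N \<Longrightarrow> l2w s M x \<le> l2w s N x"
  unfolding l2w_def L2_set_def by (intro real_sqrt_le_mono sum_mono2) auto

lemma l2w_triangle: "l2w s N (\<lambda>k. x k + y k) \<le> l2w s N x + l2w s N y"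
proof -
  have "l2w s N (\<lambda>k. x k + y k) \<le> L2_set (\<lambda>k. wt (s/2) k * cmod (x k) + wt (s/2) k * cmod (y k)) {..N}"
    unfolding l2w_def by (intro L2_set_mono) (auto simp: norm_triangle_ineq simp flip: distrib_left)
  also have "\<dots> \<le> l2w s N x + l2w s N y" unfolding l2w_def by (rule L2_set_triangle_ineq)
  finally show ?thesis .
qed

lemma hs_seqI_bounded:
  assumes "\<And>N. l2w s N x \<le> B" shows "hs_seq s x"
  unfolding hs_seq_def
proof (rule summableI_nonneg_bounded[where x = "B\<^sup>2"])
  fix n
  have "(\<Sum>k<n. wt s k * (cmod (x k))\<^sup>2) \<le> (\<Sum>k\<le>n. wt s k * (cmod (x k))\<^sup>2)"
    by (intro sum_mono2) auto
  also have "\<dots> = (l2w s n x)\<^sup>2" by (simp add: l2w_power2)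
  also have "\<dots> \<le> B\<^sup>2" using assms by (intro power_mono) auto
  finally show "(\<Sum>k<n. wt s k * (cmod (x k))\<^sup>2) \<le> B\<^sup>2" .
qed auto

lemma hs_norm_le:
  assumes "\<And>N. l2w s N x \<le> B" shows "hs_norm s x \<le> B"
  by (rule LIMSEQ_le_const2[OF l2w_tendsto[OF hs_seqI_bounded[OF assms]]]) (use assms in auto)

lemma l2w_minus: "l2w s N (\<lambda>k. - x k) = l2w s N x" by (simp add: l2w_def)

lemma l2w_diff: "l2w s N (\<lambda>k. x k - y k) \<le> l2w s N x + l2w s N y"
  using l2w_triangle[of s N x "\<lambda>k. - y k"] by (simp add: l2w_minus)

lemma hs_seq_diff:
  assumes "hs_seq s x" "hs_seq s y" shows "hs_seq s (\<lambda>k. x k - y k)"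
  by (rule hs_seqI_bounded[of _ _ "hs_norm s x + hs_norm s y"], rule order_trans[OF l2w_diff])
     (intro add_mono l2w_le_hs_norm assms)

text \<open>The reverse triangle inequality turns continuity in \<open>h\<^sup>s\<close> into continuity of the norm.\<close>

lemma hs_norm_diff_le:
  assumes "hs_seq s x" "hs_seq s y"
  shows "\<bar>hs_norm s x - hs_norm s y\<bar> \<le> hs_norm s (\<lambda>k. x k - y k)"
proof -
  have *: "hs_norm s x \<le> hs_norm s y + hs_norm s (\<lambda>k. x k - y k)" if "hs_seq s x" "hs_seq s y" for x y
  proof (rule hs_norm_le)
    fix N
    have "l2w s N x \<le> l2w s N y + l2w s N (\<lambda>k. x k - y k)"
      using l2w_triangle[of s N y "\<lambda>k. x k - y k"] by simp
    also have "\<dots> \<le> hs_norm s y + hs_norm s (\<lambda>k. x k - y k)"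
      by (intro add_mono l2w_le_hs_norm hs_seq_diff that)
    finally show "l2w s N x \<le> hs_norm s y + hs_norm s (\<lambda>k. x k - y k)" .
  qed
  have "hs_norm s (\<lambda>k. y k - x k) = hs_norm s (\<lambda>k. x k - y k)"
    by (simp add: hs_norm_def norm_minus_commute)
  with *[OF assms] *[OF assms(2,1)] show ?thesis by linarith
qed

lemma hs_seq_l1:
  assumes s: "s > 1/2" and x: "hs_seq s x"
  shows "ell1 x" and "l1_norm x \<le> emb s * hs_norm s x"
proof -
  have b: "(\<Sum>k\<le>n. cmod (x k)) \<le> emb s * hs_norm s x" for n
    using l1_le_l2w[OF s, of n x] mult_left_mono[OF l2w_le_hs_norm[OF x] emb_nonneg[OF s], of n]
    by (simp add: l1_def)
  show sm: "ell1 x"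
  proof (rule summableI_nonneg_bounded[where x = "emb s * hs_norm s x"])
    fix n
    have "(\<Sum>k<n. cmod (x k)) \<le> (\<Sum>k\<le>n. cmod (x k))" by (intro sum_mono2) auto
    then show "(\<Sum>k<n. cmod (x k)) \<le> emb s * hs_norm s x" using b[of n] by linarith
  qed auto
  show "l1_norm x \<le> emb s * hs_norm s x"
    by (rule LIMSEQ_le_const2[OF summable_LIMSEQ'[OF sm]]) (use b in auto)
qed

text \<open>The system for the Fourier coefficients.  The cubic term \<open>F\<close> is tied to \<open>U\<close> by the limit of the truncated
convolutions.\<close>

definition seq_solution :: "real \<Rightarrow> real \<Rightarrow> (real \<Rightarrow> nat \<Rightarrow> complex) \<Rightarrow> (real \<Rightarrow> nat \<Rightarrow> complex) \<Rightarrow> bool" where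
  "seq_solution s \<nu> U F \<longleftrightarrow>
     (\<forall>t. hs_seq s (U t)) \<and>
     (\<forall>t\<^sub>0. ((\<lambda>t. hs_norm s (\<lambda>k. U t k - U t\<^sub>0 k)) \<longlongrightarrow> 0) (at t\<^sub>0)) \<and>
     (\<forall>t k. ((\<lambda>\<tau>. U \<tau> k) has_vector_derivative - \<i> * (of_real (\<nu> * (real k)\<^sup>2) * U t k + F t k)) (at t)) \<and>
     (\<forall>t k. (\<lambda>N. cub N (U t) k) \<longlonglongrightarrow> F t k)"

text \<open>A sum over all integers whose negative terms vanish.  Summability is a premise because a divergent
unordered sum has the value 0, and the norm would not be recognised.\<close>

lemma hs_sum_int_nat:
  assumes neg: "\<And>j. j < 0 \<Longrightarrow> fourier_coeff f j = 0"
    and sm: "(\<lambda>k::int. (1 + (of_int k)\<^sup>2) powr s * (cmod (fourier_coeff f k))\<^sup>2) summable_on UNIV"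
  shows "hs_seq s (fcoeffs f)"
    and "Hs_norm s f = hs_norm s (fcoeffs f)"
proof -
  let ?g = "\<lambda>k::int. (1 + (of_int k)\<^sup>2) powr s * (cmod (fourier_coeff f k))\<^sup>2"
  have eq: "(?g \<circ> int) = (\<lambda>k. wt s k * (cmod (fourier_coeff f (int k)))\<^sup>2)"
    by (auto simp: wt_def)
  have "?g summable_on range int"
    using sm summable_on_subset_banach by blast
  then have "(?g \<circ> int) summable_on UNIV"
    using summable_on_reindex[of int UNIV ?g] by simp
  then have hs: "((?g \<circ> int) has_sum infsum (?g \<circ> int) UNIV) UNIV"
    by (rule has_sum_infsum)
  have "infsum ?g UNIV = infsum ?g (range int)"
    by (rule infsum_cong_neutral) (use neg in \<open>auto simp: image_iff\<close>, metis nonneg_int_cases not_less)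
  also have "\<dots> = infsum (?g \<circ> int) UNIV"
    by (rule infsum_reindex) simp
  also have "\<dots> = (\<Sum>k. wt s k * (cmod (fourier_coeff f (int k)))\<^sup>2)"
    using sums_unique[OF has_sum_imp_sums[OF hs]] by (simp add: eq)
  finally show "Hs_norm s f = hs_norm s (fcoeffs f)"
    by (simp add: Hs_norm_def hs_norm_def)
  show "hs_seq s (fcoeffs f)"
    using sums_summable[OF has_sum_imp_sums[OF hs]] by (simp add: hs_seq_def eq)
qed

lemma summable_on_intI:
  assumes neg: "\<And>j. j < 0 \<Longrightarrow> fourier_coeff f j = 0"
    and "hs_seq s (fcoeffs f)"
  shows "(\<lambda>k::int. (1 + (of_int k)\<^sup>2) powr s * (cmod (fourier_coeff f k))\<^sup>2) summable_on UNIV"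
proof -
  let ?g = "\<lambda>k::int. (1 + (of_int k)\<^sup>2) powr s * (cmod (fourier_coeff f k))\<^sup>2"
  have eq: "(?g \<circ> int) = (\<lambda>k. wt s k * (cmod (fourier_coeff f (int k)))\<^sup>2)"
    by (auto simp: wt_def)
  have "(?g \<circ> int) summable_on UNIV"
    unfolding eq by (subst summable_on_UNIV_nonneg_real_iff) (use assms(2) in \<open>auto simp: hs_seq_def\<close>)
  then have "?g summable_on range int"
    using summable_on_reindex[of int UNIV ?g] by simp
  then show ?thesis
    by (rule summable_on_cong_neutral[THEN iffD1, rotated -1])
       (use neg in \<open>auto simp: image_iff\<close>, metis nonneg_int_cases not_less)
qed

lemma Hs_plus_seq:
  assumes "f \<in> Hs_plus s"
  shows "hs_seq s (fcoeffs f)"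
    and "Hs_norm s f = hs_norm s (fcoeffs f)"
  using assms hs_sum_int_nat[of f s] by (auto simp: Hs_plus_def Hs_circle_def fourier_coeff_L2_plus_neg)

lemma xderiv_cis:
  "xderiv (\<lambda>x. a * cis (r * x) + b) = (\<lambda>x. (\<i> * of_real r) * a * cis (r * x) + 0)"
proof
  fix x
  have "((\<lambda>x. a * cis (r * x) + b) has_vector_derivative (a * (\<i> * of_real r * cis (r * x)) + 0)) (at x)"
    by (intro has_vector_derivative_add has_vector_derivative_mult_right has_vector_derivative_cis_mult has_vector_derivative_const)
  then show "xderiv (\<lambda>x. a * cis (r * x) + b) x = (\<i> * of_real r) * a * cis (r * x) + 0"
    by (simp add: xderiv_def vector_derivative_at mult_ac)
qed

text \<open>The additive constant disappears after the first derivative; it is kept in the statement because the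
initial data below have one.\<close>

lemma xderiv_cis_iterate:
  "(xderiv ^^ n) (\<lambda>x. a * cis (r * x) + b) = (\<lambda>x. (\<i> * of_real r) ^ n * a * cis (r * x) + (if n = 0 then b else 0))"
proof (induction n)
  case (Suc n)
  then show ?case by (simp only: funpow.simps o_apply xderiv_cis) (simp add: mult_ac)
qed simp

lemma Cinf_circle_cis:
  fixes j :: int
  shows "(\<lambda>x. a * cis (of_int j * x) + b) \<in> Cinf_circle"
proof -
  have "cis (of_int j * (x + 2 * pi)) = cis (of_int j * x)" for x
    using cis_multiple_2pi[of "of_int j"] by (simp add: ring_distribs cis_mult[symmetric] mult_ac)
  then have "periodic_2pi (\<lambda>x. a * cis (of_int j * x) + b)" by (simp add: periodic_2pi_def)
  moreover have "(xderiv ^^ n) (\<lambda>x. a * cis (of_int j * x) + b) differentiable at x" for n x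
    unfolding xderiv_cis_iterate
    by (rule differentiableI_vector[OF has_vector_derivative_add[OF
          has_vector_derivative_mult_right[OF has_vector_derivative_cis_mult] has_vector_derivative_const]])
  ultimately show ?thesis by (simp add: Cinf_circle_def)
qed

text \<open>The test function that extracts one Fourier coefficient.  The summand 0 puts it into the shape
of \<open>Cinf_circle_cis\<close>.\<close>

definition mode :: "nat \<Rightarrow> real \<Rightarrow> complex" where
  "mode k x = inverse (of_real (2 * pi)) * cis (of_int (- int k) * x) + 0"

lemma mode_Cinf: "mode k \<in> Cinf_circle"
  unfolding mode_def[abs_def] by (rule Cinf_circle_cis)

lemma circle_pairing_mode: "circle_pairing f (mode k) = fourier_coeff f (int k)"
proof -
  have "(\<lambda>x. f x * mode k x) = (\<lambda>x. f x * cis (- (of_int (int k) * x)) / of_real (2 * pi))"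
    by (auto simp: mode_def field_simps)
  then show ?thesis by (simp add: circle_pairing_def fourier_coeff_def set_integral_divide_zero)
qed

lemma xderiv2_mode: "xderiv (xderiv (mode k)) = (\<lambda>x. - (of_nat k)\<^sup>2 * mode k x)"
  unfolding mode_def[abs_def] xderiv_cis by (auto simp: power2_eq_square algebra_simps)

text \<open>Testing the equation against the exponentials.  For \<open>s > 1/2\<close> the solution has summable coefficients, so
\<open>cub_tendsto_szego\<close> identifies the right-hand side.\<close>

lemma solution_seq_solution:
  assumes s: "s > 1/2" and sol: "nls_szego_solution s \<nu> u0 u"
  defines "U \<equiv> \<lambda>t k. fourier_coeff (u t) (int k)"
  shows "\<exists>F. seq_solution s \<nu> U F"
    and "Hs_norm s (u t) = hs_norm s (U t)"
    and "u0 \<in> L2_circle \<Longrightarrow> U 0 k = fourier_coeff u0 (int k)"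
proof -
  have uH: "u t \<in> Hs_plus s" for t using sol by (simp add: nls_szego_solution_def)
  then have uL: "u t \<in> L2_plus" and uC: "u t \<in> L2_circle" for t
    by (simp_all add: Hs_plus_def Hs_circle_def)
  have hs: "hs_seq s (U t)" for t unfolding U_def by (rule Hs_plus_seq[OF uH])
  show "Hs_norm s (u t) = hs_norm s (U t)" unfolding U_def by (rule Hs_plus_seq[OF uH])
  define F where "F = (\<lambda>t k. fourier_coeff (szego (\<lambda>x. of_real ((cmod (u t x))\<^sup>2) * u t x)) (int k))"
  have cub: "(\<lambda>N. cub N (U t) k) \<longlonglongrightarrow> F t k" for t k
    unfolding U_def F_def
    using cub_tendsto_szego[OF uL hs_seq_l1(1)[OF s hs[unfolded U_def]]] .
  have cont: "((\<lambda>t. hs_norm s (\<lambda>k. U t k - U t0 k)) \<longlongrightarrow> 0) (at t0)" for t0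
  proof -
    have int: "integrable circ (u t)" for t by (rule sq_int_integrable[OF L2_circle_sq_int[OF uC]])
    have "Hs_norm s (\<lambda>x. u t x - u t0 x) = hs_norm s (\<lambda>k. U t k - U t0 k)" for t
    proof -
      \<comment> \<open>Summability of the difference has to be shown: otherwise its norm would be 0 by default.\<close>
      have neg: "fourier_coeff (\<lambda>x. u t x - u t0 x) j = 0" if "j < 0" for j
        using that by (simp add: fourier_coeff_diff int fourier_coeff_L2_plus_neg uL)
      have d: "(\<lambda>k. fourier_coeff (\<lambda>x. u t x - u t0 x) (int k)) = (\<lambda>k. U t k - U t0 k)"
        by (simp add: fourier_coeff_diff int U_def)
      have "hs_seq s (\<lambda>k. fourier_coeff (\<lambda>x. u t x - u t0 x) (int k))"
        unfolding d by (intro hs_seq_diff hs)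
      from hs_sum_int_nat(2)[OF neg summable_on_intI[OF neg this]] show ?thesis by (simp add: d)
    qed
    moreover have "((\<lambda>t. Hs_norm s (\<lambda>x. u t x - u t0 x)) \<longlongrightarrow> 0) (at t0)"
      using sol unfolding nls_szego_solution_def by blast
    ultimately show ?thesis by simp
  qed
  have der: "((\<lambda>\<tau>. U \<tau> k) has_vector_derivative - \<i> * (of_real (\<nu> * (real k)\<^sup>2) * U t k + F t k)) (at t)" for t k
  proof -
    obtain d where d: "((\<lambda>\<tau>. circle_pairing (u \<tau>) (mode k)) has_vector_derivative d) (at t)"
      and eq: "\<i> * d + of_real \<nu> * circle_pairing (u t) (xderiv (xderiv (mode k))) =
          circle_pairing (szego (\<lambda>x. of_real ((cmod (u t x))\<^sup>2) * u t x)) (mode k)"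
      using sol mode_Cinf[of k] unfolding nls_szego_solution_def by blast
    have "circle_pairing (u t) (xderiv (xderiv (mode k))) = - (of_nat k)\<^sup>2 * circle_pairing (u t) (mode k)"
    proof -
      have "(\<lambda>x. u t x * xderiv (xderiv (mode k)) x) = (\<lambda>x. - (of_nat k)\<^sup>2 * (u t x * mode k x))"
        by (simp add: xderiv2_mode mult_ac)
      then show ?thesis by (simp only: circle_pairing_def integral_circ integral_mult_right_zero)
    qed
    then have "\<i> * d = of_real \<nu> * (of_nat k)\<^sup>2 * U t k + F t k"
      using eq by (simp add: circle_pairing_mode U_def F_def algebra_simps)
    then have "d = - \<i> * (of_real \<nu> * (of_nat k)\<^sup>2 * U t k + F t k)"
      by (metis (no_types, lifting) i_squared mult.assoc mult_minus_left mult_1 minus_minus)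
    then show ?thesis using d by (simp add: circle_pairing_mode U_def)
  qed
  show "\<exists>F. seq_solution s \<nu> U F"
    unfolding seq_solution_def by (intro exI[of _ F] conjI allI hs cont der cub)
  have ae: "AE x in lborel. u 0 x = u0 x" using sol by (simp add: nls_szego_solution_def)
  then have ae: "AE x in circ. u 0 x = u0 x"
    unfolding circ_def by (subst AE_restrict_space_iff) auto
  assume "u0 \<in> L2_circle"
  then have [measurable]: "u0 \<in> borel_measurable circ" "u 0 \<in> borel_measurable circ"
    using uC by (auto simp: L2_circle_def measurable_circ)
  have "(\<integral>x. u 0 x * cis (- (of_int (int k) * x)) \<partial>circ) = (\<integral>x. u0 x * cis (- (of_int (int k) * x)) \<partial>circ)"
    by (rule integral_cong_AE) (use ae in \<open>measurable, auto\<close>)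
  then show "U 0 k = fourier_coeff u0 (int k)" by (simp add: U_def fourier_coeff_circ)
qed

section \<open>Truncation of the cubic term\<close>

lemma l2w_mult_ineq: "(\<Sum>k\<le>N. wt s k * cmod (x k) * cmod (y k)) \<le> l2w s N x * l2w s N y"
proof -
  have "(\<Sum>k\<le>N. wt s k * cmod (x k) * cmod (y k))
      = (\<Sum>k\<le>N. \<bar>wt (s/2) k * cmod (x k)\<bar> * \<bar>wt (s/2) k * cmod (y k)\<bar>)"
    by (intro sum.cong) (auto simp: abs_mult mult_ac simp flip: wt_half[of s])
  also have "\<dots> \<le> l2w s N x * l2w s N y" unfolding l2w_def by (rule L2_set_mult_ineq)
  finally show ?thesis .
qed

lemma cmod_cub_diff:
  "cmod (cub M x k - cub M y k) \<le>
     (\<Sum>(a, b, c)\<in>trip M k. cmod (x a - y a) * cmod (x b) * cmod (x c))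
   + (\<Sum>(a, b, c)\<in>trip M k. cmod (y a) * cmod (x b - y b) * cmod (x c))
   + (\<Sum>(a, b, c)\<in>trip M k. cmod (y a) * cmod (y b) * cmod (x c - y c))"
proof -
  have *: "cmod (p * cnj q * r - p' * cnj q' * r')
      \<le> cmod (p - p') * cmod q * cmod r + cmod p' * cmod (q - q') * cmod r + cmod p' * cmod q' * cmod (r - r')"
    for p q r p' q' r' :: complex
  proof -
    have "p * cnj q * r - p' * cnj q' * r' = (p - p') * cnj q * r + p' * cnj (q - q') * r + p' * cnj q' * (r - r')"
      by (simp add: algebra_simps)
    also have "cmod \<dots> \<le> cmod ((p - p') * cnj q * r) + cmod (p' * cnj (q - q') * r) + cmod (p' * cnj q' * (r - r'))"
      by (intro norm_triangle_le add_mono order_refl norm_triangle_ineq)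
    finally show ?thesis by (simp add: norm_mult del: complex_cnj_diff)
  qed
  have "cmod (cub M x k - cub M y k)
      \<le> (\<Sum>(a, b, c)\<in>trip M k. cmod (x a * cnj (x b) * x c - y a * cnj (y b) * y c))"
    unfolding cub_def sum_subtractf[symmetric] case_prod_unfold by (rule norm_sum)
  also have "\<dots> \<le> (\<Sum>(a, b, c)\<in>trip M k. cmod (x a - y a) * cmod (x b) * cmod (x c)
      + cmod (y a) * cmod (x b - y b) * cmod (x c) + cmod (y a) * cmod (y b) * cmod (x c - y c))"
    unfolding case_prod_unfold by (intro sum_mono *)
  finally show ?thesis by (simp add: case_prod_unfold sum.distrib)
qed

text \<open>Duality: the square of the left-hand side is a quartic sum whose outgoing factor is the difference of the
cubic terms itself; one power of its norm is then cancelled.\<close>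

lemma l2w_cub_diff:
  assumes s: "s > 1/2" and R: "l2w s M x \<le> R" "l2w s M y \<le> R"
  shows "l2w s M (\<lambda>k. cub M x k - cub M y k) \<le> 3 * qc s * R\<^sup>2 * l2w s M (\<lambda>k. x k - y k)"
proof -
  let ?w = "\<lambda>k. cub M x k - cub M y k" and ?d = "\<lambda>k. x k - y k"
  have R0: "R \<ge> 0" using R(1) l2w_nonneg order_trans by blast
  have q: "(\<Sum>k\<le>M. wt s k * cmod (?w k) * (\<Sum>(a, b, c)\<in>trip M k. cmod (f a) * cmod (g b) * cmod (h c)))
      \<le> qc s * l2w s M ?w * l2w s M f * l2w s M g * l2w s M h" for f g h
  proof -
    have "(\<Sum>k\<le>M. wt s k * cmod (?w k) * (\<Sum>(a, b, c)\<in>trip M k. cmod (f a) * cmod (g b) * cmod (h c)))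
       = (\<Sum>k\<le>M. \<Sum>(a, b, c)\<in>trip M k. wt s k * cmod (?w k) * cmod (f a) * cmod (g b) * cmod (h c))"
      by (simp add: sum_distrib_left case_prod_unfold mult.assoc)
    also have "\<dots> = (\<Sum>(k, a, b, c)\<in>quad M. wt s k * cmod (?w k) * cmod (f a) * cmod (g b) * cmod (h c))"
      by (rule sum_trip_quad)
    finally show ?thesis using quartic_bound[OF s, where w = ?w and x = f and y = g and z = h and N = M] by simp
  qed
  have "(l2w s M ?w)\<^sup>2 = (\<Sum>k\<le>M. wt s k * cmod (?w k) * cmod (?w k))"
    unfolding l2w_power2 by (simp add: power2_eq_square mult.assoc)
  also have "\<dots> \<le> (\<Sum>k\<le>M. wt s k * cmod (?w k) * (
     (\<Sum>(a, b, c)\<in>trip M k. cmod (?d a) * cmod (x b) * cmod (x c))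
   + (\<Sum>(a, b, c)\<in>trip M k. cmod (y a) * cmod (?d b) * cmod (x c))
   + (\<Sum>(a, b, c)\<in>trip M k. cmod (y a) * cmod (y b) * cmod (?d c))))"
    by (intro sum_mono mult_left_mono cmod_cub_diff) auto
  also have "\<dots> \<le> qc s * l2w s M ?w * l2w s M ?d * l2w s M x * l2w s M x
      + qc s * l2w s M ?w * l2w s M y * l2w s M ?d * l2w s M x
      + qc s * l2w s M ?w * l2w s M y * l2w s M y * l2w s M ?d"
    unfolding distrib_left sum.distrib by (intro add_mono q)
  also have "\<dots> = qc s * l2w s M ?w * l2w s M ?d *
      (l2w s M x * l2w s M x + l2w s M y * l2w s M x + l2w s M y * l2w s M y)"
    by (simp add: algebra_simps)
  also have "\<dots> \<le> qc s * l2w s M ?w * l2w s M ?d * (R * R + R * R + R * R)"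
    by (intro mult_left_mono add_mono mult_mono R) (auto simp: R0 qc_nonneg)
  also have "\<dots> = l2w s M ?w * (3 * qc s * R\<^sup>2 * l2w s M ?d)"
    by (simp add: power2_eq_square)
  finally have *: "l2w s M ?w * l2w s M ?w \<le> l2w s M ?w * (3 * qc s * R\<^sup>2 * l2w s M ?d)"
    by (simp add: power2_eq_square)
  show ?thesis
  proof (cases "l2w s M ?w = 0")
    case True then show ?thesis by (simp add: qc_nonneg)
  next
    case False
    then have "l2w s M ?w > 0" using l2w_nonneg[of s M ?w] by linarith
    then show ?thesis using * by simp
  qed
qed

lemma l2w_cub:
  assumes s: "s > 1/2" and R: "l2w s M x \<le> R"
  shows "l2w s M (cub M x) \<le> 3 * qc s * R ^ 3"
proof -
  have z: "cub M (\<lambda>_. 0) = (\<lambda>_. 0)" "l2w s M (\<lambda>_. 0) = 0" by (auto simp: cub_def l2w_def L2_set_def)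
  have R0: "R \<ge> 0" using R l2w_nonneg order_trans by blast
  have "l2w s M (cub M x) \<le> 3 * qc s * R\<^sup>2 * l2w s M x"
    using l2w_cub_diff[OF s R, of "\<lambda>_. 0"] R0 by (simp add: z)
  also have "\<dots> \<le> 3 * qc s * R\<^sup>2 * R" using R by (intro mult_left_mono) (auto simp: qc_nonneg)
  finally show ?thesis by (simp add: power3_eq_cube power2_eq_square)
qed

lemma l2w_tendsto_pointwise:
  assumes "\<And>k. k \<le> N \<Longrightarrow> (\<lambda>M. f M k) \<longlonglongrightarrow> g k"
  shows "(\<lambda>M. l2w s N (f M)) \<longlonglongrightarrow> l2w s N g"
  unfolding l2w_def L2_set_def by (intro tendsto_intros assms) auto

lemma l2w_cub_limit:
  assumes s: "s > 1/2" and x: "hs_seq s x" "hs_norm s x \<le> R"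
    and F: "\<And>k. (\<lambda>M. cub M x k) \<longlonglongrightarrow> F k"
  shows "l2w s N F \<le> 3 * qc s * R ^ 3"
proof (rule LIMSEQ_le_const2[OF l2w_tendsto_pointwise[OF F]], intro exI allI impI)
  fix M assume "N \<le> M"
  then have "l2w s N (cub M x) \<le> l2w s M (cub M x)" by (rule l2w_mono)
  also have "\<dots> \<le> 3 * qc s * R ^ 3"
    using l2w_le_hs_norm[OF x(1), of M] x(2) by (intro l2w_cub s) auto
  finally show "l2w s N (cub M x) \<le> 3 * qc s * R ^ 3" .
qed

text \<open>The error of replacing the cubic term by that of the truncated sequence is controlled by the tail of \<open>x\<close>,
since \<open>cub N x\<close> is the cubic term, at any higher cut-off \<open>M\<close>, of the truncation \<open>x'\<close> of \<open>x\<close>.\<close>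

lemma l2w_cub_truncation:
  assumes s: "s > 1/2" and x: "hs_seq s x" "hs_norm s x \<le> R"
    and F: "\<And>k. (\<lambda>M. cub M x k) \<longlonglongrightarrow> F k"
  shows "l2w s N (\<lambda>k. F k - cub N x k) \<le> 3 * qc s * R\<^sup>2 * sqrt ((hs_norm s x)\<^sup>2 - (l2w s N x)\<^sup>2)"
proof (rule LIMSEQ_le_const2[OF l2w_tendsto_pointwise[OF tendsto_diff[OF F tendsto_const]]], intro exI allI impI)
  fix M assume M: "N \<le> M"
  define x' where "x' = (\<lambda>k. if k \<le> N then x k else 0)"
  have c: "cub N x k = cub M x' k" for k
    unfolding cub_def
    by (rule sum.mono_neutral_cong_left[OF finite_trip])
       (use M in \<open>auto simp: trip_def x'_def split: if_splits\<close>)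
  have xM: "l2w s M x \<le> R" using l2w_le_hs_norm[OF x(1), of M] x(2) by linarith
  have "l2w s M x' \<le> l2w s M x"
    unfolding l2w_def by (intro L2_set_mono) (auto simp: x'_def)
  then have x'M: "l2w s M x' \<le> R" using xM by linarith
  have "(l2w s M (\<lambda>k. x k - x' k))\<^sup>2 = (\<Sum>k\<le>M. wt s k * (cmod (x k))\<^sup>2) - (\<Sum>k\<le>N. wt s k * (cmod (x k))\<^sup>2)"
  proof -
    have "(l2w s M (\<lambda>k. x k - x' k))\<^sup>2 = (\<Sum>k\<le>M. wt s k * (cmod (x k))\<^sup>2 - (if k \<le> N then wt s k * (cmod (x k))\<^sup>2 else 0))"
      unfolding l2w_power2 by (intro sum.cong) (auto simp: x'_def)
    also have "\<dots> = (\<Sum>k\<le>M. wt s k * (cmod (x k))\<^sup>2) - (\<Sum>k\<le>M. if k \<le> N then wt s k * (cmod (x k))\<^sup>2 else 0)"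
      by (rule sum_subtractf)
    also have "(\<Sum>k\<le>M. if k \<le> N then wt s k * (cmod (x k))\<^sup>2 else 0) = (\<Sum>k\<le>N. wt s k * (cmod (x k))\<^sup>2)"
      by (rule sum.mono_neutral_cong_right) (use M in auto)
    finally show ?thesis .
  qed
  also have "\<dots> \<le> (hs_norm s x)\<^sup>2 - (l2w s N x)\<^sup>2"
    using power_mono[OF l2w_le_hs_norm[OF x(1), of M], of 2] by (simp add: l2w_power2)
  finally have d: "l2w s M (\<lambda>k. x k - x' k) \<le> sqrt ((hs_norm s x)\<^sup>2 - (l2w s N x)\<^sup>2)"
    by (rule real_le_rsqrt)
  have "l2w s N (\<lambda>k. cub M x k - cub N x k) \<le> l2w s M (\<lambda>k. cub M x k - cub M x' k)"
    unfolding c by (rule l2w_mono[OF M])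
  also have "\<dots> \<le> 3 * qc s * R\<^sup>2 * l2w s M (\<lambda>k. x k - x' k)"
    by (rule l2w_cub_diff[OF s xM x'M])
  also have "\<dots> \<le> 3 * qc s * R\<^sup>2 * sqrt ((hs_norm s x)\<^sup>2 - (l2w s N x)\<^sup>2)"
    by (rule mult_left_mono[OF d]) (simp add: qc_nonneg)
  finally show "l2w s N (\<lambda>k. cub M x k - cub N x k) \<le> 3 * qc s * R\<^sup>2 * sqrt ((hs_norm s x)\<^sup>2 - (l2w s N x)\<^sup>2)" .
qed

section \<open>Continuity arguments\<close>

text \<open>A continuous function cannot pass the level \<open>B\<close> for the first time if staying below \<open>B\<close> (weakly) up to a
time implies being below \<open>B\<close> (strictly) at that time.\<close>

lemma continuity_bootstrap:
  fixes f :: "real \<Rightarrow> real"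
  assumes cont: "continuous_on {0..T} f" and f0: "f 0 < B"
    and step: "\<And>t. 0 \<le> t \<Longrightarrow> t \<le> T \<Longrightarrow> (\<And>\<tau>. 0 \<le> \<tau> \<Longrightarrow> \<tau> \<le> t \<Longrightarrow> f \<tau> \<le> B) \<Longrightarrow> f t < B"
    and t: "0 \<le> t" "t \<le> T"
  shows "f t < B"
proof (rule ccontr)
  assume "\<not> f t < B"
  define A where "A = {\<tau> \<in> {0..T}. B \<le> f \<tau>}"
  have "closed A" unfolding A_def
    by (rule continuous_on_closed_Collect_le[OF continuous_on_const cont]) auto
  moreover have ne: "A \<noteq> {}" using t \<open>\<not> f t < B\<close> by (auto simp: A_def)
  moreover have bb: "bdd_below A" by (auto simp: A_def intro: bdd_belowI[of _ 0])
  ultimately have inf: "Inf A \<in> A" by (intro closed_contains_Inf)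
  \<comment> \<open>The first time at which the level is reached.\<close>
  define t1 where "t1 = Inf A"
  have t1: "0 \<le> t1" "t1 \<le> T" "B \<le> f t1" using inf by (auto simp: t1_def A_def)
  have below: "f \<tau> < B" if "0 \<le> \<tau>" "\<tau> < t1" for \<tau>
  proof (rule ccontr)
    assume "\<not> f \<tau> < B"
    then have "\<tau> \<in> A" using that t1 by (auto simp: A_def)
    then have "t1 \<le> \<tau>" unfolding t1_def by (rule cInf_lower[OF _ bb])
    then show False using that by simp
  qed
  obtain \<tau> where \<tau>: "0 \<le> \<tau>" "\<tau> \<le> t1" "f \<tau> = B"
    using IVT'[of f 0 B t1] f0 t1 continuous_on_subset[OF cont, of "{0..t1}"] by auto
  then have "\<tau> = t1" using below[of \<tau>] by force
  then have "f \<tau>' \<le> B" if "0 \<le> \<tau>'" "\<tau>' \<le> t1" for \<tau>'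
    using below[of \<tau>'] that \<tau> by (cases "\<tau>' = t1") auto
  then have "f t1 < B" using t1 by (intro step) auto
  then show False using t1 by simp
qed

lemma seq_solution_hs: "seq_solution s \<nu> U F \<Longrightarrow> hs_seq s (U t)"
  and seq_solution_deriv: "seq_solution s \<nu> U F \<Longrightarrow>
    ((\<lambda>\<tau>. U \<tau> k) has_vector_derivative - \<i> * (of_real (\<nu> * (real k)\<^sup>2) * U t k + F t k)) (at t)"
  and seq_solution_cub: "seq_solution s \<nu> U F \<Longrightarrow> (\<lambda>N. cub N (U t) k) \<longlonglongrightarrow> F t k"
  by (simp_all add: seq_solution_def)

lemma seq_solution_continuous_norm:
  assumes sol: "seq_solution s \<nu> U F" shows "continuous_on S (\<lambda>t. hs_norm s (U t))"
proof -
  have "isCont (\<lambda>t. hs_norm s (U t)) t0" for t0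
  proof -
    have lim: "((\<lambda>t. hs_norm s (\<lambda>k. U t k - U t0 k)) \<longlongrightarrow> 0) (at t0)" using sol by (simp add: seq_solution_def)
    have "((\<lambda>t. hs_norm s (U t) - hs_norm s (U t0)) \<longlongrightarrow> 0) (at t0)"
      by (rule Lim_null_comparison[OF _ lim])
         (auto intro!: always_eventually hs_norm_diff_le seq_solution_hs[OF sol])
    then show ?thesis unfolding isCont_def by (rule LIM_zero_cancel)
  qed
  then show ?thesis by (simp add: continuous_at_imp_continuous_on)
qed

lemma seq_solution_continuous_component:
  assumes sol: "seq_solution s \<nu> U F" shows "continuous_on S (\<lambda>t. U t k)"
  using has_vector_derivative_continuous[OF seq_solution_deriv[OF sol]]
  by (simp add: continuous_at_imp_continuous_on)

lemma seq_solution_continuous_l2w: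
  assumes sol: "seq_solution s \<nu> U F" shows "continuous_on S (\<lambda>t. l2w s N (U t))"
  unfolding l2w_def L2_set_def
  by (intro continuous_intros seq_solution_continuous_component[OF sol])

text \<open>Dini's theorem: the tails are continuous in time and decrease to 0, hence uniformly on a compact
interval.\<close>

lemma seq_solution_uniform_tail:
  assumes sol: "seq_solution s \<nu> U F" and d: "d > 0"
  shows "\<exists>N. \<forall>n\<ge>N. \<forall>\<tau>\<in>{0..t}. (hs_norm s (U \<tau>))\<^sup>2 - (l2w s n (U \<tau>))\<^sup>2 < d"
proof (rule ccontr)
  define g where "g n \<tau> = (hs_norm s (U \<tau>))\<^sup>2 - (l2w s n (U \<tau>))\<^sup>2" for n \<tau>
  assume "\<not> ?thesis"
  then obtain n \<tau> where n: "\<And>N. n N \<ge> (N::nat)" "\<And>N. \<tau> N \<in> {0..t}" "\<And>N. g (n N) (\<tau> N) \<ge> d"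
    unfolding not_ex not_all not_imp not_less g_def by (metis (no_types, lifting) atLeastAtMost_iff not_less)
  \<comment> \<open>Times that violate the claim for larger and larger cut-offs accumulate at some \<open>l\<close>.\<close>
  obtain l r where l: "l \<in> {0..t}" "strict_mono (r :: nat \<Rightarrow> nat)" "(\<tau> \<circ> r) \<longlonglongrightarrow> l"
    using compact_Icc[of 0 t] n(2) unfolding compact_def by metis
  have "(\<lambda>m. g m l) \<longlonglongrightarrow> (hs_norm s (U l))\<^sup>2 - (hs_norm s (U l))\<^sup>2"
    unfolding g_def by (intro tendsto_intros l2w_tendsto seq_solution_hs[OF sol])
  then have "\<forall>\<^sub>F m in sequentially. g m l < d" using d by (intro order_tendstoD) auto
  then obtain m where m: "g m l < d" by (auto simp: eventually_sequentially)
  have "continuous_on UNIV (g m)" unfolding g_def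
    by (intro continuous_intros seq_solution_continuous_norm[OF sol] seq_solution_continuous_l2w[OF sol])
  then have "(\<lambda>j. g m ((\<tau> \<circ> r) j)) \<longlonglongrightarrow> g m l"
    by (rule continuous_on_tendsto_compose[OF _ l(3)]) auto
  then have "\<forall>\<^sub>F j in sequentially. g m ((\<tau> \<circ> r) j) < d" using m by (rule order_tendstoD)
  then have "\<forall>\<^sub>F j in sequentially. g m ((\<tau> \<circ> r) j) < d \<and> m \<le> j"
    using eventually_ge_at_top[of m] by eventually_elim auto
  then obtain j where j: "g m (\<tau> (r j)) < d" "m \<le> j" by (auto simp: eventually_sequentially)
  have "m \<le> n (r j)" using j(2) n(1)[of "r j"] seq_suble[OF l(2), of j] by linarith
  then have "g (n (r j)) (\<tau> (r j)) \<le> g m (\<tau> (r j))"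
    unfolding g_def by (intro diff_left_mono power_mono l2w_mono) auto
  then show False using j(1) n(3)[of "r j"] by linarith
qed

lemma vector_derivative_bound:
  fixes f :: "real \<Rightarrow> complex"
  assumes "0 \<le> t" "\<And>\<tau>. 0 \<le> \<tau> \<Longrightarrow> \<tau> \<le> t \<Longrightarrow> (f has_vector_derivative f' \<tau>) (at \<tau>)"
    and "\<And>\<tau>. 0 \<le> \<tau> \<Longrightarrow> \<tau> \<le> t \<Longrightarrow> cmod (f' \<tau>) \<le> B"
  shows "cmod (f t - f 0) \<le> B * t"
proof (cases "t = 0")
  case False
  have "norm (f t - f 0) \<le> B * t - B * 0"
  proof (rule differentiable_bound_general[where f' = f' and \<phi>' = "\<lambda>_. B"])
    show "0 < t" using assms(1) False by simp
    show "continuous_on {0..t} f"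
      using assms(2) by (intro continuous_at_imp_continuous_on ballI) (auto intro: has_vector_derivative_continuous)
    show "continuous_on {0..t} (\<lambda>t. B * t)" by (intro continuous_intros)
    show "((\<lambda>t. B * t) has_vector_derivative B) (at \<tau>)" for \<tau>
      by (auto intro!: derivative_eq_intros simp: has_real_derivative_iff_has_vector_derivative[symmetric])
  qed (use assms in auto)
  then show ?thesis by simp
qed simp

section \<open>Energy and its normal form correction\<close>

text \<open>Energies are kept complex-valued: derivatives are then sums of a number and its conjugate, and no real
parts have to be differentiated.\<close>

definition energy :: "real \<Rightarrow> nat \<Rightarrow> (nat \<Rightarrow> complex) \<Rightarrow> complex" where
  "energy s N x = (\<Sum>k\<le>N. of_real (wt s k) * (cnj (x k) * x k))"

text \<open>The energy grows at twice the real part of this quantity; the linear term of the equation does not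
contribute because \<open>\<nu> k\<^sup>2\<close> is real.\<close>

definition power_input :: "real \<Rightarrow> nat \<Rightarrow> (nat \<Rightarrow> complex) \<Rightarrow> (nat \<Rightarrow> complex) \<Rightarrow> complex" where
  "power_input s N x f = (\<Sum>k\<le>N. of_real (wt s k) * (cnj (x k) * (- \<i> * f k)))"

lemma energy_l2w: "energy s N x = of_real ((l2w s N x)\<^sup>2)"
  unfolding energy_def l2w_power2 of_real_sum
  by (intro sum.cong refl) (simp only: of_real_mult complex_norm_square mult.commute)

lemma cmod_power_input: "cmod (power_input s N x f) \<le> l2w s N x * l2w s N f"
proof -
  have "cmod (power_input s N x f) \<le> (\<Sum>k\<le>N. wt s k * cmod (x k) * cmod (f k))"
    unfolding power_input_def by (rule order_trans[OF norm_sum]) (simp add: norm_mult mult.assoc)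
  also have "\<dots> \<le> l2w s N x * l2w s N f" by (rule l2w_mult_ineq)
  finally show ?thesis .
qed

lemma energy_deriv:
  assumes sol: "seq_solution s \<nu> U F"
  shows "((\<lambda>\<tau>. energy s N (U \<tau>)) has_vector_derivative
     power_input s N (U t) (F t) + cnj (power_input s N (U t) (F t))) (at t)"
proof -
  let ?D = "\<lambda>k. - \<i> * (of_real (\<nu> * (real k)\<^sup>2) * U t k + F t k)"
  have "((\<lambda>\<tau>. energy s N (U \<tau>)) has_vector_derivative
     (\<Sum>k\<le>N. of_real (wt s k) * (cnj (U t k) * ?D k + cnj (?D k) * U t k))) (at t)"
    unfolding energy_def
    by (intro has_vector_derivative_sum has_vector_derivative_mult_right has_vector_derivative_mult
        has_vector_derivative_cnj seq_solution_deriv[OF sol])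
  also have "(\<Sum>k\<le>N. of_real (wt s k) * (cnj (U t k) * ?D k + cnj (?D k) * U t k))
     = power_input s N (U t) (F t) + cnj (power_input s N (U t) (F t))"
    unfolding power_input_def cnj_sum sum.distrib[symmetric]
    by (intro sum.cong refl) (simp add: algebra_simps)
  finally show ?thesis .
qed

lemma energy_growth_cubic:
  assumes s: "s > 1/2" and sol: "seq_solution s \<nu> U F" and t: "t \<ge> 0"
    and R: "\<And>\<tau>. 0 \<le> \<tau> \<Longrightarrow> \<tau> \<le> t \<Longrightarrow> hs_norm s (U \<tau>) \<le> R"
  shows "\<bar>(hs_norm s (U t))\<^sup>2 - (hs_norm s (U 0))\<^sup>2\<bar> \<le> 6 * qc s * R ^ 4 * t"
proof -
  have R0: "R \<ge> 0" using R[of 0] t hs_norm_nonneg[OF seq_solution_hs[OF sol], of 0] by linarith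
  have "\<bar>(l2w s N (U t))\<^sup>2 - (l2w s N (U 0))\<^sup>2\<bar> \<le> 6 * qc s * R ^ 4 * t" for N
  proof -
    have "cmod (energy s N (U t) - energy s N (U 0)) \<le> (6 * qc s * R ^ 4) * t"
    proof (rule vector_derivative_bound[OF t energy_deriv[OF sol]])
      fix \<tau> assume \<tau>: "0 \<le> \<tau>" "\<tau> \<le> t"
      have "cmod (power_input s N (U \<tau>) (F \<tau>)) \<le> l2w s N (U \<tau>) * l2w s N (F \<tau>)" by (rule cmod_power_input)
      also have "\<dots> \<le> R * (3 * qc s * R ^ 3)"
        using order_trans[OF l2w_le_hs_norm[OF seq_solution_hs[OF sol]] R[OF \<tau>]]
          l2w_cub_limit[OF s seq_solution_hs[OF sol] R[OF \<tau>] seq_solution_cub[OF sol]] R0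
        by (intro mult_mono) auto
      finally have "cmod (power_input s N (U \<tau>) (F \<tau>)) \<le> 3 * qc s * R ^ 4" by (simp add: eval_nat_numeral mult_ac)
      then show "cmod (power_input s N (U \<tau>) (F \<tau>) + cnj (power_input s N (U \<tau>) (F \<tau>))) \<le> 6 * qc s * R ^ 4"
        using norm_triangle_ineq[of "power_input s N (U \<tau>) (F \<tau>)" "cnj (power_input s N (U \<tau>) (F \<tau>))"] by simp
    qed
    then show ?thesis unfolding energy_l2w of_real_diff[symmetric] norm_of_real by simp
  qed
  moreover have "(\<lambda>N. \<bar>(l2w s N (U t))\<^sup>2 - (l2w s N (U 0))\<^sup>2\<bar>) \<longlonglongrightarrow> \<bar>(hs_norm s (U t))\<^sup>2 - (hs_norm s (U 0))\<^sup>2\<bar>"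
    by (intro tendsto_intros l2w_tendsto seq_solution_hs[OF sol])
  ultimately show ?thesis by (intro LIMSEQ_le_const2) auto
qed

definition phase :: "nat \<Rightarrow> nat \<Rightarrow> nat \<Rightarrow> nat \<Rightarrow> real" where
  "phase k a b c = (real k)\<^sup>2 - (real a)\<^sup>2 + (real b)\<^sup>2 - (real c)\<^sup>2"

lemma phase_factor: "k + b = a + c \<Longrightarrow> phase k a b c = 2 * (real k - real a) * (real k - real c)"
proof -
  assume "k + b = a + c"
  then have "real b = real a + real c - real k" by linarith
  then show ?thesis unfolding phase_def by (simp only:) (simp add: power2_eq_square algebra_simps)
qed

text \<open>Phases are integers, so there are no small divisors.\<close>

lemma phase_ge_1:
  assumes "phase k a b c \<noteq> 0" shows "\<bar>phase k a b c\<bar> \<ge> 1"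
proof -
  define j :: int where "j = (int k)\<^sup>2 - (int a)\<^sup>2 + (int b)\<^sup>2 - (int c)\<^sup>2"
  have "phase k a b c = of_int j" by (simp add: phase_def j_def)
  moreover from this assms have "\<bar>j\<bar> \<ge> 1" by auto
  ultimately show ?thesis by linarith
qed

definition quad_nr :: "nat \<Rightarrow> (nat \<times> nat \<times> nat \<times> nat) set" where
  "quad_nr N = {(k, a, b, c) \<in> quad N. phase k a b c \<noteq> 0}"

text \<open>The quartic normal form correction, with its four entries kept separate so that one formula also
describes each term of its derivative.\<close>

definition nform :: "real \<Rightarrow> real \<Rightarrow> nat \<Rightarrow> (nat \<Rightarrow> complex) \<Rightarrow> (nat \<Rightarrow> complex) \<Rightarrow> (nat \<Rightarrow> complex) \<Rightarrow> (nat \<Rightarrow> complex) \<Rightarrow> complex" where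
  "nform s \<nu> N w x y z = (\<Sum>(k, a, b, c)\<in>quad_nr N.
     of_real (wt s k / (\<nu> * phase k a b c)) * (cnj (w k) * x a * cnj (y b) * z c))"

lemma cmod_nform:
  assumes s: "s > 1/2" and \<nu>: "\<nu> > 0"
  shows "cmod (nform s \<nu> N w x y z) \<le> qc s / \<nu> * l2w s N w * l2w s N x * l2w s N y * l2w s N z"
proof -
  have "cmod (nform s \<nu> N w x y z) \<le> (\<Sum>(k, a, b, c)\<in>quad_nr N.
     wt s k / (\<nu> * \<bar>phase k a b c\<bar>) * (cmod (w k) * cmod (x a) * cmod (y b) * cmod (z c)))"
    unfolding nform_def using \<nu>
    by (intro order_trans[OF norm_sum]) (simp add: case_prod_unfold norm_mult norm_divide abs_mult)
  also have "\<dots> \<le> (\<Sum>(k, a, b, c)\<in>quad_nr N.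
     1 / \<nu> * (wt s k * cmod (w k) * cmod (x a) * cmod (y b) * cmod (z c)))"
  proof (rule sum_quad_mono)
    fix k a b c assume "(k, a, b, c) \<in> quad_nr N"
    then have ph: "\<bar>phase k a b c\<bar> \<ge> 1" by (intro phase_ge_1) (auto simp: quad_nr_def)
    have "\<nu> * 1 \<le> \<nu> * \<bar>phase k a b c\<bar>" using ph \<nu> by (intro mult_left_mono) auto
    then have "wt s k / (\<nu> * \<bar>phase k a b c\<bar>) \<le> wt s k / \<nu>"
      using \<nu> by (intro divide_left_mono) auto
    from mult_right_mono[OF this, of "cmod (w k) * cmod (x a) * cmod (y b) * cmod (z c)"]
    show "wt s k / (\<nu> * \<bar>phase k a b c\<bar>) * (cmod (w k) * cmod (x a) * cmod (y b) * cmod (z c))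
       \<le> 1 / \<nu> * (wt s k * cmod (w k) * cmod (x a) * cmod (y b) * cmod (z c))"
      by (simp add: mult_ac)
  qed
  also have "\<dots> \<le> (\<Sum>(k, a, b, c)\<in>quad N. 1 / \<nu> * (wt s k * cmod (w k) * cmod (x a) * cmod (y b) * cmod (z c)))"
    by (rule sum_mono2) (use \<nu> in \<open>auto simp: quad_nr_def\<close>)
  also have "\<dots> = 1 / \<nu> * (\<Sum>(k, a, b, c)\<in>quad N. wt s k * cmod (w k) * cmod (x a) * cmod (y b) * cmod (z c))"
    by (simp add: sum_distrib_left case_prod_unfold)
  also have "\<dots> \<le> 1 / \<nu> * (qc s * l2w s N w * l2w s N x * l2w s N y * l2w s N z)"
    by (intro mult_left_mono quartic_bound s) (use \<nu> in auto)
  finally show ?thesis by simp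
qed

definition quartic_nr :: "real \<Rightarrow> nat \<Rightarrow> (nat \<Rightarrow> complex) \<Rightarrow> complex" where
  "quartic_nr s N x = (\<Sum>(k, a, b, c)\<in>quad_nr N. of_real (wt s k) * (cnj (x k) * x a * cnj (x b) * x c))"

text \<open>The linear flow multiplies each monomial by \<open>i \<nu> \<Phi>\<close>, which cancels the denominator \<open>\<nu> \<Phi>\<close> and reproduces the
non-resonant quartic form; every other term has one factor replaced by the cubic term.\<close>

lemma nform_deriv:
  assumes sol: "seq_solution s \<nu> U F" and \<nu>: "\<nu> > 0"
  defines "G \<equiv> \<lambda>t k. - \<i> * F t k"
  shows "((\<lambda>\<tau>. nform s \<nu> N (U \<tau>) (U \<tau>) (U \<tau>) (U \<tau>)) has_vector_derivative
      \<i> * quartic_nr s N (U t) + (nform s \<nu> N (G t) (U t) (U t) (U t) + nform s \<nu> N (U t) (G t) (U t) (U t)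
        + nform s \<nu> N (U t) (U t) (G t) (U t) + nform s \<nu> N (U t) (U t) (U t) (G t))) (at t)"
proof -
  let ?D = "\<lambda>k. - \<i> * (of_real (\<nu> * (real k)\<^sup>2) * U t k + F t k)"
  let ?r = "\<lambda>k a b c. (of_real (wt s k / (\<nu> * phase k a b c)) :: complex)"
  let ?d' = "\<lambda>k a b c. cnj (U t k) * U t a * cnj (U t b) * ?D c
      + (cnj (U t k) * U t a * cnj (?D b) + (cnj (U t k) * ?D a + cnj (?D k) * U t a) * cnj (U t b)) * U t c"
  let ?d = "\<lambda>k a b c. ?r k a b c * ?d' k a b c"
  let ?e = "\<lambda>k a b c. \<i> * (of_real (wt s k) * (cnj (U t k) * U t a * cnj (U t b) * U t c))
      + (?r k a b c * (cnj (G t k) * U t a * cnj (U t b) * U t c)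
       + ?r k a b c * (cnj (U t k) * G t a * cnj (U t b) * U t c)
       + ?r k a b c * (cnj (U t k) * U t a * cnj (G t b) * U t c)
       + ?r k a b c * (cnj (U t k) * U t a * cnj (U t b) * G t c))"
  have "((\<lambda>\<tau>. nform s \<nu> N (U \<tau>) (U \<tau>) (U \<tau>) (U \<tau>)) has_vector_derivative
     (\<Sum>q\<in>quad_nr N. ?d (fst q) (fst (snd q)) (fst (snd (snd q))) (snd (snd (snd q))))) (at t)"
    unfolding nform_def case_prod_unfold
    by (intro has_vector_derivative_sum has_vector_derivative_mult_right has_vector_derivative_mult
        has_vector_derivative_cnj seq_solution_deriv[OF sol])
  also have "(\<Sum>q\<in>quad_nr N. ?d (fst q) (fst (snd q)) (fst (snd (snd q))) (snd (snd (snd q))))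
     = (\<Sum>(k, a, b, c)\<in>quad_nr N. ?d k a b c)" by (simp add: case_prod_unfold)
  also have "\<dots> = (\<Sum>(k, a, b, c)\<in>quad_nr N. ?e k a b c)"
  proof (intro sum.cong refl)
    fix q assume q: "q \<in> quad_nr N"
    obtain k a b c where qe: "q = (k, a, b, c)" by (cases q) auto
    have nz: "\<nu> * phase k a b c \<noteq> 0" using q \<nu> by (auto simp: qe quad_nr_def)
    have w: "of_real (wt s k) = ?r k a b c * of_real (\<nu> * phase k a b c)"
      unfolding of_real_mult[symmetric] using nz by simp
    have "r * ?d' k a b c = \<i> * (r * of_real (\<nu> * phase k a b c) * (cnj (U t k) * U t a * cnj (U t b) * U t c))
      + (r * (cnj (G t k) * U t a * cnj (U t b) * U t c)
       + r * (cnj (U t k) * G t a * cnj (U t b) * U t c)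
       + r * (cnj (U t k) * U t a * cnj (G t b) * U t c)
       + r * (cnj (U t k) * U t a * cnj (U t b) * G t c))" for r :: complex
      by (simp add: G_def phase_def algebra_simps)
    then have "?d k a b c = ?e k a b c" unfolding w .
    then show "(case q of (k, a, b, c) \<Rightarrow> ?d k a b c) = (case q of (k, a, b, c) \<Rightarrow> ?e k a b c)"
      by (simp only: qe prod.case)
  qed
  also have "\<dots> = \<i> * quartic_nr s N (U t) + (nform s \<nu> N (G t) (U t) (U t) (U t) + nform s \<nu> N (U t) (G t) (U t) (U t)
        + nform s \<nu> N (U t) (U t) (G t) (U t) + nform s \<nu> N (U t) (U t) (U t) (G t))"
    unfolding nform_def quartic_nr_def case_prod_unfold sum.distrib sum_distrib_left ..
  finally show ?thesis .
qed

text \<open>By \<open>phase_factor\<close> a resonant quadruple has \<open>k = a\<close> or \<open>k = c\<close>, and its monomial is then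
\<open>|u\<^sub>k|\<^sup>2 |u\<^sub>b|\<^sup>2\<close>.  Being real, it disappears when the conjugate is added.\<close>

lemma power_input_cub:
  "power_input s N x (cub N x) + cnj (power_input s N x (cub N x))
     = - (\<i> * quartic_nr s N x) + cnj (- (\<i> * quartic_nr s N x))"
proof -
  let ?m = "\<lambda>(k, a, b, c). of_real (wt s k) * (cnj (x k) * x a * cnj (x b) * x c)"
  have "power_input s N x (cub N x) = - \<i> * (\<Sum>k\<le>N. \<Sum>(a, b, c)\<in>trip N k. of_real (wt s k) * (cnj (x k) * x a * cnj (x b) * x c))"
    unfolding power_input_def cub_def by (simp add: sum_distrib_left case_prod_unfold mult_ac sum_negf)
  also have "\<dots> = - \<i> * sum ?m (quad N)" by (subst sum_trip_quad) simp
  also have "sum ?m (quad N) = sum ?m (quad_nr N) + sum ?m (quad N - quad_nr N)"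
    using sum.subset_diff[of "quad_nr N" "quad N" ?m] by (simp add: quad_nr_def subset_iff)
  finally have p: "power_input s N x (cub N x) = - \<i> * (quartic_nr s N x + sum ?m (quad N - quad_nr N))"
    by (simp add: quartic_nr_def)
  have real: "cnj (sum ?m (quad N - quad_nr N)) = sum ?m (quad N - quad_nr N)"
    unfolding cnj_sum
  proof (intro sum.cong refl)
    fix q assume q: "q \<in> quad N - quad_nr N"
    obtain k a b c where qe: "q = (k, a, b, c)" by (cases q) auto
    have e: "k + b = a + c" and "phase k a b c = 0" using q by (auto simp: qe quad_nr_def quad_iff)
    then have "k = a \<or> k = c" using phase_factor[OF e] by simp
    then show "cnj (?m q) = ?m q" using e by (auto simp: qe mult_ac)
  qed
  show ?thesis
    unfolding p complex_cnj_mult complex_cnj_add complex_cnj_minus complex_cnj_i real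
    by (simp add: algebra_simps)
qed

lemma power_input_diff: "power_input s N x f = power_input s N x g + power_input s N x (\<lambda>k. f k - g k)"
  unfolding power_input_def sum.distrib[symmetric] by (intro sum.cong refl) (simp add: algebra_simps)

section \<open>Life span of small solutions\<close>

text \<open>The energy plus correction changes only through the sextic terms \<open>H\<close> and the truncation error \<open>P\<close>; the
latter is made smaller than any \<open>e > 0\<close> by the choice of \<open>N\<close>, after which \<open>N\<close> and \<open>e\<close> are removed.\<close>

lemma energy_growth_normal_form:
  assumes s: "s > 1/2" and sol: "seq_solution s \<nu> U F" and \<nu>: "\<nu> > 0" and t: "t \<ge> 0"
    and R: "\<And>\<tau>. 0 \<le> \<tau> \<Longrightarrow> \<tau> \<le> t \<Longrightarrow> hs_norm s (U \<tau>) \<le> R"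
  shows "\<bar>(hs_norm s (U t))\<^sup>2 - (hs_norm s (U 0))\<^sup>2\<bar>
     \<le> 4 * qc s * R ^ 4 / \<nu> + 24 * (qc s)\<^sup>2 * R ^ 6 / \<nu> * t"
proof -
  have R0: "R \<ge> 0" using R[of 0] t hs_norm_nonneg[OF seq_solution_hs[OF sol], of 0] by linarith
  define Q where "Q N \<tau> = nform s \<nu> N (U \<tau>) (U \<tau>) (U \<tau>) (U \<tau>)" for N \<tau>
  define G where "G = (\<lambda>t k. - \<i> * F t k)"
  define \<rho> where "\<rho> N \<tau> = (\<lambda>k. F \<tau> k - cub N (U \<tau>) k)" for N \<tau>
  define H where "H N \<tau> = nform s \<nu> N (G \<tau>) (U \<tau>) (U \<tau>) (U \<tau>) + nform s \<nu> N (U \<tau>) (G \<tau>) (U \<tau>) (U \<tau>)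
        + nform s \<nu> N (U \<tau>) (U \<tau>) (G \<tau>) (U \<tau>) + nform s \<nu> N (U \<tau>) (U \<tau>) (U \<tau>) (G \<tau>)" for N \<tau>
  have UR: "l2w s N (U \<tau>) \<le> R" if "0 \<le> \<tau>" "\<tau> \<le> t" for N \<tau>
    using order_trans[OF l2w_le_hs_norm[OF seq_solution_hs[OF sol]] R[OF that]] .
  have GR: "l2w s N (G \<tau>) \<le> 3 * qc s * R ^ 3" if "0 \<le> \<tau>" "\<tau> \<le> t" for N \<tau>
  proof -
    have "l2w s N (G \<tau>) = l2w s N (F \<tau>)" by (simp add: G_def l2w_def norm_mult)
    then show ?thesis
      using l2w_cub_limit[OF s seq_solution_hs[OF sol] R[OF that] seq_solution_cub[OF sol]] by simp
  qed
  have QR: "cmod (Q N \<tau>) \<le> qc s * R ^ 4 / \<nu>" if "0 \<le> \<tau>" "\<tau> \<le> t" for N \<tau>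
  proof -
    have "cmod (Q N \<tau>) \<le> qc s / \<nu> * l2w s N (U \<tau>) * l2w s N (U \<tau>) * l2w s N (U \<tau>) * l2w s N (U \<tau>)"
      unfolding Q_def by (rule cmod_nform[OF s \<nu>])
    also have "\<dots> \<le> qc s / \<nu> * R * R * R * R"
      using UR[OF that] R0 \<nu> qc_nonneg by (intro mult_mono) auto
    finally show ?thesis by (simp add: eval_nat_numeral mult_ac)
  qed
  have HR: "cmod (H N \<tau>) \<le> 12 * (qc s)\<^sup>2 * R ^ 6 / \<nu>" if \<tau>: "0 \<le> \<tau>" "\<tau> \<le> t" for N \<tau>
  proof -
    have b: "cmod (nform s \<nu> N w x y z) \<le> qc s / \<nu> * A * B * C * D"
      if "l2w s N w \<le> A" "l2w s N x \<le> B" "l2w s N y \<le> C" "l2w s N z \<le> D" for w x y z A B C D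
    proof -
      have p: "0 \<le> A" "0 \<le> B" "0 \<le> C" "0 \<le> D" using that l2w_nonneg order_trans by blast+
      have "cmod (nform s \<nu> N w x y z) \<le> qc s / \<nu> * l2w s N w * l2w s N x * l2w s N y * l2w s N z"
        by (rule cmod_nform[OF s \<nu>])
      also have "\<dots> \<le> qc s / \<nu> * A * B * C * D"
        using that p \<nu> qc_nonneg by (intro mult_mono) auto
      finally show ?thesis .
    qed
    note u = UR[OF \<tau>] and g = GR[OF \<tau>]
    have "cmod (H N \<tau>) \<le> cmod (nform s \<nu> N (G \<tau>) (U \<tau>) (U \<tau>) (U \<tau>)) + cmod (nform s \<nu> N (U \<tau>) (G \<tau>) (U \<tau>) (U \<tau>))
        + cmod (nform s \<nu> N (U \<tau>) (U \<tau>) (G \<tau>) (U \<tau>)) + cmod (nform s \<nu> N (U \<tau>) (U \<tau>) (U \<tau>) (G \<tau>))"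
      unfolding H_def by (intro norm_triangle_le add_mono order_refl norm_triangle_ineq)
    also have "\<dots> \<le> qc s / \<nu> * (3 * qc s * R ^ 3) * R * R * R + qc s / \<nu> * R * (3 * qc s * R ^ 3) * R * R
        + qc s / \<nu> * R * R * (3 * qc s * R ^ 3) * R + qc s / \<nu> * R * R * R * (3 * qc s * R ^ 3)"
      by (intro add_mono b u g)
    also have "\<dots> = 12 * (qc s)\<^sup>2 * R ^ 6 / \<nu>" by (simp add: eval_nat_numeral mult_ac)
    finally show ?thesis .
  qed
  have key: "\<bar>(hs_norm s (U t))\<^sup>2 - (hs_norm s (U 0))\<^sup>2\<bar>
     \<le> 4 * qc s * R ^ 4 / \<nu> + (6 * qc s * R ^ 3 * e + 24 * (qc s)\<^sup>2 * R ^ 6 / \<nu>) * t" if e: "e > 0" for e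
  proof -
    have "e\<^sup>2 > 0" using e by simp
    from seq_solution_uniform_tail[OF sol this, of t]
    obtain N0 where N0: "\<And>N \<tau>. N \<ge> N0 \<Longrightarrow> \<tau> \<in> {0..t} \<Longrightarrow> (hs_norm s (U \<tau>))\<^sup>2 - (l2w s N (U \<tau>))\<^sup>2 < e\<^sup>2"
      by blast
    have "\<bar>(l2w s N (U t))\<^sup>2 - (l2w s N (U 0))\<^sup>2\<bar>
       \<le> 4 * qc s * R ^ 4 / \<nu> + (6 * qc s * R ^ 3 * e + 24 * (qc s)\<^sup>2 * R ^ 6 / \<nu>) * t" if N: "N \<ge> N0" for N
    proof -
      define Z where "Z \<tau> = energy s N (U \<tau>) + (Q N \<tau> + cnj (Q N \<tau>))" for \<tau>
      define P where "P \<tau> = power_input s N (U \<tau>) (\<rho> N \<tau>)" for \<tau>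
      have PR: "cmod (P \<tau>) \<le> 3 * qc s * R ^ 3 * e" if \<tau>: "0 \<le> \<tau>" "\<tau> \<le> t" for \<tau>
      proof -
        have "cmod (P \<tau>) \<le> l2w s N (U \<tau>) * l2w s N (\<rho> N \<tau>)" unfolding P_def by (rule cmod_power_input)
        also have "\<dots> \<le> R * (3 * qc s * R\<^sup>2 * e)"
        proof (intro mult_mono UR[OF \<tau>])
          have "l2w s N (\<rho> N \<tau>) \<le> 3 * qc s * R\<^sup>2 * sqrt ((hs_norm s (U \<tau>))\<^sup>2 - (l2w s N (U \<tau>))\<^sup>2)"
            unfolding \<rho>_def by (rule l2w_cub_truncation[OF s seq_solution_hs[OF sol] R[OF \<tau>] seq_solution_cub[OF sol]])
          also have "\<dots> \<le> 3 * qc s * R\<^sup>2 * e"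
            using N0[OF N, of \<tau>] \<tau> e by (intro mult_left_mono real_le_lsqrt) (auto simp: qc_nonneg)
          finally show "l2w s N (\<rho> N \<tau>) \<le> 3 * qc s * R\<^sup>2 * e" .
        qed (use R0 in auto)
        finally show ?thesis by (simp add: eval_nat_numeral mult_ac)
      qed
      have "cmod (Z t - Z 0) \<le> (6 * qc s * R ^ 3 * e + 24 * (qc s)\<^sup>2 * R ^ 6 / \<nu>) * t"
      proof (rule vector_derivative_bound[OF t])
        fix \<tau> assume \<tau>: "0 \<le> \<tau>" "\<tau> \<le> t"
        let ?W = "power_input s N (U \<tau>) (F \<tau>)"
        have "(Q N has_vector_derivative \<i> * quartic_nr s N (U \<tau>) + H N \<tau>) (at \<tau>)"
          using nform_deriv[OF sol \<nu>, of N \<tau>] unfolding Q_def H_def G_def .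
        then have "(Z has_vector_derivative (?W + cnj ?W)
            + ((\<i> * quartic_nr s N (U \<tau>) + H N \<tau>) + cnj (\<i> * quartic_nr s N (U \<tau>) + H N \<tau>))) (at \<tau>)"
          unfolding Z_def
          by (intro has_vector_derivative_add has_vector_derivative_cnj energy_deriv[OF sol])
        moreover have "?W = power_input s N (U \<tau>) (cub N (U \<tau>)) + P \<tau>"
          unfolding P_def \<rho>_def by (rule power_input_diff)
        then have "?W + cnj ?W = (power_input s N (U \<tau>) (cub N (U \<tau>)) + cnj (power_input s N (U \<tau>) (cub N (U \<tau>)))) + (P \<tau> + cnj (P \<tau>))"
          by simp
        then have "(?W + cnj ?W) + ((\<i> * quartic_nr s N (U \<tau>) + H N \<tau>) + cnj (\<i> * quartic_nr s N (U \<tau>) + H N \<tau>))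
            = (P \<tau> + cnj (P \<tau>)) + (H N \<tau> + cnj (H N \<tau>))"
          unfolding power_input_cub by simp
        ultimately show "(Z has_vector_derivative (P \<tau> + cnj (P \<tau>)) + (H N \<tau> + cnj (H N \<tau>))) (at \<tau>)"
          by (rule has_vector_derivative_eq_rhs)
        have "cmod ((P \<tau> + cnj (P \<tau>)) + (H N \<tau> + cnj (H N \<tau>)))
            \<le> (cmod (P \<tau>) + cmod (cnj (P \<tau>))) + (cmod (H N \<tau>) + cmod (cnj (H N \<tau>)))"
          by (intro norm_triangle_le add_mono norm_triangle_ineq)
        also have "\<dots> \<le> (3 * qc s * R ^ 3 * e + 3 * qc s * R ^ 3 * e)
            + (12 * (qc s)\<^sup>2 * R ^ 6 / \<nu> + 12 * (qc s)\<^sup>2 * R ^ 6 / \<nu>)"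
          unfolding complex_mod_cnj by (intro add_mono PR HR \<tau>)
        finally show "cmod ((P \<tau> + cnj (P \<tau>)) + (H N \<tau> + cnj (H N \<tau>)))
            \<le> 6 * qc s * R ^ 3 * e + 24 * (qc s)\<^sup>2 * R ^ 6 / \<nu>" by (simp add: mult_ac)
      qed
      moreover have "energy s N (U t) - energy s N (U 0) = (Z t - Z 0) - ((Q N t + cnj (Q N t)) - (Q N 0 + cnj (Q N 0)))"
        by (simp add: Z_def)
      then have "cmod (energy s N (U t) - energy s N (U 0))
          \<le> cmod (Z t - Z 0) + ((cmod (Q N t) + cmod (cnj (Q N t))) + (cmod (Q N 0) + cmod (cnj (Q N 0))))"
        by (simp only:) (intro order_trans[OF norm_triangle_ineq4] add_mono order_refl norm_triangle_ineq)
      moreover have "cmod (Q N t) \<le> qc s * R ^ 4 / \<nu>" "cmod (Q N 0) \<le> qc s * R ^ 4 / \<nu>"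
        using t by (auto intro: QR)
      ultimately show ?thesis unfolding energy_l2w of_real_diff[symmetric] norm_of_real by simp
    qed
    moreover have "(\<lambda>N. \<bar>(l2w s N (U t))\<^sup>2 - (l2w s N (U 0))\<^sup>2\<bar>) \<longlonglongrightarrow> \<bar>(hs_norm s (U t))\<^sup>2 - (hs_norm s (U 0))\<^sup>2\<bar>"
      by (intro tendsto_intros l2w_tendsto seq_solution_hs[OF sol])
    ultimately show ?thesis by (intro LIMSEQ_le_const2) auto
  qed
  have "((\<lambda>e. 4 * qc s * R ^ 4 / \<nu> + (6 * qc s * R ^ 3 * e + 24 * (qc s)\<^sup>2 * R ^ 6 / \<nu>) * t) \<longlongrightarrow>
      4 * qc s * R ^ 4 / \<nu> + (6 * qc s * R ^ 3 * 0 + 24 * (qc s)\<^sup>2 * R ^ 6 / \<nu>) * t) (at_right 0)"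
    by (intro tendsto_intros)
  moreover have "\<forall>\<^sub>F e in at_right 0. \<bar>(hs_norm s (U t))\<^sup>2 - (hs_norm s (U 0))\<^sup>2\<bar>
     \<le> 4 * qc s * R ^ 4 / \<nu> + (6 * qc s * R ^ 3 * e + 24 * (qc s)\<^sup>2 * R ^ 6 / \<nu>) * t"
    using key by (auto simp: eventually_at_filter)
  ultimately have "\<bar>(hs_norm s (U t))\<^sup>2 - (hs_norm s (U 0))\<^sup>2\<bar>
     \<le> 4 * qc s * R ^ 4 / \<nu> + (6 * qc s * R ^ 3 * 0 + 24 * (qc s)\<^sup>2 * R ^ 6 / \<nu>) * t"
    by (rule tendsto_lowerbound) simp
  then show ?thesis by simp
qed

text \<open>As long as the norm is at most \<open>2 e\<close>, its square has changed by at most \<open>2 e\<^sup>2\<close> and is therefore at most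
\<open>3 e\<^sup>2 < (2 e)\<^sup>2\<close>.\<close>

lemma seq_solution_bootstrap:
  assumes sol: "seq_solution s \<nu> U F" and e: "hs_norm s (U 0) = e" "e > 0"
    and step: "\<And>t. 0 \<le> t \<Longrightarrow> t \<le> T \<Longrightarrow> (\<And>\<tau>. 0 \<le> \<tau> \<Longrightarrow> \<tau> \<le> t \<Longrightarrow> hs_norm s (U \<tau>) \<le> 2 * e)
        \<Longrightarrow> \<bar>(hs_norm s (U t))\<^sup>2 - (hs_norm s (U 0))\<^sup>2\<bar> \<le> 2 * e\<^sup>2"
    and t: "0 \<le> t" "t \<le> T"
  shows "hs_norm s (U t) \<le> 2 * e"
proof -
  have "hs_norm s (U t) < 2 * e"
  proof (rule continuity_bootstrap[OF seq_solution_continuous_norm[OF sol] _ _ t])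
    fix t assume t: "0 \<le> t" "t \<le> T" and "\<And>\<tau>. 0 \<le> \<tau> \<Longrightarrow> \<tau> \<le> t \<Longrightarrow> hs_norm s (U \<tau>) \<le> 2 * e"
    from step[OF this] have "(hs_norm s (U t))\<^sup>2 \<le> 3 * e\<^sup>2" using e by (simp add: abs_le_iff)
    also have "\<dots> < (2 * e)\<^sup>2" using e by (simp add: power_mult_distrib)
    finally show "hs_norm s (U t) < 2 * e" by (rule power2_less_imp_less) (use e in auto)
  qed (use e in auto)
  then show ?thesis by simp
qed

lemma cub_cnj: "cub N (\<lambda>k. cnj (x k)) k = cnj (cub N x k)"
  by (simp add: cub_def cnj_sum case_prod_unfold)

text \<open>Time reversal \<open>u(t) \<mapsto> cnj (u(-t))\<close>, coefficientwise, so that only forward times need to be treated.\<close>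

lemma seq_solution_reverse:
  assumes sol: "seq_solution s \<nu> U F"
  shows "seq_solution s \<nu> (\<lambda>t k. cnj (U (- t) k)) (\<lambda>t k. cnj (F (- t) k))"
  unfolding seq_solution_def
proof (intro conjI allI)
  fix t t0 k
  have n: "hs_norm s (\<lambda>k. cnj (x k) - cnj (y k)) = hs_norm s (\<lambda>k. x k - y k)" for x y
    by (simp add: hs_norm_def flip: complex_cnj_diff)
  show "hs_seq s (\<lambda>k. cnj (U (- t) k))"
    using seq_solution_hs[OF sol, of "- t"] by (simp add: hs_seq_def)
  have "((\<lambda>t. hs_norm s (\<lambda>k. U t k - U (- t0) k)) \<longlongrightarrow> 0) (at (- t0))"
    using sol by (simp add: seq_solution_def)
  then have "((\<lambda>t. hs_norm s (\<lambda>k. U (- t) k - U (- t0) k)) \<longlongrightarrow> 0) (at t0)"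
    by (simp add: filterlim_filtermap flip: filtermap_at_minus)
  then show "((\<lambda>t. hs_norm s (\<lambda>k. cnj (U (- t) k) - cnj (U (- t0) k))) \<longlongrightarrow> 0) (at t0)"
    by (simp only: n)
  have "((\<lambda>\<tau>. U (- \<tau>) k) has_vector_derivative - 1 *\<^sub>R (- \<i> * (of_real (\<nu> * (real k)\<^sup>2) * U (- t) k + F (- t) k))) (at t)"
    using vector_diff_chain_at[of uminus "-1" t "\<lambda>\<tau>. U \<tau> k", OF _ seq_solution_deriv[OF sol]]
    by (simp add: o_def has_vector_derivative_minus[OF has_vector_derivative_id, unfolded id_def])
  then show "((\<lambda>\<tau>. cnj (U (- \<tau>) k)) has_vector_derivative
       - \<i> * (of_real (\<nu> * (real k)\<^sup>2) * cnj (U (- t) k) + cnj (F (- t) k))) (at t)"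
    by (rule has_vector_derivative_cnj[THEN has_vector_derivative_eq_rhs]) simp
  show "(\<lambda>N. cub N (\<lambda>k. cnj (U (- t) k)) k) \<longlonglongrightarrow> cnj (F (- t) k)"
    unfolding cub_cnj using seq_solution_cub[OF sol] by (intro tendsto_cnj)
qed

lemma seq_solution_two_sided:
  assumes fwd: "\<And>U F t. seq_solution s \<nu> U F \<Longrightarrow> hs_norm s (U 0) = e \<Longrightarrow> 0 \<le> t \<Longrightarrow> t \<le> T \<Longrightarrow> hs_norm s (U t) \<le> B"
    and sol: "seq_solution s \<nu> U F" and e: "hs_norm s (U 0) = e" and t: "\<bar>t\<bar> \<le> T"
  shows "hs_norm s (U t) \<le> B"
proof (cases "t \<ge> 0")
  case True
  then show ?thesis using fwd[OF sol e] t by auto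
next
  case False
  have "hs_norm s (\<lambda>k. cnj (x k)) = hs_norm s x" for x by (simp add: hs_norm_def)
  then show ?thesis using fwd[OF seq_solution_reverse[OF sol], of "- t"] e t False by auto
qed

lemma sup_Hs_norm_le:
  assumes s: "s > 1/2" and u0: "u0 \<in> Hs_plus s" "Hs_norm s u0 = e" and sol: "nls_szego_solution s \<nu> u0 u"
    and fwd: "\<And>U F t. seq_solution s \<nu> U F \<Longrightarrow> hs_norm s (U 0) = e \<Longrightarrow> 0 \<le> t \<Longrightarrow> t \<le> T \<Longrightarrow> hs_norm s (U t) \<le> B"
  shows "sup_Hs_norm s T u \<le> ereal B"
  unfolding sup_Hs_norm_def
proof (rule SUP_least)
  fix t assume t: "t \<in> {- T..T}"
  define U where "U = (\<lambda>t k. fourier_coeff (u t) (int k))"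
  obtain F where F: "seq_solution s \<nu> U F" using solution_seq_solution(1)[OF s sol] by (auto simp: U_def)
  have "u0 \<in> L2_circle" using u0(1) by (simp add: Hs_plus_def Hs_circle_def)
  then have "U 0 = (fcoeffs u0)"
    using solution_seq_solution(3)[OF s sol] by (auto simp: U_def)
  then have "hs_norm s (U 0) = e" using Hs_plus_seq(2)[OF u0(1)] u0(2) by simp
  then have "hs_norm s (U t) \<le> B"
    using t F by (intro seq_solution_two_sided[where T = T and e = e and U = U and F = F and \<nu> = \<nu>] fwd) auto
  then show "ereal (Hs_norm s (u t)) \<le> ereal B"
    using solution_seq_solution(2)[OF s sol] by (simp add: U_def)
qed

text \<open>With \<open>R = 2 e\<close> the constants of the two energy estimates become \<open>6 * 2^4 = 96\<close> and \<open>24 * 2^6 = 1536\<close>.\<close>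

definition lifespan :: "real \<Rightarrow> real" where
  "lifespan s = 1 / (2 + 96 * qc s + 1536 * (qc s)\<^sup>2)"

lemma lifespan_bounds:
  "0 < lifespan s" "lifespan s < 1" "96 * qc s * lifespan s \<le> 1" "1536 * (qc s)\<^sup>2 * lifespan s \<le> 1"
proof -
  have d: "2 + 96 * qc s + 1536 * (qc s)\<^sup>2 > 1" using qc_nonneg[of s] by (simp add: add_pos_nonneg)
  show "0 < lifespan s" "lifespan s < 1" using d by (auto simp: lifespan_def)
  show "96 * qc s * lifespan s \<le> 1" "1536 * (qc s)\<^sup>2 * lifespan s \<le> 1"
    using d qc_nonneg[of s] by (auto simp: lifespan_def field_simps)
qed

lemma cubic_time_bound:
  assumes s: "s > 1/2" and sol: "seq_solution s \<nu> U F" and e: "hs_norm s (U 0) = e" "e > 0"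
    and t: "0 \<le> t" "t \<le> lifespan s * e powr (- 2)"
  shows "hs_norm s (U t) \<le> 2 * e"
proof (rule seq_solution_bootstrap[OF sol e _ t])
  fix t assume t: "0 \<le> t" "t \<le> lifespan s * e powr (- 2)"
    and R: "\<And>\<tau>. 0 \<le> \<tau> \<Longrightarrow> \<tau> \<le> t \<Longrightarrow> hs_norm s (U \<tau>) \<le> 2 * e"
  have p: "e powr (-2) = 1 / e\<^sup>2" using e(2) by (simp add: powr_minus_divide)
  have "\<bar>(hs_norm s (U t))\<^sup>2 - (hs_norm s (U 0))\<^sup>2\<bar> \<le> 6 * qc s * (2 * e) ^ 4 * t"
    by (rule energy_growth_cubic[OF s sol t(1) R])
  also have "\<dots> \<le> 6 * qc s * (2 * e) ^ 4 * (lifespan s * (1 / e\<^sup>2))"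
    using t(2) qc_nonneg[of s] by (intro mult_left_mono) (auto simp: p)
  also have "\<dots> = 96 * qc s * lifespan s * e\<^sup>2"
    using e(2) by (simp add: field_simps eval_nat_numeral)
  also have "\<dots> \<le> 1 * e\<^sup>2" by (intro mult_right_mono lifespan_bounds) auto
  finally show "\<bar>(hs_norm s (U t))\<^sup>2 - (hs_norm s (U 0))\<^sup>2\<bar> \<le> 2 * e\<^sup>2" by simp
qed

text \<open>The second hypothesis on \<open>\<nu>\<close> keeps the correction, of size \<open>e^4 / \<nu>\<close>, below the energy.\<close>

lemma quintic_time_bound:
  assumes s: "s > 1/2" and sol: "seq_solution s \<nu> U F" and e: "hs_norm s (U 0) = e" "e > 0"
    and \<nu>: "\<nu> > 0" "64 * qc s * e\<^sup>2 \<le> \<nu>"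
    and t: "0 \<le> t" "t \<le> lifespan s * \<nu> / e ^ 4"
  shows "hs_norm s (U t) \<le> 2 * e"
proof (rule seq_solution_bootstrap[OF sol e _ t])
  fix t assume t: "0 \<le> t" "t \<le> lifespan s * \<nu> / e ^ 4"
    and R: "\<And>\<tau>. 0 \<le> \<tau> \<Longrightarrow> \<tau> \<le> t \<Longrightarrow> hs_norm s (U \<tau>) \<le> 2 * e"
  have "\<bar>(hs_norm s (U t))\<^sup>2 - (hs_norm s (U 0))\<^sup>2\<bar>
      \<le> 4 * qc s * (2 * e) ^ 4 / \<nu> + 24 * (qc s)\<^sup>2 * (2 * e) ^ 6 / \<nu> * t"
    by (rule energy_growth_normal_form[OF s sol \<nu>(1) t(1) R])
  also have "\<dots> \<le> 4 * qc s * (2 * e) ^ 4 / \<nu> + 24 * (qc s)\<^sup>2 * (2 * e) ^ 6 / \<nu> * (lifespan s * \<nu> / e ^ 4)"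
    using t(2) \<nu>(1) e(2) by (intro add_left_mono mult_left_mono) auto
  also have "\<dots> = 64 * qc s * e\<^sup>2 / \<nu> * e\<^sup>2 + 1536 * (qc s)\<^sup>2 * lifespan s * e\<^sup>2"
    using e(2) \<nu>(1) by (simp add: field_simps eval_nat_numeral)
  also have "\<dots> \<le> 1 * e\<^sup>2 + 1 * e\<^sup>2"
    using \<nu> by (intro add_mono mult_right_mono lifespan_bounds) auto
  finally show "\<bar>(hs_norm s (U t))\<^sup>2 - (hs_norm s (U 0))\<^sup>2\<bar> \<le> 2 * e\<^sup>2" by simp
qed

text \<open>For \<open>\<alpha> = 2\<close> the two time scales coincide, and there the cubic bound is used, since the
normal form correction is no longer small.  The threshold for \<open>\<alpha> < 2\<close> comes from \<open>64 * qc s * \<epsilon>\<^sup>2 \<le> \<epsilon> powr \<alpha>\<close>.\<close>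

theorem long_time_bound:
  assumes s: "s > 1/2" and \<alpha>: "\<alpha> \<ge> 0"
  shows "\<exists>\<epsilon>0>0. \<forall>\<epsilon>. 0 < \<epsilon> \<and> \<epsilon> < \<epsilon>0 \<longrightarrow>
        (\<forall>u0\<in>Hs_plus s. Hs_norm s u0 = \<epsilon> \<longrightarrow>
          (\<forall>u. nls_szego_solution s (\<epsilon> powr \<alpha>) u0 u \<longrightarrow>
             (\<alpha> \<le> 2 \<longrightarrow> sup_Hs_norm s (lifespan s * \<epsilon> powr (- (4 - \<alpha>))) u \<le> ereal (2 * \<epsilon>)) \<and>
             (\<alpha> > 2 \<longrightarrow> sup_Hs_norm s (lifespan s * \<epsilon> powr (- 2)) u \<le> ereal (2 * \<epsilon>))))"
proof (cases "\<alpha> < 2")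
  case False
  have "sup_Hs_norm s (lifespan s * \<epsilon> powr (- 2)) u \<le> ereal (2 * \<epsilon>)"
    if "0 < \<epsilon>" "u0 \<in> Hs_plus s" "Hs_norm s u0 = \<epsilon>" "nls_szego_solution s (\<epsilon> powr \<alpha>) u0 u" for \<epsilon> u0 u
    by (rule sup_Hs_norm_le[OF s that(2-4)]) (rule cubic_time_bound[OF s _ _ that(1)])
  then show ?thesis using False by (intro exI[of _ 1]) auto
next
  case True
  define e0 where "e0 = (1 / (64 * qc s + 1)) powr (1 / (2 - \<alpha>))"
  have q: "64 * qc s + 1 > 0" using qc_nonneg[of s] by linarith
  have "e0 > 0" using q by (simp add: e0_def)
  moreover have "sup_Hs_norm s (lifespan s * \<epsilon> powr (- (4 - \<alpha>))) u \<le> ereal (2 * \<epsilon>)"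
    if \<epsilon>: "0 < \<epsilon>" "\<epsilon> < e0" and u: "u0 \<in> Hs_plus s" "Hs_norm s u0 = \<epsilon>" "nls_szego_solution s (\<epsilon> powr \<alpha>) u0 u" for \<epsilon> u0 u
  proof -
    have "\<epsilon> powr (2 - \<alpha>) \<le> e0 powr (2 - \<alpha>)" using \<epsilon> True by (intro powr_mono2) auto
    also have "\<dots> = 1 / (64 * qc s + 1)" using True q by (simp add: e0_def powr_powr)
    finally have "\<epsilon> powr (2 - \<alpha>) * (64 * qc s + 1) \<le> 1" using q by (simp add: field_simps)
    moreover have "\<epsilon> powr (2 - \<alpha>) > 0" using \<epsilon> by simp
    moreover have "\<epsilon> powr (2 - \<alpha>) * (64 * qc s + 1) = 64 * qc s * \<epsilon> powr (2 - \<alpha>) + \<epsilon> powr (2 - \<alpha>)"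
      by (simp add: algebra_simps)
    ultimately have "64 * qc s * \<epsilon> powr (2 - \<alpha>) \<le> 1" by linarith
    then have "64 * qc s * \<epsilon> powr (2 - \<alpha>) * \<epsilon> powr \<alpha> \<le> 1 * \<epsilon> powr \<alpha>" by (intro mult_right_mono) auto
    then have sm: "64 * qc s * \<epsilon>\<^sup>2 \<le> \<epsilon> powr \<alpha>"
      using \<epsilon> by (simp add: mult.assoc powr_add[symmetric])
    have T: "lifespan s * \<epsilon> powr (- (4 - \<alpha>)) = lifespan s * \<epsilon> powr \<alpha> / \<epsilon> ^ 4"
      using \<epsilon> by (simp add: powr_diff)
    have pos: "\<epsilon> powr \<alpha> > 0" using \<epsilon> by simp
    show ?thesis unfolding T
      by (rule sup_Hs_norm_le[OF s u]) (rule quintic_time_bound[OF s _ _ \<epsilon>(1) pos sm])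
  qed
  ultimately show ?thesis using True by (intro exI[of _ e0]) auto
qed

section \<open>Stability in the Wiener algebra\<close>

lemma l1_cub_diff:
  assumes X: "l1 M x \<le> X" and Y: "l1 M y \<le> Y"
  shows "(\<Sum>k\<le>M. cmod (cub M x k - cub M y k)) \<le> (X\<^sup>2 + X * Y + Y\<^sup>2) * l1 M (\<lambda>k. x k - y k)"
proof -
  have p: "0 \<le> X" "0 \<le> Y" using X Y l1_nonneg order_trans by blast+
  let ?d = "\<lambda>k. x k - y k"
  have q: "(\<Sum>k\<le>M. \<Sum>(a, b, c)\<in>trip M k. cmod (f a) * cmod (g b) * cmod (h c)) \<le> l1 M f * l1 M g * l1 M h" for f g h
    unfolding sum_trip_quad l1_def by (rule trip_l1) auto
  have "(\<Sum>k\<le>M. cmod (cub M x k - cub M y k)) \<le>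
     (\<Sum>k\<le>M. (\<Sum>(a, b, c)\<in>trip M k. cmod (?d a) * cmod (x b) * cmod (x c))
   + (\<Sum>(a, b, c)\<in>trip M k. cmod (y a) * cmod (?d b) * cmod (x c))
   + (\<Sum>(a, b, c)\<in>trip M k. cmod (y a) * cmod (y b) * cmod (?d c)))"
    by (intro sum_mono cmod_cub_diff)
  also have "\<dots> \<le> l1 M ?d * l1 M x * l1 M x + l1 M y * l1 M ?d * l1 M x + l1 M y * l1 M y * l1 M ?d"
    unfolding sum.distrib by (intro add_mono q)
  also have "\<dots> \<le> l1 M ?d * X * X + Y * l1 M ?d * X + Y * Y * l1 M ?d"
    using p by (intro add_mono mult_mono X Y) auto
  finally show ?thesis by (simp add: power2_eq_square algebra_simps)
qed

lemma l1_cub_limit_diff: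
  assumes x: "ell1 x" "l1_norm x \<le> X"
    and y: "ell1 y" "l1_norm y \<le> Y"
    and F: "\<And>k. (\<lambda>M. cub M x k) \<longlonglongrightarrow> F k" and G: "\<And>k. (\<lambda>M. cub M y k) \<longlonglongrightarrow> G k"
    and d: "ell1 (\<lambda>k. x k - y k)"
  shows "(\<Sum>k\<le>n. cmod (F k - G k)) \<le> (X\<^sup>2 + X * Y + Y\<^sup>2) * l1_norm (\<lambda>k. x k - y k)"
proof (rule LIMSEQ_le_const2)
  show "(\<lambda>M. \<Sum>k\<le>n. cmod (cub M x k - cub M y k)) \<longlonglongrightarrow> (\<Sum>k\<le>n. cmod (F k - G k))"
    by (intro tendsto_intros F G)
  have l: "l1 M z \<le> l1_norm z" if "ell1 z" for M z
    unfolding l1_def by (rule sum_le_suminf) (use that in auto)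
  have p: "0 \<le> X" "0 \<le> Y" using l[OF x(1), of 0] l[OF y(1), of 0] x(2) y(2) l1_nonneg[of 0 x] l1_nonneg[of 0 y] by linarith+
  show "\<exists>N. \<forall>M\<ge>N. (\<Sum>k\<le>n. cmod (cub M x k - cub M y k)) \<le> (X\<^sup>2 + X * Y + Y\<^sup>2) * l1_norm (\<lambda>k. x k - y k)"
  proof (intro exI allI impI)
    fix M assume "n \<le> M"
    then have "(\<Sum>k\<le>n. cmod (cub M x k - cub M y k)) \<le> (\<Sum>k\<le>M. cmod (cub M x k - cub M y k))"
      by (intro sum_mono2) auto
    also have "\<dots> \<le> (X\<^sup>2 + X * Y + Y\<^sup>2) * l1 M (\<lambda>k. x k - y k)"
      using l[OF x(1), of M] l[OF y(1), of M] x(2) y(2) by (intro l1_cub_diff) auto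
    also have "\<dots> \<le> (X\<^sup>2 + X * Y + Y\<^sup>2) * l1_norm (\<lambda>k. x k - y k)"
      using p by (intro mult_left_mono l d) auto
    finally show "(\<Sum>k\<le>n. cmod (cub M x k - cub M y k)) \<le> (X\<^sup>2 + X * Y + Y\<^sup>2) * l1_norm (\<lambda>k. x k - y k)" .
  qed
qed

text \<open>The comparison of a solution \<open>U\<close> of the dispersive system with a solution \<open>w\<close> of the dispersionless one.
While the distance is at most 1 the two sequences have \<open>l\<^sup>1\<close> norms at most 5 and 4, which makes the cubic
term Lipschitz with constant \<open>25 + 20 + 16 = 61\<close>.  The exponent 62 leaves room for the forcing \<open>\<eta>\<close>
that \<open>w\<close> contributes through the dispersive term.\<close>

lemma l1_perturbation:
  fixes U w F G :: "real \<Rightarrow> nat \<Rightarrow> complex"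
  assumes dU: "\<And>t k. ((\<lambda>\<tau>. U \<tau> k) has_vector_derivative - \<i> * (of_real (\<nu> * (real k)\<^sup>2) * U t k + F t k)) (at t)"
    and dw: "\<And>t k. ((\<lambda>\<tau>. w \<tau> k) has_vector_derivative - \<i> * G t k) (at t)"
    and F: "\<And>t k. (\<lambda>M. cub M (U t) k) \<longlonglongrightarrow> F t k" and G: "\<And>t k. (\<lambda>M. cub M (w t) k) \<longlonglongrightarrow> G t k"
    and U1: "\<And>t. ell1 (U t)"
    and w1: "\<And>t. ell1 (w t)" "\<And>t. l1_norm (w t) \<le> 4"
    and cont: "continuous_on {0..T} (\<lambda>t. \<Sum>k. cmod (U t k - w t k))"
    and init: "\<And>k. U 0 k = w 0 k"
    and disp: "\<And>n t. (\<Sum>k\<le>n. cmod (of_real (\<nu> * (real k)\<^sup>2) * w t k)) \<le> \<eta>"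
    and \<eta>: "\<eta> > 0" "\<eta> * exp (62 * T) \<le> 1"
    and t: "0 \<le> t" "t \<le> T"
  shows "l1_norm (\<lambda>k. U t k - w t k) \<le> \<eta> * exp (62 * t)"
proof -
  define \<rho> where "\<rho> t = l1_norm (\<lambda>k. U t k - w t k)" for t
  have sd: "ell1 (\<lambda>k. U t k - w t k)" for t
    by (rule summable_comparison_test'[OF summable_add[OF U1 w1(1)]]) (auto intro: norm_triangle_ineq4)
  have U\<rho>: "l1_norm (U t) \<le> \<rho> t + 4" for t
  proof -
    have "l1_norm (U t) \<le> (\<Sum>k. cmod (U t k - w t k) + cmod (w t k))"
    proof (rule suminf_le[OF _ U1 summable_add[OF sd w1(1)]])
      show "cmod (U t k) \<le> cmod (U t k - w t k) + cmod (w t k)" for k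
        using norm_triangle_ineq[of "U t k - w t k" "w t k"] by simp
    qed
    also have "\<dots> = \<rho> t + l1_norm (w t)"
      unfolding \<rho>_def by (rule suminf_add[OF sd w1(1), symmetric])
    finally show ?thesis using w1(2)[of t] by linarith
  qed
  \<comment> \<open>Bootstrap on the distance divided by its expected growth.\<close>
  have "\<rho> t * exp (- (62 * t)) < \<eta>"
  proof (rule continuity_bootstrap[where f = "\<lambda>t. \<rho> t * exp (- (62 * t))", OF _ _ _ t])
    show "continuous_on {0..T} (\<lambda>t. \<rho> t * exp (- (62 * t)))"
      unfolding \<rho>_def by (intro continuous_intros cont)
    show "\<rho> 0 * exp (- (62 * 0)) < \<eta>" using \<eta> by (simp add: \<rho>_def init)
    fix t assume t: "0 \<le> t" "t \<le> T" and "\<And>\<tau>. 0 \<le> \<tau> \<Longrightarrow> \<tau> \<le> t \<Longrightarrow> \<rho> \<tau> * exp (- (62 * \<tau>)) \<le> \<eta>"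
    then have H: "\<rho> \<tau> \<le> \<eta> * exp (62 * \<tau>)" if "0 \<le> \<tau>" "\<tau> \<le> t" for \<tau>
      using that by (simp add: exp_minus field_simps)
    have H1: "\<rho> \<tau> \<le> 1" if "0 \<le> \<tau>" "\<tau> \<le> t" for \<tau>
    proof -
      have "\<rho> \<tau> \<le> \<eta> * exp (62 * \<tau>)" by (rule H[OF that])
      also have "\<dots> \<le> \<eta> * exp (62 * T)" using that t \<eta> by (intro mult_left_mono) auto
      finally show ?thesis using \<eta> by simp
    qed
    have "(\<Sum>k\<le>n. cmod (U t k - w t k)) \<le> \<eta> * exp (62 * t) - \<eta>" for n
    proof (cases "t = 0")
      case True then show ?thesis by (simp add: init)
    next
      case False
      \<comment> \<open>The factor removes the linear phase, so that the unbounded multiplier hits only \<open>w\<close>.\<close>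
      define z where "z k \<tau> = cis (\<nu> * (real k)\<^sup>2 * \<tau>) * (U \<tau> k - w \<tau> k)" for k \<tau>
      \<comment> \<open>Unimodular factors that turn the partial \<open>l\<^sup>1\<close> norm at time \<open>t\<close> into a linear functional.\<close>
      define \<theta> where "\<theta> k = cnj (sgn (z k t))" for k
      have \<theta>: "\<theta> k * z k t = of_real (cmod (U t k - w t k))" for k
      proof -
        have "cnj (sgn v) * v = of_real (cmod v)" for v :: complex
        proof (cases "v = 0")
          case False
          then show ?thesis
            by (simp add: sgn_eq field_simps power2_eq_square[symmetric] complex_norm_square del: of_real_power)
               (simp add: complex_norm_square[symmetric] power2_eq_square mult.commute)
        qed simp
        then show ?thesis by (simp add: \<theta>_def, simp add: z_def norm_mult)
      qed
      define dz where "dz k \<tau> = cis (\<nu> * (real k)\<^sup>2 * \<tau>) * (- \<i> * (of_real (\<nu> * (real k)\<^sup>2) * w \<tau> k + (F \<tau> k - G \<tau> k)))" for k \<tau>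
      have dz: "(z k has_vector_derivative dz k \<tau>) (at \<tau>)" for k \<tau>
      proof -
        have "(z k has_vector_derivative (cis (\<nu> * (real k)\<^sup>2 * \<tau>) * (- \<i> * (of_real (\<nu> * (real k)\<^sup>2) * U \<tau> k + F \<tau> k) - - \<i> * G \<tau> k)
             + (\<i> * of_real (\<nu> * (real k)\<^sup>2) * cis (\<nu> * (real k)\<^sup>2 * \<tau>)) * (U \<tau> k - w \<tau> k))) (at \<tau>)"
          unfolding z_def[abs_def]
          by (intro has_vector_derivative_mult has_vector_derivative_diff has_vector_derivative_cis_mult dU dw)
        then show ?thesis
          by (rule has_vector_derivative_eq_rhs) (simp add: dz_def algebra_simps)
      qed
      have "norm ((\<Sum>k\<le>n. \<theta> k * z k t) - (\<Sum>k\<le>n. \<theta> k * z k 0)) \<le> \<eta> * exp (62 * t) - \<eta> * exp (62 * 0)"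
      proof (rule differentiable_bound_general)
        show "0 < t" using t False by simp
        have d: "((\<lambda>\<tau>. \<Sum>k\<le>n. \<theta> k * z k \<tau>) has_vector_derivative (\<Sum>k\<le>n. \<theta> k * dz k \<tau>)) (at \<tau>)" for \<tau>
          by (intro has_vector_derivative_sum has_vector_derivative_mult_right dz)
        then show "((\<lambda>\<tau>. \<Sum>k\<le>n. \<theta> k * z k \<tau>) has_vector_derivative (\<Sum>k\<le>n. \<theta> k * dz k \<tau>)) (at \<tau>)" for \<tau> .
        show "continuous_on {0..t} (\<lambda>\<tau>. \<Sum>k\<le>n. \<theta> k * z k \<tau>)"
          using has_vector_derivative_continuous[OF d] by (simp add: continuous_at_imp_continuous_on)
        show "continuous_on {0..t} (\<lambda>\<tau>. \<eta> * exp (62 * \<tau>))" by (intro continuous_intros)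
        show "((\<lambda>\<tau>. \<eta> * exp (62 * \<tau>)) has_vector_derivative \<eta> * (62 * exp (62 * \<tau>))) (at \<tau>)" for \<tau>
          unfolding has_real_derivative_iff_has_vector_derivative[symmetric]
          by (auto intro!: derivative_eq_intros)
        fix \<tau> assume "0 < \<tau>" "\<tau> < t"
        then have \<tau>: "0 \<le> \<tau>" "\<tau> \<le> t" by auto
        have "norm (\<Sum>k\<le>n. \<theta> k * dz k \<tau>) \<le> (\<Sum>k\<le>n. cmod (of_real (\<nu> * (real k)\<^sup>2) * w \<tau> k) + cmod (F \<tau> k - G \<tau> k))"
        proof (rule order_trans[OF norm_sum], rule sum_mono)
          fix k
          have "norm (\<theta> k * dz k \<tau>) \<le> 1 * norm (dz k \<tau>)"
            unfolding norm_mult by (intro mult_right_mono) (auto simp: \<theta>_def norm_sgn)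
          also have "\<dots> = cmod (of_real (\<nu> * (real k)\<^sup>2) * w \<tau> k + (F \<tau> k - G \<tau> k))"
            by (simp add: dz_def norm_mult)
          also have "\<dots> \<le> cmod (of_real (\<nu> * (real k)\<^sup>2) * w \<tau> k) + cmod (F \<tau> k - G \<tau> k)" by (rule norm_triangle_ineq)
          finally show "norm (\<theta> k * dz k \<tau>) \<le> cmod (of_real (\<nu> * (real k)\<^sup>2) * w \<tau> k) + cmod (F \<tau> k - G \<tau> k)" .
        qed
        also have "\<dots> \<le> \<eta> + (5\<^sup>2 + 5 * 4 + 4\<^sup>2) * \<rho> \<tau>"
          unfolding sum.distrib \<rho>_def using U\<rho>[of \<tau>] H1[OF \<tau>]
          by (intro add_mono disp l1_cub_limit_diff U1 w1 F G sd) auto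
        also have "\<dots> \<le> \<eta> * exp (62 * \<tau>) + 61 * (\<eta> * exp (62 * \<tau>))"
          using H[OF \<tau>] \<tau> \<eta> by (intro add_mono) auto
        finally show "norm (\<Sum>k\<le>n. \<theta> k * dz k \<tau>) \<le> \<eta> * (62 * exp (62 * \<tau>))" by simp
      qed
      moreover have "z k 0 = 0" for k by (simp add: z_def init)
      moreover have "norm (\<Sum>k\<le>n. \<theta> k * z k t) = (\<Sum>k\<le>n. cmod (U t k - w t k))"
        unfolding \<theta> of_real_sum[symmetric] norm_of_real by (simp add: sum_nonneg)
      ultimately show ?thesis by simp
    qed
    then have "\<rho> t \<le> \<eta> * exp (62 * t) - \<eta>"
      unfolding \<rho>_def by (intro LIMSEQ_le_const2[OF summable_LIMSEQ'[OF sd]]) auto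
    then have "\<rho> t < \<eta> * exp (62 * t)" using \<eta> by simp
    then show "\<rho> t * exp (- (62 * t)) < \<eta>" by (simp add: exp_minus field_simps)
  qed
  then show ?thesis unfolding \<rho>_def by (simp add: exp_minus field_simps)
qed

section \<open>The cubic term of a rational function with one pole\<close>

text \<open>The identities that make the explicit formula a solution, with all phases divided out.  The variables
stand for the imaginary unit \<open>i\<close>, for \<open>r = 1 / sqrt (4 + d\<^sup>2)\<close> and for sine \<open>s\<close> and cosine \<open>c\<close> of the internal angle;
\<open>Bc\<close> and \<open>Pc\<close> play the part of the conjugates of \<open>B\<close> and \<open>P\<close>.  The last three are the equations
for the pole \<open>p\<close>, for \<open>b\<close> and for \<open>c\<close>; the last two reduce to the earlier ones by hand.\<close>

lemma szego_algebra:
  fixes i r d s c :: complex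
  assumes i: "i * i = -1" and r: "r * r * (4 + d * d) = 1" and s: "s * s + c * c = 1"
  defines "B \<equiv> d * c - i * (2 + d * d) * r * s" and "Bc \<equiv> d * c + i * (2 + d * d) * r * s"
    and "P \<equiv> - 2 * i * r * s" and "Pc \<equiv> 2 * i * r * s" and "y \<equiv> 1 - 4 * r * r * s * s"
  shows "P * Pc = 1 - y" (is ?A1)
    and "B * Bc = 1 + d * d - y" (is ?A2)
    and "(1 + B * P) * (1 + Bc * Pc) = y * y" (is ?A3)
    and "d * c + d * d / 2 * P = Bc * (1 + B * P) + y * P" (is ?A4)
    and "- i * d * d * r * (4 + d * d) * s / 2 + d * (2 + d * d) / 2 * c + (1 + d * d / 2) * B
       = (1 + d * d + y) * B + (1 + B * P) * Pc" (is ?A5)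
    and "i * ((- d * d * r * (4 + d * d) * s / 2 - i * d * (2 + d * d) / 2 * c) * P + B * (- i * d * c))
          + (1 + d * d) * (1 + B * P) = 2 * (1 + d * d - y) * (1 + B * P) + 2 * y * P * B + (1 + B * P)" (is ?A6)
proof -
  show PP: ?A1 unfolding P_def Pc_def y_def using i by algebra
  show BB: ?A2 unfolding B_def Bc_def y_def using i r s by algebra
  show ?A3 unfolding B_def Bc_def P_def Pc_def y_def using i r s by algebra
  show p: ?A4
    unfolding B_def Bc_def P_def Pc_def y_def using i r s by algebra
  have b: "- i * d * d * r * (4 + d * d) * s / 2 + d * (2 + d * d) / 2 * c = (1 + d * d / 2) * B + Pc"
    unfolding B_def Pc_def by (simp add: field_simps)
  have "(1 + d * d + y) * B + (1 + B * P) * Pc = (1 + d * d + y) * B + Pc + B * (P * Pc)"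
    by (simp add: algebra_simps)
  also have "\<dots> = (2 + d * d) * B + Pc" unfolding PP by (simp add: algebra_simps)
  finally have F: "(1 + d * d + y) * B + (1 + B * P) * Pc = (2 + d * d) * B + Pc" .
  show ?A5
    unfolding b F by (simp add: field_simps)
  have "i * (- d * d * r * (4 + d * d) * s / 2 - i * d * (2 + d * d) / 2 * c)
      = - i * d * d * r * (4 + d * d) * s / 2 - (i * i) * (d * (2 + d * d) / 2 * c)"
    by (simp add: field_simps)
  then have ib: "i * (- d * d * r * (4 + d * d) * s / 2 - i * d * (2 + d * d) / 2 * c) = (1 + d * d / 2) * B + Pc"
    unfolding i by (simp flip: b)
  have dc: "d * c = Bc * (1 + B * P) + y * P - d * d / 2 * P" using p by (simp add: algebra_simps)
  have "i * ((- d * d * r * (4 + d * d) * s / 2 - i * d * (2 + d * d) / 2 * c) * P + B * (- i * d * c))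
      = i * (- d * d * r * (4 + d * d) * s / 2 - i * d * (2 + d * d) / 2 * c) * P - (i * i) * B * (d * c)"
    by (simp add: algebra_simps)
  also have "\<dots> = ((1 + d * d / 2) * B + Pc) * P + B * (d * c)" unfolding ib i by simp
  also have "\<dots> = (1 + d * d / 2) * B * P + P * Pc + (B * Bc) * (1 + B * P) + y * P * B - d * d / 2 * P * B"
    unfolding dc by (simp add: algebra_simps)
  finally have F: "i * ((- d * d * r * (4 + d * d) * s / 2 - i * d * (2 + d * d) / 2 * c) * P + B * (- i * d * c))
      = (1 + d * d / 2) * B * P + P * Pc + (B * Bc) * (1 + B * P) + y * P * B - d * d / 2 * P * B" .
  show ?A6
    unfolding F PP BB by (simp add: field_simps)
qed

lemma sums_geometric_cis:
  fixes p :: complex and x :: real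
  assumes p: "cmod p < 1"
  defines "f \<equiv> cis x / (1 - p * cis x)"
  shows "(\<lambda>k. p ^ k * cis (real (Suc k) * x)) sums f"
    and "(\<lambda>k. of_nat k * p ^ (k - 1) * cis (real (Suc k) * x)) sums f\<^sup>2"
proof -
  let ?z = "cis x"
  have zp: "cis (real n * x) = ?z ^ n" for n by (simp only: Complex.DeMoivre)
  have n: "norm (p * ?z) < 1" using p by (simp add: norm_mult)
  have "(\<lambda>k. ?z * (p * ?z) ^ k) sums (?z * (1 / (1 - p * ?z)))"
    by (intro sums_mult geometric_sums n)
  then show "(\<lambda>k. p ^ k * cis (real (Suc k) * x)) sums f"
    unfolding zp f_def by (simp add: power_mult_distrib mult_ac)
  have "(\<lambda>k. ?z\<^sup>2 * (of_nat (Suc k) * (p * ?z) ^ k)) sums (?z\<^sup>2 * (1 / (1 - p * ?z)\<^sup>2))"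
    by (intro sums_mult geometric_deriv_sums n)
  then have "(\<lambda>k. of_nat (Suc k) * p ^ (Suc k - 1) * cis (real (Suc (Suc k)) * x)) sums (f\<^sup>2)"
    unfolding zp f_def by (simp add: power_mult_distrib mult_ac power2_eq_square)
  from sums_Suc[OF this] show "(\<lambda>k. of_nat k * p ^ (k - 1) * cis (real (Suc k) * x)) sums f\<^sup>2"
    by simp
qed

lemma summable_geometric_norm:
  fixes p :: complex
  assumes p: "cmod p < 1"
  shows "ell1 (\<lambda>k. c * p ^ k)" "ell1 (\<lambda>k. c * (of_nat k * p ^ (k - 1)))"
proof -
  show "ell1 (\<lambda>k. c * p ^ k)"
    unfolding norm_mult norm_power using p by (intro summable_mult summable_geometric) simp
  have "summable (\<lambda>k. of_nat (Suc k) * cmod p ^ k)"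
    using geometric_deriv_sums[of "cmod p"] p by (intro sums_summable) auto
  then have "summable (\<lambda>k. real k * cmod p ^ (k - 1))"
    by (subst summable_Suc_iff[symmetric]) simp
  then show "ell1 (\<lambda>k. c * (of_nat k * p ^ (k - 1)))"
    unfolding norm_mult norm_power by (intro summable_mult) simp
qed

text \<open>The coefficients of \<open>b + c z / (1 - p z)\<close>.\<close>

definition rat_seq :: "complex \<Rightarrow> complex \<Rightarrow> complex \<Rightarrow> nat \<Rightarrow> complex" where
  "rat_seq b c p k = (case k of 0 \<Rightarrow> b | Suc j \<Rightarrow> c * p ^ j)"

text \<open>The coefficients of its cubic term.  They involve only \<open>z / (1 - p z)\<close> and its square, so the
Szego flow preserves this family of functions.\<close>

definition rat_cub :: "complex \<Rightarrow> complex \<Rightarrow> complex \<Rightarrow> nat \<Rightarrow> complex" where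
  "rat_cub b c p k = (let m = of_real (1 / (1 - (cmod p)\<^sup>2)); n = c * cnj c in
     case k of 0 \<Rightarrow> b * cnj b * b + 2 * b * n * m + c * n * m\<^sup>2 * cnj p
     | Suc j \<Rightarrow> (2 * b * cnj b * c + 2 * b * n * m * p + c * n * m\<^sup>2) * p ^ j
           + (cnj b * c\<^sup>2 + c * n * m * p) * (of_nat j * p ^ (j - 1)))"

lemma fser_Suc:
  assumes "(\<lambda>k. h (Suc k) * cis (real (Suc k) * x)) sums S"
  shows "fser h x = h 0 + S"
  using sums_unique[OF sums_Suc[of "\<lambda>k. h k * cis (real k * x)", OF assms]] by (simp add: fser_def add.commute)

lemma fourier_coeff_cnj: "fourier_coeff (\<lambda>x. cnj (f x)) k = cnj (fourier_coeff f (- k))"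
proof -
  have "(\<integral>x. cnj (f x) * cis (- (of_int k * x)) \<partial>circ) = (\<integral>x. cnj (f x * cis (- (of_int (- k) * x))) \<partial>circ)"
    by (intro Bochner_Integration.integral_cong) (auto simp: cis_cnj)
  also have "\<dots> = cnj (\<integral>x. f x * cis (- (of_int (- k) * x)) \<partial>circ)" by (rule Bochner_Integration.integral_cnj)
  finally show ?thesis by (simp add: fourier_coeff_circ)
qed

text \<open>With \<open>f = z / (1 - p z)\<close> and \<open>m = 1 / (1 - |p|\<^sup>2)\<close>, on the circle \<open>|f|\<^sup>2 = m (1 + p f + cnj (p f))\<close>.  Applying this
twice writes the cubic term as a combination of \<open>1\<close>, \<open>f\<close>, \<open>f\<^sup>2\<close> and \<open>cnj f\<close>; the last has only negative
frequencies.\<close>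

lemma cub_rat_seq:
  assumes p: "cmod p < 1"
  shows "(\<lambda>N. cub N (rat_seq b c p) k) \<longlonglongrightarrow> rat_cub b c p k"
proof -
  define m where "m = complex_of_real (1 / (1 - (cmod p)\<^sup>2))"
  define n where "n = c * cnj c"
  define f where "f x = cis x / (1 - p * cis x)" for x
  define h where "h k = (case k of 0 \<Rightarrow> 0 | Suc j \<Rightarrow> p ^ j)" for k
  define D where "D = b * n * m * cnj p * 2 + (b * b * cnj c + c * n * m\<^sup>2 * (cnj p)\<^sup>2)"
  have sm: "ell1 (rat_seq b c p)" "ell1 h" "ell1 (rat_cub b c p)"
  proof -
    show "ell1 (rat_seq b c p)"
      by (subst summable_Suc_iff[symmetric]) (use summable_geometric_norm(1)[OF p, of c] in \<open>simp add: rat_seq_def\<close>)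
    show "ell1 h"
      by (subst summable_Suc_iff[symmetric]) (use summable_geometric_norm(1)[OF p, of 1] in \<open>simp add: h_def\<close>)
    show "ell1 (rat_cub b c p)"
    proof (subst summable_Suc_iff[symmetric])
      let ?C = "2 * b * cnj b * c + 2 * b * n * m * p + c * n * m\<^sup>2" and ?E = "cnj b * c\<^sup>2 + c * n * m * p"
      have "rat_cub b c p (Suc j) = ?C * p ^ j + ?E * (of_nat j * p ^ (j - 1))" for j
        by (simp add: rat_cub_def Let_def m_def n_def)
      then show "ell1 (\<lambda>k. rat_cub b c p (Suc k))"
        by (intro summable_comparison_test'[OF summable_add[OF summable_geometric_norm(1)[OF p, of ?C]
              summable_geometric_norm(2)[OF p, of ?E]]]) (auto intro: norm_triangle_ineq)
    qed
  qed
  have fsr: "fser (rat_seq b c p) x = b + c * f x" for x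
    using fser_Suc[of "rat_seq b c p" x "c * f x"] sums_mult[OF sums_geometric_cis(1)[OF p], of c x]
    by (simp add: rat_seq_def f_def mult.assoc)
  have fsh: "fser h x = f x" for x
    using fser_Suc[of h x "f x"] sums_geometric_cis(1)[OF p, of x] by (simp add: h_def f_def)
  have fsc: "fser (rat_cub b c p) x = (b * cnj b * b + 2 * b * n * m + c * n * m\<^sup>2 * cnj p)
      + ((2 * b * cnj b * c + 2 * b * n * m * p + c * n * m\<^sup>2) * f x + (cnj b * c\<^sup>2 + c * n * m * p) * (f x)\<^sup>2)" for x
  proof -
    have "(\<lambda>j. (2 * b * cnj b * c + 2 * b * n * m * p + c * n * m\<^sup>2) * (p ^ j * cis (real (Suc j) * x))
          + (cnj b * c\<^sup>2 + c * n * m * p) * (of_nat j * p ^ (j - 1) * cis (real (Suc j) * x)))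
        sums ((2 * b * cnj b * c + 2 * b * n * m * p + c * n * m\<^sup>2) * f x + (cnj b * c\<^sup>2 + c * n * m * p) * (f x)\<^sup>2)"
      unfolding f_def by (intro sums_add sums_mult sums_geometric_cis p)
    then have "(\<lambda>j. rat_cub b c p (Suc j) * cis (real (Suc j) * x))
        sums ((2 * b * cnj b * c + 2 * b * n * m * p + c * n * m\<^sup>2) * f x + (cnj b * c\<^sup>2 + c * n * m * p) * (f x)\<^sup>2)"
      by (rule sums_cong[THEN iffD1, rotated])
         (simp add: rat_cub_def Let_def m_def n_def algebra_simps)
    from fser_Suc[of "rat_cub b c p" x, OF this] show ?thesis
      by (simp add: rat_cub_def Let_def m_def n_def)
  qed
  have m1: "m * (1 - p * cnj p) = 1"
  proof -
    have "(cmod p)\<^sup>2 < 1" using p by (simp add: power_less_one_iff abs_square_less_1)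
    then have "1 - complex_of_real ((cmod p)\<^sup>2) \<noteq> 0" by (metis less_irrefl of_real_1 of_real_eq_iff right_minus_eq)
    then show ?thesis unfolding m_def complex_norm_square[symmetric] by simp
  qed
  have ff: "f x * cnj (f x) = m * (1 + p * f x + cnj p * cnj (f x))" for x
  proof -
    have z: "cis x * cnj (cis x) = 1" by (simp add: cis_cnj cis_mult)
    have nz: "1 - p * cis x \<noteq> 0" 
    proof
      assume "1 - p * cis x = 0"
      then have "cmod (p * cis x) = 1" by (metis norm_one right_minus_eq)
      then show False using p by (simp add: norm_mult)
    qed
    then have nz': "1 - cnj p * cnj (cis x) \<noteq> 0"
      by (metis complex_cnj_cancel_iff complex_cnj_diff complex_cnj_mult complex_cnj_one complex_cnj_zero)
    have e1: "1 + p * f x = 1 / (1 - p * cis x)" using nz by (simp add: f_def field_simps)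
    have e2: "cnj p * cnj (f x) = cnj p * cnj (cis x) / (1 - cnj p * cnj (cis x))" by (simp add: f_def)
    have "f x * cnj (f x) = 1 / ((1 - p * cis x) * (1 - cnj p * cnj (cis x)))"
      using z by (simp add: f_def)
    also have "\<dots> = m * (1 - p * cnj p) / ((1 - p * cis x) * (1 - cnj p * cnj (cis x)))" by (simp add: m1)
    also have "m * (1 - p * cnj p) = m * (1 - p * cnj p * (cis x * cnj (cis x)))" by (simp add: z)
    also have "\<dots> / ((1 - p * cis x) * (1 - cnj p * cnj (cis x)))
        = m * (1 / (1 - p * cis x) + cnj p * cnj (cis x) / (1 - cnj p * cnj (cis x)))"
      using nz nz' by (simp add: field_simps)
    finally show ?thesis by (simp add: e1 e2)
  qed
  have cubic: "fser (rat_seq b c p) x * cnj (fser (rat_seq b c p) x) * fser (rat_seq b c p) x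
      = fser (rat_cub b c p) x + D * cnj (fser h x)" for x
  proof -
    define u where "u = f x"
    define v where "v = cnj (f x)"
    have uv: "u * v = m * (1 + p * u + cnj p * v)" using ff[of x] by (simp add: u_def v_def)
    have uuv: "u * u * v = m * (u + p * u * u + cnj p * m * (1 + p * u + cnj p * v))"
    proof -
      have "u * u * v = u * (u * v)" by (simp only: mult.assoc)
      also have "\<dots> = u * (m * (1 + p * u + cnj p * v))" by (simp only: uv)
      also have "\<dots> = m * (u + p * u * u + cnj p * (u * v))" by (simp add: algebra_simps)
      also have "\<dots> = m * (u + p * u * u + cnj p * (m * (1 + p * u + cnj p * v)))" by (simp only: uv)
      finally show ?thesis by (simp only: mult.assoc)
    qed
    have mm: "1 + m * p * cnj p = m" using m1 by (simp add: algebra_simps)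
    have "(b + c * u) * (cnj b + cnj c * v) * (b + c * u)
        = cnj b * (b * b + 2 * b * c * u + c * c * (u * u))
          + cnj c * b * b * v + 2 * b * n * (u * v) + c * n * (u * u * v)"
      by (simp add: n_def algebra_simps)
    also have "\<dots> = (b * cnj b * b + 2 * b * n * m + c * n * m\<^sup>2 * cnj p)
      + ((2 * b * cnj b * c + 2 * b * n * m * p + c * n * m * (1 + m * p * cnj p)) * u + (cnj b * c\<^sup>2 + c * n * m * p) * u\<^sup>2) + D * v"
      unfolding uv uuv D_def by (simp add: algebra_simps power2_eq_square)
    finally show ?thesis unfolding mm fsr fsc fsh u_def v_def by (simp add: power2_eq_square)
  qed
  have "fourier_coeff (\<lambda>x. fser (rat_cub b c p) x - (- D) * cnj (fser h x)) (int k)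
     = fourier_coeff (fser (rat_cub b c p)) (int k) - fourier_coeff (\<lambda>x. (- D) * cnj (fser h x)) (int k)"
  proof (rule fourier_coeff_diff)
    show "integrable circ (fser (rat_cub b c p))" by (rule sq_int_integrable[OF fser_sq_int[OF sm(3)]])
    have "integrable circ (\<lambda>x. cnj (fser h x))" using sq_int_integrable[OF fser_sq_int[OF sm(2)]] by simp
    then show "integrable circ (\<lambda>x. (- D) * cnj (fser h x))" by (rule integrable_mult_right)
  qed
  also have "fourier_coeff (\<lambda>x. (- D) * cnj (fser h x)) (int k) = (- D) * fourier_coeff (\<lambda>x. cnj (fser h x)) (int k)"
    unfolding fourier_coeff_circ mult.assoc integral_mult_right_zero by simp
  also have "fourier_coeff (\<lambda>x. cnj (fser h x)) (int k) = 0"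
    unfolding fourier_coeff_cnj fourier_coeff_fser[OF sm(2)] by (cases k) (auto simp: h_def)
  finally have "fourier_coeff (\<lambda>x. fser (rat_seq b c p) x * cnj (fser (rat_seq b c p) x) * fser (rat_seq b c p) x) (int k) = rat_cub b c p k"
    unfolding cubic by (simp add: fourier_coeff_fser[OF sm(3)])
  then show ?thesis using cub_tendsto[OF sm(1), of k] by simp
qed

section \<open>An explicit solution of the cubic Szego equation\<close>

text \<open>The solution of Gerard and Grellier with datum \<open>e^(ix) + d\<close>.  It depends on time through the angle
\<open>sz_om d * t\<close>, up to phases that are split off: \<open>sz_B\<close> and \<open>sz_P\<close> are the coefficients \<open>sz_b\<close> and \<open>sz_p\<close> without
their phases.\<close>

definition sz_r :: "real \<Rightarrow> real" where "sz_r d = 1 / sqrt (4 + d\<^sup>2)"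
definition sz_om :: "real \<Rightarrow> real" where "sz_om d = d * sz_r d * (4 + d\<^sup>2) / 2"

definition sz_B :: "real \<Rightarrow> real \<Rightarrow> complex" where
  "sz_B d t = of_real d * of_real (cos (sz_om d * t))
     - \<i> * (2 + of_real d * of_real d) * of_real (sz_r d) * of_real (sin (sz_om d * t))"
definition sz_P :: "real \<Rightarrow> real \<Rightarrow> complex" where
  "sz_P d t = - 2 * \<i> * of_real (sz_r d) * of_real (sin (sz_om d * t))"

definition sz_b :: "real \<Rightarrow> real \<Rightarrow> complex" where
  "sz_b d t = sz_B d t * cis (- (1 + d * d / 2) * t)"
definition sz_p :: "real \<Rightarrow> real \<Rightarrow> complex" where
  "sz_p d t = sz_P d t * cis (- (d * d / 2) * t)"
definition sz_c :: "real \<Rightarrow> real \<Rightarrow> complex" where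
  "sz_c d t = (1 + sz_B d t * sz_P d t) * cis (- (1 + d * d) * t)"
text \<open>The quantity \<open>1 - |p|\<^sup>2\<close>, essentially the distance of the pole from the circle.\<close>

definition sz_y :: "real \<Rightarrow> real \<Rightarrow> real" where
  "sz_y d t = 1 - 4 * (sz_r d)\<^sup>2 * (sin (sz_om d * t))\<^sup>2"

lemma sz_r_sq: "(sz_r d)\<^sup>2 * (4 + d\<^sup>2) = 1"
proof -
  have "4 + d\<^sup>2 > 0" by (simp add: add_pos_nonneg)
  then show ?thesis by (simp add: sz_r_def power_divide)
qed

lemma sz_y_lower: "sz_y d t \<ge> d\<^sup>2 / (4 + d\<^sup>2)" and sz_y_pos: "d > 0 \<Longrightarrow> sz_y d t > 0" and sz_y_upper: "sz_y d t \<le> 1"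
proof -
  have p: "4 + d\<^sup>2 > 0" by (simp add: add_pos_nonneg)
  then have r: "(sz_r d)\<^sup>2 = 1 / (4 + d\<^sup>2)" using sz_r_sq[of d] by (simp add: field_simps)
  have "4 * (sz_r d)\<^sup>2 * (sin (sz_om d * t))\<^sup>2 \<le> 4 * (sz_r d)\<^sup>2 * 1"
    by (intro mult_left_mono) (auto simp: abs_square_le_1)
  moreover have "1 - 4 * (sz_r d)\<^sup>2 = d\<^sup>2 / (4 + d\<^sup>2)" using p by (simp add: r field_simps)
  ultimately show l: "sz_y d t \<ge> d\<^sup>2 / (4 + d\<^sup>2)" by (simp add: sz_y_def)
  show "sz_y d t > 0" if "d > 0"
  proof -
    have "d\<^sup>2 / (4 + d\<^sup>2) > 0" using that p by simp
    then show ?thesis using l by linarith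
  qed
  show "sz_y d t \<le> 1" by (simp add: sz_y_def)
qed

lemma sz_identities:
  fixes d t :: real
  defines "D \<equiv> complex_of_real d" and "R \<equiv> complex_of_real (sz_r d)" and "Y \<equiv> complex_of_real (sz_y d t)"
    and "S \<equiv> complex_of_real (sin (sz_om d * t))" and "C \<equiv> complex_of_real (cos (sz_om d * t))"
  shows "sz_P d t * cnj (sz_P d t) = 1 - Y" (is ?A1)
    and "sz_B d t * cnj (sz_B d t) = 1 + D * D - Y" (is ?A2)
    and "(1 + sz_B d t * sz_P d t) * cnj (1 + sz_B d t * sz_P d t) = Y * Y" (is ?A3)
    and "D * C + D * D / 2 * sz_P d t = cnj (sz_B d t) * (1 + sz_B d t * sz_P d t) + Y * sz_P d t" (is ?A4)
    and "- \<i> * D * D * R * (4 + D * D) * S / 2 + D * (2 + D * D) / 2 * C + (1 + D * D / 2) * sz_B d t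
       = (1 + D * D + Y) * sz_B d t + (1 + sz_B d t * sz_P d t) * cnj (sz_P d t)" (is ?A5)
    and "\<i> * ((- D * D * R * (4 + D * D) * S / 2 - \<i> * D * (2 + D * D) / 2 * C) * sz_P d t + sz_B d t * (- \<i> * D * C))
          + (1 + D * D) * (1 + sz_B d t * sz_P d t) = 2 * (1 + D * D - Y) * (1 + sz_B d t * sz_P d t)
          + 2 * Y * sz_P d t * sz_B d t + (1 + sz_B d t * sz_P d t)" (is ?A6)
proof -
  have i: "\<i> * \<i> = - 1" by simp
  have r: "R * R * (4 + D * D) = 1"
  proof -
    have "R * R * (4 + D * D) = of_real ((sz_r d)\<^sup>2 * (4 + d\<^sup>2))" by (simp add: R_def D_def power2_eq_square)
    then show ?thesis by (simp add: sz_r_sq)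
  qed
  have s: "S * S + C * C = 1"
  proof -
    have "S * S + C * C = of_real ((sin (sz_om d * t))\<^sup>2 + (cos (sz_om d * t))\<^sup>2)"
      by (simp only: of_real_add of_real_mult power2_eq_square S_def C_def)
    then show ?thesis by simp
  qed
  have B: "sz_B d t = D * C - \<i> * (2 + D * D) * R * S" by (simp add: sz_B_def D_def C_def R_def S_def)
  have Bc: "cnj (sz_B d t) = D * C + \<i> * (2 + D * D) * R * S" by (simp add: sz_B_def D_def C_def R_def S_def)
  have P: "sz_P d t = - 2 * \<i> * R * S" by (simp add: sz_P_def R_def S_def)
  have Pc: "cnj (sz_P d t) = 2 * \<i> * R * S" by (simp add: sz_P_def R_def S_def)
  have y: "Y = 1 - 4 * R * R * S * S" by (simp add: Y_def R_def S_def sz_y_def power2_eq_square)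
  note A = szego_algebra[OF i r s, folded B Bc P Pc y]
  show ?A1 by (rule A(1))
  show ?A2 by (rule A(2))
  show ?A3
    using A(3) by simp
  show ?A4 by (rule A(4))
  show ?A5 by (rule A(5))
  show ?A6 by (rule A(6))
qed

text \<open>The three relations reflect conservation of mass and momentum.  In particular \<open>|c| = 1 - |p|\<^sup>2\<close>: the residue
is as small as the pole is close to the circle.\<close>

lemma sz_norms:
  shows "(cmod (sz_p d t))\<^sup>2 = 1 - sz_y d t" (is ?A1) and "(cmod (sz_b d t))\<^sup>2 = 1 + d\<^sup>2 - sz_y d t" (is ?A2)
    and "cmod (sz_c d t) = sz_y d t" (is ?A3)
proof -
  have *: "(cmod (z * cis a))\<^sup>2 = x" if "z * cnj z = of_real x" for z a x
    using that by (simp add: norm_mult complex_norm_square[symmetric] of_real_eq_iff del: of_real_power)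
  show ?A1 unfolding sz_p_def by (rule *) (simp add: sz_identities(1))
  show ?A2 unfolding sz_b_def
    by (rule *) (simp add: sz_identities(2) power2_eq_square)
  have "(cmod (sz_c d t))\<^sup>2 = sz_y d t * sz_y d t" unfolding sz_c_def by (rule *) (simp only: sz_identities(3) of_real_mult)
  moreover have "sz_y d t \<ge> 0"
    using order_trans[OF _ sz_y_lower[of d t], of 0] by simp
  ultimately show ?A3
    by (metis norm_ge_zero power2_eq_iff_nonneg power2_eq_square)
qed

lemma sz_B_P_deriv:
  fixes d t :: real
  defines "D \<equiv> complex_of_real d" and "R \<equiv> complex_of_real (sz_r d)" and "Y \<equiv> complex_of_real (sz_y d t)"
    and "S \<equiv> complex_of_real (sin (sz_om d * t))" and "C \<equiv> complex_of_real (cos (sz_om d * t))"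
  shows sz_B_deriv: "(sz_B d has_vector_derivative
    (- D * D * R * (4 + D * D) * S / 2 - \<i> * D * (2 + D * D) / 2 * C)) (at t)" (is ?A1)
    and sz_P_deriv: "(sz_P d has_vector_derivative (- \<i> * D * C)) (at t)" (is ?A2)
proof -
  have c: "((\<lambda>t. complex_of_real (cos (sz_om d * t))) has_vector_derivative of_real (- sin (sz_om d * t) * sz_om d)) (at t)"
    by (rule has_vector_derivative_of_real) (auto intro!: derivative_eq_intros)
  have s: "((\<lambda>t. complex_of_real (sin (sz_om d * t))) has_vector_derivative of_real (cos (sz_om d * t) * sz_om d)) (at t)"
    by (rule has_vector_derivative_of_real) (auto intro!: derivative_eq_intros)
  have r: "sz_r d * sz_om d = d / 2"
  proof -
    have "sz_r d * sz_om d = d / 2 * ((sz_r d)\<^sup>2 * (4 + d\<^sup>2))" by (simp add: sz_om_def power2_eq_square)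
    then show ?thesis by (simp add: sz_r_sq)
  qed
  have "(sz_B d has_vector_derivative
     (D * of_real (- sin (sz_om d * t) * sz_om d) - (\<i> * (2 + D * D) * R) * of_real (cos (sz_om d * t) * sz_om d))) (at t)"
    unfolding sz_B_def[abs_def] D_def R_def
    by (intro has_vector_derivative_diff has_vector_derivative_mult_right c s)
  then show ?A1
  proof (rule has_vector_derivative_eq_rhs)
    have "(\<i> * (2 + D * D) * R) * of_real (cos (sz_om d * t) * sz_om d)
      = \<i> * (2 + D * D) * of_real (sz_r d * sz_om d) * C" by (simp add: mult_ac R_def C_def)
    also have "\<dots> = \<i> * D * (2 + D * D) / 2 * C" unfolding r by (simp add: D_def)
    finally have cc: "(\<i> * (2 + D * D) * R) * of_real (cos (sz_om d * t) * sz_om d) = \<i> * D * (2 + D * D) / 2 * C" .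
    have "D * of_real (- sin (sz_om d * t) * sz_om d) = - (D * S * of_real (sz_om d))" by (simp add: S_def)
    also have "of_real (sz_om d) = D * R * (4 + D * D) / 2" by (simp add: sz_om_def D_def R_def power2_eq_square)
    finally show "D * of_real (- sin (sz_om d * t) * sz_om d) - (\<i> * (2 + D * D) * R) * of_real (cos (sz_om d * t) * sz_om d)
      = - D * D * R * (4 + D * D) * S / 2 - \<i> * D * (2 + D * D) / 2 * C"
      unfolding cc by (simp add: field_simps)
  qed
  have "(sz_P d has_vector_derivative ((- 2 * \<i> * R) * of_real (cos (sz_om d * t) * sz_om d))) (at t)"
    unfolding sz_P_def[abs_def] R_def by (intro has_vector_derivative_mult_right s)
  then show ?A2
  proof (rule has_vector_derivative_eq_rhs)
    have "(- 2 * \<i> * R) * of_real (cos (sz_om d * t) * sz_om d) = - 2 * \<i> * of_real (sz_r d * sz_om d) * C"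
      by (simp add: R_def C_def)
    then show "(- 2 * \<i> * R) * of_real (cos (sz_om d * t) * sz_om d) = - \<i> * D * C"
      unfolding r by (simp add: D_def)
  qed
qed

lemma sz_derivs:
  fixes d t :: real
  defines "D \<equiv> complex_of_real d" and "R \<equiv> complex_of_real (sz_r d)" and "Y \<equiv> complex_of_real (sz_y d t)"
    and "S \<equiv> complex_of_real (sin (sz_om d * t))" and "C \<equiv> complex_of_real (cos (sz_om d * t))"
  shows "(sz_p d has_vector_derivative - \<i> * (cnj (sz_b d t) * sz_c d t + Y * sz_p d t)) (at t)" (is ?A1)
    and "(sz_b d has_vector_derivative - \<i> * ((1 + D * D + Y) * sz_b d t + sz_c d t * cnj (sz_p d t))) (at t)" (is ?A2)
    and "(sz_c d has_vector_derivative - \<i> * (2 * (1 + D * D - Y) * sz_c d t + 2 * Y * sz_p d t * sz_b d t + sz_c d t)) (at t)" (is ?A3)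
proof -
  let ?B = "sz_B d t" and ?P = "sz_P d t" 
  let ?dB = "- D * D * R * (4 + D * D) * S / 2 - \<i> * D * (2 + D * D) / 2 * C"
  let ?e = "cis (- (d * d / 2) * t)" and ?g = "cis (- (1 + d * d / 2) * t)" and ?h = "cis (- (1 + d * d) * t)"
  have gh: "cnj ?g * ?h = ?e" "?h * cnj ?e = ?g" "?e * ?g = ?h"
    by (simp_all add: cis_cnj cis_mult algebra_simps)
  have ii: "\<i> * (\<i> * z) = - z" for z by (simp flip: mult.assoc)
  have "(sz_p d has_vector_derivative (?P * (\<i> * of_real (- (d * d / 2)) * ?e) + (- \<i> * D * C) * ?e)) (at t)"
    unfolding sz_p_def[abs_def]
    by (intro has_vector_derivative_mult sz_P_deriv[of d t, folded D_def C_def] has_vector_derivative_cis_mult)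
  then show ?A1
  proof (rule has_vector_derivative_eq_rhs)
    have "?P * (\<i> * of_real (- (d * d / 2)) * ?e) + (- \<i> * D * C) * ?e = - \<i> * ((D * C + D * D / 2 * ?P) * ?e)"
      by (simp add: algebra_simps D_def)
    also have "\<dots> = - \<i> * ((cnj ?B * (1 + ?B * ?P) + Y * ?P) * ?e)"
      using sz_identities(4)[of d t, folded D_def R_def S_def C_def Y_def] by simp
    also have "(cnj ?B * (1 + ?B * ?P) + Y * ?P) * ?e = cnj (sz_b d t) * sz_c d t + Y * sz_p d t"
      unfolding sz_b_def sz_c_def sz_p_def complex_cnj_mult by (simp only: gh(1)[symmetric]) (simp add: algebra_simps)
    finally show "?P * (\<i> * of_real (- (d * d / 2)) * ?e) + (- \<i> * D * C) * ?e
       = - \<i> * (cnj (sz_b d t) * sz_c d t + Y * sz_p d t)" .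
  qed
  have "(sz_b d has_vector_derivative (?B * (\<i> * of_real (- (1 + d * d / 2)) * ?g) + ?dB * ?g)) (at t)"
    unfolding sz_b_def[abs_def]
    by (intro has_vector_derivative_mult sz_B_deriv[of d t, folded D_def R_def S_def C_def] has_vector_derivative_cis_mult)
  then show ?A2
  proof (rule has_vector_derivative_eq_rhs)
    have "?B * (\<i> * of_real (- (1 + d * d / 2)) * ?g) + ?dB * ?g
       = - \<i> * ((- \<i> * D * D * R * (4 + D * D) * S / 2 + D * (2 + D * D) / 2 * C + (1 + D * D / 2) * ?B) * ?g)"
      by (simp add: field_simps ii D_def)
    also have "\<dots> = - \<i> * (((1 + D * D + Y) * ?B + (1 + ?B * ?P) * cnj ?P) * ?g)"
      unfolding sz_identities(5)[of d t, folded D_def R_def S_def C_def Y_def] ..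
    also have "((1 + D * D + Y) * ?B + (1 + ?B * ?P) * cnj ?P) * ?g
        = (1 + D * D + Y) * sz_b d t + sz_c d t * cnj (sz_p d t)"
      unfolding sz_b_def sz_c_def sz_p_def complex_cnj_mult distrib_right gh(2)[symmetric] by (simp only: mult_ac)
    finally show "?B * (\<i> * of_real (- (1 + d * d / 2)) * ?g) + ?dB * ?g
       = - \<i> * ((1 + D * D + Y) * sz_b d t + sz_c d t * cnj (sz_p d t))" .
  qed
  have "(sz_c d has_vector_derivative ((1 + ?B * ?P) * (\<i> * of_real (- (1 + d * d)) * ?h)
      + (0 + (?B * (- \<i> * D * C) + ?dB * ?P)) * ?h)) (at t)"
    unfolding sz_c_def[abs_def]
    by (intro has_vector_derivative_mult has_vector_derivative_add has_vector_derivative_const sz_B_deriv[of d t, folded D_def R_def S_def C_def] sz_P_deriv[of d t, folded D_def C_def] has_vector_derivative_cis_mult)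
  then show ?A3
  proof (rule has_vector_derivative_eq_rhs)
    have "(1 + ?B * ?P) * (\<i> * of_real (- (1 + d * d)) * ?h) + (0 + (?B * (- \<i> * D * C) + X * ?P)) * ?h
      = - \<i> * ((\<i> * (X * ?P + ?B * (- \<i> * D * C)) + (1 + D * D) * (1 + ?B * ?P)) * ?h)" for X
      by (simp add: algebra_simps ii D_def)
    from this[of ?dB] have "(1 + ?B * ?P) * (\<i> * of_real (- (1 + d * d)) * ?h) + (0 + (?B * (- \<i> * D * C) + ?dB * ?P)) * ?h
      = - \<i> * ((\<i> * (?dB * ?P + ?B * (- \<i> * D * C)) + (1 + D * D) * (1 + ?B * ?P)) * ?h)" by simp
    also have "\<dots> = - \<i> * ((2 * (1 + D * D - Y) * (1 + ?B * ?P) + 2 * Y * ?P * ?B + (1 + ?B * ?P)) * ?h)"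
      unfolding sz_identities(6)[of d t, folded D_def R_def S_def C_def Y_def] ..
    also have "(2 * (1 + D * D - Y) * (1 + ?B * ?P) + 2 * Y * ?P * ?B + (1 + ?B * ?P)) * ?h
       = 2 * (1 + D * D - Y) * sz_c d t + 2 * Y * sz_p d t * sz_b d t + sz_c d t"
    proof -
      have "2 * Y * sz_p d t * sz_b d t = 2 * Y * ?P * ?B * (?e * ?g)"
        unfolding sz_p_def sz_b_def by (simp only: mult_ac)
      then show ?thesis unfolding gh(3) sz_c_def by (simp only: distrib_right mult.assoc)
    qed
    finally show "(1 + ?B * ?P) * (\<i> * of_real (- (1 + d * d)) * ?h) + (0 + (?B * (- \<i> * D * C) + ?dB * ?P)) * ?h
      = - \<i> * (2 * (1 + D * D - Y) * sz_c d t + 2 * Y * sz_p d t * sz_b d t + sz_c d t)" .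
  qed
qed

section \<open>Comparison with the explicit solution\<close>

definition sz_w :: "real \<Rightarrow> real \<Rightarrow> nat \<Rightarrow> complex" where
  "sz_w d t = rat_seq (sz_b d t) (sz_c d t) (sz_p d t)"

definition sz_G :: "real \<Rightarrow> real \<Rightarrow> nat \<Rightarrow> complex" where
  "sz_G d t = rat_cub (sz_b d t) (sz_c d t) (sz_p d t)"

lemma sz_p_less_1:
  assumes "d > 0" shows "cmod (sz_p d t) < 1"
proof -
  have "(cmod (sz_p d t))\<^sup>2 < 1\<^sup>2" using sz_y_pos[OF assms, of t] by (simp add: sz_norms)
  then show ?thesis by (rule power2_less_imp_less) simp
qed

lemma sz_w_cub: "d > 0 \<Longrightarrow> (\<lambda>N. cub N (sz_w d t) k) \<longlonglongrightarrow> sz_G d t k"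
  unfolding sz_w_def sz_G_def by (intro cub_rat_seq sz_p_less_1)

lemma has_vector_derivative_power_complex:
  fixes f :: "real \<Rightarrow> complex"
  assumes "(f has_vector_derivative f') (at t)"
  shows "((\<lambda>\<tau>. f \<tau> ^ j) has_vector_derivative of_nat j * f t ^ (j - 1) * f') (at t)"
proof -
  have "((\<lambda>z. z ^ j) has_field_derivative of_nat j * f t ^ (j - 1)) (at (f t))"
    by (auto intro!: derivative_eq_intros)
  from field_vector_diff_chain_at[OF assms this] show ?thesis by (simp add: o_def mult_ac)
qed

lemma sz_w_deriv:
  assumes d: "d > 0"
  shows "((\<lambda>\<tau>. sz_w d \<tau> k) has_vector_derivative - \<i> * sz_G d t k) (at t)"
proof -
  define b c p where "b = sz_b d t" and "c = sz_c d t" and "p = sz_p d t"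
  define y where "y = complex_of_real (sz_y d t)"
  have y0: "y \<noteq> 0" using sz_y_pos[OF d, of t] by (simp add: y_def)
  have n: "c * cnj c = y * y"
    unfolding c_def complex_norm_square[symmetric] by (simp add: sz_norms y_def power2_eq_square)
  have m: "complex_of_real (1 / (1 - (cmod p)\<^sup>2)) = 1 / y" by (simp add: p_def sz_norms y_def)
  have b2: "b * cnj b = 1 + of_real d * of_real d - y"
    unfolding b_def complex_norm_square[symmetric] of_real_power[symmetric] sz_norms by (simp add: y_def power2_eq_square)
  note der = sz_derivs[where d = d and t = t, folded b_def c_def p_def y_def]
  show ?thesis
  proof (cases k)
    case 0
    have "rat_cub b c p 0 = (b * cnj b) * b + 2 * b * (c * cnj c) / y + c * (c * cnj c) * (1 / y)\<^sup>2 * cnj p"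
      unfolding rat_cub_def Let_def m by simp
    also have "\<dots> = (1 + of_real d * of_real d + y) * b + c * cnj p"
      unfolding n b2 using y0 by (simp add: field_simps power2_eq_square)
    finally show ?thesis using der(2) by (simp add: 0 sz_w_def sz_G_def rat_seq_def b_def c_def p_def)
  next
    case (Suc j)
    have "((\<lambda>\<tau>. sz_c d \<tau> * sz_p d \<tau> ^ j) has_vector_derivative
       c * (of_nat j * p ^ (j - 1) * (- \<i> * (cnj b * c + y * p)))
        + (- \<i> * (2 * (1 + of_real d * of_real d - y) * c + 2 * y * p * b + c)) * p ^ j) (at t)"
      unfolding c_def p_def
      by (intro has_vector_derivative_mult has_vector_derivative_power_complex der[unfolded c_def p_def])
    moreover have "rat_cub b c p (Suc j) = (2 * (b * cnj b) * c + 2 * b * (c * cnj c) / y * p + c * (c * cnj c) * (1 / y)\<^sup>2) * p ^ j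
        + (cnj b * c\<^sup>2 + c * (c * cnj c) / y * p) * (of_nat j * p ^ (j - 1))"
      unfolding rat_cub_def Let_def m by simp
    then have rc: "rat_cub b c p (Suc j) = (2 * (1 + of_real d * of_real d - y) * c + 2 * y * p * b + c) * p ^ j
        + c * (cnj b * c + y * p) * (of_nat j * p ^ (j - 1))"
      unfolding n b2 using y0 by (simp add: field_simps power2_eq_square)
    have "c * (of_nat j * p ^ (j - 1) * (- \<i> * (cnj b * c + y * p)))
        + (- \<i> * (2 * (1 + of_real d * of_real d - y) * c + 2 * y * p * b + c)) * p ^ j = - \<i> * rat_cub b c p (Suc j)"
      unfolding rc by (simp add: algebra_simps)
    ultimately show ?thesis
      by (simp add: Suc sz_w_def sz_G_def rat_seq_def b_def c_def p_def)
  qed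
qed

lemma sz_w_Suc_norm: "cmod (sz_w d t (Suc j)) = sz_y d t * cmod (sz_p d t) ^ j"
  by (simp add: sz_w_def rat_seq_def norm_mult norm_power sz_norms)

lemma sz_w_0_norm: "d \<le> 1 \<Longrightarrow> d > 0 \<Longrightarrow> cmod (sz_w d t 0) \<le> 2"
proof -
  assume d: "d \<le> 1" "d > 0"
  then have "d\<^sup>2 \<le> 1" by (simp add: power_le_one)
  then have "(cmod (sz_b d t))\<^sup>2 \<le> 2\<^sup>2" using sz_y_pos[OF d(2), of t] by (simp add: sz_norms)
  then have "cmod (sz_b d t) \<le> 2" by (rule power2_le_imp_le) simp
  then show ?thesis by (simp add: sz_w_def rat_seq_def)
qed

text \<open>The geometric series of ratio \<open>|p|\<close> has the factor \<open>|c| = (1 - |p|) (1 + |p|)\<close>, so it sums to \<open>1 + |p| \<le> 2\<close> however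
close the pole is.\<close>

lemma sz_w_l1:
  assumes d: "0 < d" "d \<le> 1"
  shows "ell1 (sz_w d t)" "l1_norm (sz_w d t) \<le> 4"
proof -
  define q where "q = cmod (sz_p d t)"
  have q: "0 \<le> q" "q < 1" using sz_p_less_1[OF d(1)] by (auto simp: q_def)
  have y: "sz_y d t = (1 - q) * (1 + q)"
    using sz_norms(1)[of d t] by (simp add: q_def power2_eq_square algebra_simps)
  have "(\<lambda>j. sz_y d t * q ^ j) sums (sz_y d t * (1 / (1 - q)))"
    using q by (intro sums_mult geometric_sums) simp
  then have "(\<lambda>j. cmod (sz_w d t (Suc j))) sums (1 + q)"
    using q by (simp add: sz_w_Suc_norm q_def[symmetric] y)
  from sums_Suc[OF this] have s: "(\<lambda>k. cmod (sz_w d t k)) sums (1 + q + cmod (sz_w d t 0))" .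
  show "ell1 (sz_w d t)" using s by (rule sums_summable)
  show "l1_norm (sz_w d t) \<le> 4"
    using sums_unique[OF s] sz_w_0_norm[OF d(2,1), of t] q by simp
qed

text \<open>Multiplication by \<open>1 - q\<close> is a discrete derivative; three of them reduce the square to a bounded
quantity.\<close>

lemma sum_square_geometric:
  fixes q :: real
  assumes q: "0 \<le> q" "q < 1"
  shows "(\<Sum>j<n. (real (Suc j))\<^sup>2 * q ^ j) \<le> 2 / (1 - q) ^ 3"
proof -
  have s0: "(1 - q) * (\<Sum>j<n. q ^ j) = 1 - q ^ n" for n
  proof (induction n)
    case (Suc n)
    show ?case unfolding sum.lessThan_Suc distrib_left[of "1 - q"] Suc.IH
      by (simp add: algebra_simps power2_eq_square)
  qed simp
  have s1: "(1 - q) * (\<Sum>j<n. real (Suc j) * q ^ j) = (\<Sum>j<n. q ^ j) - real n * q ^ n" for n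
  proof (induction n)
    case (Suc n)
    show ?case unfolding sum.lessThan_Suc distrib_left[of "1 - q"] Suc.IH
      by (simp add: algebra_simps power2_eq_square)
  qed simp
  have s2: "(1 - q) * (\<Sum>j<n. (real (Suc j))\<^sup>2 * q ^ j)
      = 2 * (\<Sum>j<n. real (Suc j) * q ^ j) - (\<Sum>j<n. q ^ j) - (real n)\<^sup>2 * q ^ n" for n
  proof (induction n)
    case (Suc n)
    show ?case unfolding sum.lessThan_Suc distrib_left[of "1 - q"] Suc.IH
      by (simp add: algebra_simps power2_eq_square)
  qed simp
  have "(1 - q) ^ 3 * (\<Sum>j<n. (real (Suc j))\<^sup>2 * q ^ j)
      = (1 - q)\<^sup>2 * ((1 - q) * (\<Sum>j<n. (real (Suc j))\<^sup>2 * q ^ j))"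
    by (simp add: eval_nat_numeral mult.assoc)
  also have "\<dots> \<le> (1 - q)\<^sup>2 * (2 * (\<Sum>j<n. real (Suc j) * q ^ j))"
  proof (rule mult_left_mono)
    have "0 \<le> (\<Sum>j<n. q ^ j)" "0 \<le> (real n)\<^sup>2 * q ^ n" using q by (auto intro: sum_nonneg)
    then show "(1 - q) * (\<Sum>j<n. (real (Suc j))\<^sup>2 * q ^ j) \<le> 2 * (\<Sum>j<n. real (Suc j) * q ^ j)"
      unfolding s2 by linarith
  qed simp
  also have "\<dots> = 2 * (1 - q) * ((1 - q) * (\<Sum>j<n. real (Suc j) * q ^ j))"
    by (simp add: power2_eq_square)
  also have "\<dots> \<le> 2 * (1 - q) * (\<Sum>j<n. q ^ j)"
    unfolding s1 using q by (intro mult_left_mono) auto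
  also have "\<dots> = 2 * ((1 - q) * (\<Sum>j<n. q ^ j))" by simp
  also have "\<dots> \<le> 2 * 1" unfolding s0 using q by (intro mult_left_mono) auto
  finally show ?thesis using q by (simp add: field_simps)
qed

text \<open>The second derivative in \<open>x\<close> is measured in \<open>l\<^sup>1\<close>.  It grows like a power of \<open>1/d\<close> only, which is
negligible against the factor \<open>\<epsilon> powr (\<alpha> - 2)\<close>.\<close>

lemma sz_w_dispersion:
  assumes d: "0 < d" "d \<le> 1"
  shows "(\<Sum>k\<le>n. (real k)\<^sup>2 * cmod (sz_w d t k)) \<le> 400 / d ^ 4"
proof -
  define q where "q = cmod (sz_p d t)"
  have q: "0 \<le> q" "q < 1" using sz_p_less_1[OF d(1)] by (auto simp: q_def)
  define y where "y = sz_y d t"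
  have y: "y = (1 - q) * (1 + q)"
    using sz_norms(1)[of d t] by (simp add: y_def q_def power2_eq_square algebra_simps)
  have d2: "d\<^sup>2 \<le> 1" using d by (simp add: power_le_one)
  have "d\<^sup>2 / 5 \<le> d\<^sup>2 / (4 + d\<^sup>2)" using d d2 by (intro divide_left_mono) (auto intro!: mult_pos_pos add_pos_nonneg)
  also have "\<dots> \<le> y" unfolding y_def by (rule sz_y_lower)
  also have "y \<le> (1 - q) * 2" unfolding y using q by (intro mult_left_mono) auto
  finally have ql: "d\<^sup>2 / 10 \<le> 1 - q" by simp
  have "(\<Sum>k\<le>n. (real k)\<^sup>2 * cmod (sz_w d t k)) \<le> (\<Sum>k<Suc n. (real k)\<^sup>2 * cmod (sz_w d t k))"
    by (simp add: lessThan_Suc_atMost)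
  also have "\<dots> = (\<Sum>j<n. (real (Suc j))\<^sup>2 * (y * q ^ j))"
    by (subst sum.lessThan_Suc_shift) (simp add: sz_w_Suc_norm q_def y_def)
  also have "\<dots> = y * (\<Sum>j<n. (real (Suc j))\<^sup>2 * q ^ j)"
    by (simp add: sum_distrib_left mult_ac)
  also have "\<dots> \<le> ((1 - q) * 2) * (2 / (1 - q) ^ 3)"
    using q sum_square_geometric[OF q, of n] \<open>y \<le> (1 - q) * 2\<close>
    by (intro mult_mono) (auto intro: sum_nonneg)
  also have "\<dots> = 4 / (1 - q)\<^sup>2"
  proof -
    have R: "r * 2 * (2 / r ^ 3) = 4 / r\<^sup>2" if "r > 0" for r :: real
      using that by (simp add: field_simps eval_nat_numeral)
    show ?thesis by (rule R) (use q in simp)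
  qed
  also have "\<dots> \<le> 4 / (d\<^sup>2 / 10)\<^sup>2"
    using ql d q by (intro divide_left_mono power_mono mult_pos_pos zero_less_power) auto
  also have "\<dots> = 400 / d ^ 4" by (simp add: power_divide flip: power_mult)
  finally show ?thesis .
qed

lemma l1_continuous_dominated:
  fixes w :: "real \<Rightarrow> nat \<Rightarrow> complex"
  assumes c: "\<And>k. continuous_on UNIV (\<lambda>t. w t k)" and b: "\<And>t k. cmod (w t k) \<le> B k" and B: "summable B"
  shows "((\<lambda>t. \<Sum>k. cmod (w t k - w t0 k)) \<longlongrightarrow> 0) (at t0)"
proof -
  have "uniform_limit UNIV (\<lambda>n t. \<Sum>k<n. cmod (w t k - w t0 k)) (\<lambda>t. \<Sum>k. cmod (w t k - w t0 k)) sequentially"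
  proof (rule Weierstrass_m_test)
    show "norm (cmod (w t k - w t0 k)) \<le> 2 * B k" for t k
      using norm_triangle_ineq4[of "w t k" "w t0 k"] b[of t k] b[of t0 k] by simp
    show "summable (\<lambda>k. 2 * B k)" using B by (rule summable_mult)
  qed
  then have "continuous_on UNIV (\<lambda>t. \<Sum>k. cmod (w t k - w t0 k))"
    by (rule uniform_limit_theorem[rotated]) (auto intro!: always_eventually continuous_intros c)
  then have "((\<lambda>t. \<Sum>k. cmod (w t k - w t0 k)) \<longlongrightarrow> l1_norm (\<lambda>k. w t0 k - w t0 k)) (at t0)"
    unfolding continuous_on_def by blast
  then show ?thesis by simp
qed

text \<open>The pole keeps a fixed distance from the circle for given \<open>d\<close>, which yields a geometric majorant that is
uniform in time.\<close>

lemma sz_w_l1_continuous: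
  assumes d: "0 < d" "d \<le> 1"
  shows "((\<lambda>t. \<Sum>k. cmod (sz_w d t k - sz_w d t0 k)) \<longlongrightarrow> 0) (at t0)"
proof -
  define q where "q = sqrt (1 - d\<^sup>2 / (4 + d\<^sup>2))"
  \<comment> \<open>The majorant: \<open>q\<close> is the largest modulus that the pole attains.\<close>
  define B where "B k = (case k of 0 \<Rightarrow> 2 | Suc j \<Rightarrow> q ^ j)" for k
  have pos: "d\<^sup>2 / (4 + d\<^sup>2) > 0" "d\<^sup>2 / (4 + d\<^sup>2) \<le> 1" using d by (auto simp: add_pos_nonneg field_simps)
  then have q: "0 \<le> q" "q < 1" by (auto simp: q_def)
  have pq: "cmod (sz_p d t) \<le> q" for t
    unfolding q_def by (rule real_le_rsqrt) (use sz_y_lower[of d t] in \<open>simp add: sz_norms\<close>)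
  show ?thesis
  proof (rule l1_continuous_dominated)
    show "continuous_on UNIV (\<lambda>t. sz_w d t k)" for k
      using has_vector_derivative_continuous[OF sz_w_deriv[OF d(1)]] by (simp add: continuous_at_imp_continuous_on)
    show "cmod (sz_w d t k) \<le> B k" for t k
    proof (cases k)
      case 0 then show ?thesis using sz_w_0_norm[OF d(2,1)] by (simp add: B_def)
    next
      case (Suc j)
      have "sz_y d t * cmod (sz_p d t) ^ j \<le> 1 * q ^ j"
        using sz_y_upper pq q by (intro mult_mono power_mono) auto
      then show ?thesis by (simp add: Suc sz_w_Suc_norm B_def)
    qed
    show "summable B"
      by (subst summable_Suc_iff[symmetric]) (use q in \<open>simp add: B_def summable_geometric\<close>)
  qed
qed

lemma l1_distance_continuous:
  fixes U w :: "real \<Rightarrow> nat \<Rightarrow> complex"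
  assumes U: "\<And>t. ell1 (U t)" and w: "\<And>t. ell1 (w t)"
    and cU: "\<And>t0. ((\<lambda>t. \<Sum>k. cmod (U t k - U t0 k)) \<longlongrightarrow> 0) (at t0)"
    and cw: "\<And>t0. ((\<lambda>t. \<Sum>k. cmod (w t k - w t0 k)) \<longlongrightarrow> 0) (at t0)"
  shows "continuous_on S (\<lambda>t. \<Sum>k. cmod (U t k - w t k))"
proof -
  define \<rho> where "\<rho> t = l1_norm (\<lambda>k. U t k - w t k)" for t
  have sd: "ell1 (\<lambda>k. x k - y k)" if "ell1 x" "ell1 y" for x y :: "nat \<Rightarrow> complex"
    by (rule summable_comparison_test'[OF summable_add[OF that]]) (auto intro: norm_triangle_ineq4)
  have b: "norm (\<rho> t - \<rho> t0) \<le> l1_norm (\<lambda>k. U t k - U t0 k) + l1_norm (\<lambda>k. w t k - w t0 k)" for t t0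
  proof -
    have "\<rho> t - \<rho> t0 = (\<Sum>k. cmod (U t k - w t k) - cmod (U t0 k - w t0 k))"
      unfolding \<rho>_def by (intro suminf_diff sd U w)
    also have "norm \<dots> \<le> (\<Sum>k. norm (cmod (U t k - U t0 k) + cmod (w t k - w t0 k)))"
    proof (rule norm_suminf_le)
      show "norm (cmod (U t k - w t k) - cmod (U t0 k - w t0 k)) \<le> norm (cmod (U t k - U t0 k) + cmod (w t k - w t0 k))" for k
      proof -
        have "norm (cmod (U t k - w t k) - cmod (U t0 k - w t0 k)) \<le> cmod ((U t k - w t k) - (U t0 k - w t0 k))"
          by (simp add: norm_triangle_ineq3)
        also have "(U t k - w t k) - (U t0 k - w t0 k) = (U t k - U t0 k) - (w t k - w t0 k)" by simp
        also have "cmod \<dots> \<le> cmod (U t k - U t0 k) + cmod (w t k - w t0 k)" by (rule norm_triangle_ineq4)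
        finally show ?thesis by simp
      qed
      show "summable (\<lambda>k. norm (cmod (U t k - U t0 k) + cmod (w t k - w t0 k)))"
        using summable_add[OF sd[OF U[of t] U[of t0]] sd[OF w[of t] w[of t0]]] by simp
    qed
    also have "\<dots> = l1_norm (\<lambda>k. U t k - U t0 k) + l1_norm (\<lambda>k. w t k - w t0 k)"
      by (simp add: suminf_add[OF sd[OF U[of t] U[of t0]] sd[OF w[of t] w[of t0]]])
    finally show ?thesis .
  qed
  have "isCont \<rho> t0" for t0
  proof -
    have "((\<lambda>t. \<rho> t - \<rho> t0) \<longlongrightarrow> 0) (at t0)"
    proof (rule Lim_null_comparison[OF always_eventually])
      show "\<forall>t. norm (\<rho> t - \<rho> t0) \<le> l1_norm (\<lambda>k. U t k - U t0 k) + l1_norm (\<lambda>k. w t k - w t0 k)" using b by simp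
      show "((\<lambda>t. l1_norm (\<lambda>k. U t k - U t0 k) + l1_norm (\<lambda>k. w t k - w t0 k)) \<longlongrightarrow> 0) (at t0)"
        using tendsto_add[OF cU cw] by simp
    qed
    then show ?thesis unfolding isCont_def by (rule LIM_zero_cancel)
  qed
  then show ?thesis unfolding \<rho>_def by (simp add: continuous_at_imp_continuous_on)
qed

lemma seq_solution_l1_continuous:
  assumes s: "s > 1/2" and sol: "seq_solution s \<nu> U F"
  shows "((\<lambda>t. \<Sum>k. cmod (U t k - U t0 k)) \<longlongrightarrow> 0) (at t0)"
proof (rule Lim_null_comparison[OF always_eventually])
  have hs: "hs_seq s (\<lambda>k. U t k - U t0 k)" for t by (intro hs_seq_diff seq_solution_hs[OF sol])
  show "\<forall>t. norm (l1_norm (\<lambda>k. U t k - U t0 k)) \<le> emb s * hs_norm s (\<lambda>k. U t k - U t0 k)"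
    using hs_seq_l1[OF s hs] by (simp add: abs_of_nonneg suminf_nonneg)
  have "((\<lambda>t. emb s * hs_norm s (\<lambda>k. U t k - U t0 k)) \<longlongrightarrow> emb s * 0) (at t0)"
    using sol by (intro tendsto_mult_left) (simp add: seq_solution_def)
  then show "((\<lambda>t. emb s * hs_norm s (\<lambda>k. U t k - U t0 k)) \<longlongrightarrow> 0) (at t0)" by simp
qed

lemma sz_w_initial: "sz_w d 0 k = (if k = 0 then of_real d else if k = 1 then 1 else 0)"
  by (cases k) (auto simp: sz_w_def rat_seq_def sz_b_def sz_B_def sz_c_def sz_P_def sz_p_def)

text \<open>The forcing \<open>\<eta>\<close> of \<open>l1_perturbation\<close> is \<open>\<nu>\<close> times the bound of \<open>sz_w_dispersion\<close>.\<close>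

lemma seq_solution_near_szego:
  assumes s: "s > 1/2" and sol: "seq_solution s \<nu> U F" and d: "0 < d" "d \<le> 1" and \<nu>: "\<nu> > 0"
    and init: "\<And>k. U 0 k = sz_w d 0 k"
    and small: "\<nu> * (400 / d ^ 4) * exp (62 * T) \<le> 1" and t: "0 \<le> t" "t \<le> T"
  shows "ell1 (\<lambda>k. U t k - sz_w d t k)"
    and "l1_norm (\<lambda>k. U t k - sz_w d t k) \<le> \<nu> * (400 / d ^ 4) * exp (62 * t)"
proof -
  have U1: "ell1 (U t)" for t by (rule hs_seq_l1(1)[OF s seq_solution_hs[OF sol]])
  show "ell1 (\<lambda>k. U t k - sz_w d t k)"
    by (rule summable_comparison_test'[OF summable_add[OF U1 sz_w_l1(1)[OF d]]]) (auto intro: norm_triangle_ineq4)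
  show "l1_norm (\<lambda>k. U t k - sz_w d t k) \<le> \<nu> * (400 / d ^ 4) * exp (62 * t)"
  proof (rule l1_perturbation[OF seq_solution_deriv[OF sol] sz_w_deriv[OF d(1)] seq_solution_cub[OF sol] sz_w_cub[OF d(1)]
        U1 sz_w_l1[OF d] _ init _ _ small t])
    show "continuous_on {0..T} (\<lambda>t. \<Sum>k. cmod (U t k - sz_w d t k))"
      by (intro l1_distance_continuous U1 sz_w_l1(1)[OF d] seq_solution_l1_continuous[OF s sol] sz_w_l1_continuous[OF d])
    show "(\<Sum>k\<le>n. cmod (of_real (\<nu> * (real k)\<^sup>2) * sz_w d t k)) \<le> \<nu> * (400 / d ^ 4)" for n t
    proof -
      have "(\<Sum>k\<le>n. cmod (of_real (\<nu> * (real k)\<^sup>2) * sz_w d t k)) = \<nu> * (\<Sum>k\<le>n. (real k)\<^sup>2 * cmod (sz_w d t k))"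
        using \<nu> by (simp add: norm_mult abs_mult norm_power sum_distrib_left mult_ac)
      also have "\<dots> \<le> \<nu> * (400 / d ^ 4)" using \<nu> by (intro mult_left_mono sz_w_dispersion d) auto
      finally show ?thesis .
    qed
    show "0 < \<nu> * (400 / d ^ 4)" using \<nu> d by simp
  qed
qed

section \<open>Growth of the Sobolev norm\<close>

text \<open>The first time at which the sine is 1 and the pole is closest to the circle.\<close>

definition sz_peak :: "real \<Rightarrow> real" where
  "sz_peak d = pi / (2 * sz_om d)"

lemma sz_om_ge: "d > 0 \<Longrightarrow> sz_om d \<ge> d"
proof -
  assume d: "d > 0"
  have p: "4 + d\<^sup>2 > 0" by (simp add: add_pos_nonneg)
  have "sz_r d * (4 + d\<^sup>2) = sqrt (4 + d\<^sup>2)"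
    unfolding sz_r_def using p real_div_sqrt[of "4 + d\<^sup>2"] by simp
  moreover have "2 \<le> sqrt (4 + d\<^sup>2)" by (rule real_le_rsqrt) simp
  ultimately have "d * 2 / 2 \<le> d * (sz_r d * (4 + d\<^sup>2)) / 2" using d by (intro divide_right_mono mult_left_mono) auto
  then show ?thesis by (simp add: sz_om_def mult.assoc)
qed

lemma sz_peak_bounds: "d > 0 \<Longrightarrow> 0 \<le> sz_peak d \<and> sz_peak d \<le> 2 / d"
proof -
  assume d: "d > 0"
  then have o: "sz_om d > 0" using sz_om_ge[OF d] by linarith
  have "pi / (2 * sz_om d) \<le> 4 / (2 * d)"
    using d sz_om_ge[OF d] pi_less_4 by (intro frac_le) auto
  then show ?thesis using o d by (simp add: sz_peak_def)
qed

lemma sz_y_peak: "d > 0 \<Longrightarrow> sz_y d (sz_peak d) = d\<^sup>2 / (4 + d\<^sup>2)"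
proof -
  assume d: "d > 0"
  have p: "4 + d\<^sup>2 > 0" by (simp add: add_pos_nonneg)
  have "sz_om d * sz_peak d = pi / 2" using sz_om_ge[OF d] d by (simp add: sz_peak_def)
  then have "sin (sz_om d * sz_peak d) = 1" by (simp only: sin_pi_half)
  moreover have "(sz_r d)\<^sup>2 = 1 / (4 + d\<^sup>2)" using sz_r_sq[of d] p by (simp add: field_simps)
  ultimately show ?thesis using p by (simp add: sz_y_def field_simps)
qed

lemma sum_squares_ge: "real n ^ 3 / 3 \<le> (\<Sum>j<n. (real (Suc j))\<^sup>2)"
proof (induction n)
  case (Suc n)
  have "real (Suc n) ^ 3 / 3 \<le> real n ^ 3 / 3 + (real (Suc n))\<^sup>2"
    by (simp add: power2_eq_square power3_eq_cube algebra_simps)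
  then show ?case using Suc by simp
qed simp

text \<open>Up to frequency \<open>n\<close>, of order \<open>1/y\<close>, the geometric factor \<open>|p|^(2j)\<close> stays above \<open>1/2\<close> by Bernoulli's inequality.  These
frequencies alone contribute about \<open>y^2 n^3\<close>, of order \<open>1/y\<close>, to the square of the \<open>H\<^sup>1\<close> norm, and \<open>y\<close> is
about \<open>d\<^sup>2 / 4\<close>.\<close>

lemma sz_w_peak_l2w:
  assumes d: "0 < d" "d \<le> 1"
  defines "n \<equiv> nat \<lfloor>1 / (2 * sz_y d (sz_peak d))\<rfloor>"
  shows "1 / (10 * d) \<le> l2w 1 n (sz_w d (sz_peak d))" and "1 + real n \<le> 4 / d\<^sup>2"
proof -
  define y where "y = sz_y d (sz_peak d)"
  define q where "q = cmod (sz_p d (sz_peak d))"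
  have d2: "0 < d\<^sup>2" "d\<^sup>2 \<le> 1" using d by (auto simp: power_le_one)
  have y: "y = d\<^sup>2 / (4 + d\<^sup>2)" using sz_y_peak[OF d(1)] by (simp add: y_def)
  have y0: "y > 0" using d2 by (simp add: y add_pos_pos)
  have y4: "y \<le> d\<^sup>2 / 4" unfolding y using d2 by (intro frac_le) auto
  then have y1: "y \<le> 1 / 4" using d2 by simp
  have q2: "q\<^sup>2 = 1 - y" by (simp add: q_def y_def sz_norms)
  have n: "n = nat \<lfloor>1 / (2 * y)\<rfloor>" by (simp add: n_def y_def)
  have nu: "real n \<le> 1 / (2 * y)" unfolding n using y0 by (simp add: of_nat_nat)
  have "1 / (2 * y) < real n + 1" unfolding n using y0 by (simp add: of_nat_nat)
  moreover have "1 \<le> 1 / (4 * y)" using y0 y1 by (simp add: field_simps)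
  moreover have "1 / (2 * y) = 1 / (4 * y) + 1 / (4 * y)" by simp
  ultimately have nl: "1 / (4 * y) \<le> real n" by linarith
  have "1 + real n \<le> 1 + (4 + d\<^sup>2) / (2 * d\<^sup>2)" using nu by (simp add: y)
  also have "\<dots> = (4 + 3 * d\<^sup>2) / (2 * d\<^sup>2)" using d2 by (simp add: field_simps)
  also have "\<dots> \<le> 8 / (2 * d\<^sup>2)" using d2 by (intro divide_right_mono) auto
  finally show "1 + real n \<le> 4 / d\<^sup>2" by simp
  have pw: "1 / 2 \<le> (q ^ j)\<^sup>2" if "j < n" for j
  proof -
    have "1 / 2 \<le> 1 - real n * y" using nu y0 by (simp add: field_simps)
    also have "\<dots> \<le> 1 + real j * (- y)" using that y0 by simp
    also have "\<dots> \<le> (1 + (- y)) ^ j" by (rule Bernoulli_inequality) (use y1 in simp)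
    also have "\<dots> = (q\<^sup>2) ^ j" by (simp add: q2)
    finally show ?thesis by (simp flip: power_mult add: mult.commute)
  qed
  have "1 / (100 * d\<^sup>2) \<le> 1 / (384 * y)" using y4 y0 d2 by (intro divide_left_mono) auto
  also have "\<dots> = y\<^sup>2 / 2 * ((1 / (4 * y)) ^ 3 / 3)" using y0 by (simp add: field_simps eval_nat_numeral)
  also have "\<dots> \<le> y\<^sup>2 / 2 * (real n ^ 3 / 3)"
    using nl y0 by (intro mult_left_mono divide_right_mono power_mono) auto
  also have "\<dots> \<le> y\<^sup>2 / 2 * (\<Sum>j<n. (real (Suc j))\<^sup>2)" by (intro mult_left_mono sum_squares_ge) auto
  also have "\<dots> = (\<Sum>j<n. (real (Suc j))\<^sup>2 * (y\<^sup>2 * (1 / 2)))" by (simp add: sum_distrib_left mult_ac)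
  also have "\<dots> \<le> (\<Sum>j<n. wt 1 (Suc j) * (y\<^sup>2 * (q ^ j)\<^sup>2))"
  proof (intro sum_mono mult_mono mult_left_mono)
    fix j assume "j \<in> {..<n}" then show "1 / 2 \<le> (q ^ j)\<^sup>2" by (intro pw) simp
  qed (auto simp: wt_def)
  also have "\<dots> = (\<Sum>j<n. wt 1 (Suc j) * (cmod (sz_w d (sz_peak d) (Suc j)))\<^sup>2)"
    by (simp add: sz_w_Suc_norm y_def q_def power_mult_distrib)
  also have "\<dots> \<le> (\<Sum>k<Suc n. wt 1 k * (cmod (sz_w d (sz_peak d) k))\<^sup>2)"
    by (subst sum.lessThan_Suc_shift) simp
  also have "\<dots> = (l2w 1 n (sz_w d (sz_peak d)))\<^sup>2" by (simp add: l2w_power2 lessThan_Suc_atMost)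
  finally have "(1 / (10 * d))\<^sup>2 \<le> (l2w 1 n (sz_w d (sz_peak d)))\<^sup>2"
    by (simp add: power_divide power_mult_distrib)
  then show "1 / (10 * d) \<le> l2w 1 n (sz_w d (sz_peak d))" by (rule power2_le_imp_le) simp
qed

lemma l2w_1_le_l1: "l2w 1 n x \<le> (1 + real n) * l1 n x"
proof -
  have "l2w 1 n x \<le> (\<Sum>k\<le>n. wt (1/2) k * cmod (x k))"
    unfolding l2w_def by (rule L2_set_le_sum) simp
  also have "\<dots> \<le> (\<Sum>k\<le>n. (1 + real n) * cmod (x k))"
  proof (intro sum_mono mult_right_mono)
    fix k assume k: "k \<in> {..n}"
    have "wt (1/2) k = sqrt (1 + (real k)\<^sup>2)" by (simp add: wt_def powr_half_sqrt)
    also have "\<dots> \<le> 1 + real k" by (rule real_le_lsqrt) (auto simp: power2_sum)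
    also have "\<dots> \<le> 1 + real n" using k by simp
    finally show "wt (1/2) k \<le> 1 + real n" .
  qed simp
  finally show ?thesis by (simp add: l1_def sum_distrib_left)
qed

lemma l2w_mono_s:
  assumes "r \<le> s" shows "l2w r n x \<le> l2w s n x"
  unfolding l2w_def
  by (rule L2_set_mono) (use assms in \<open>auto simp: wt_def intro!: mult_right_mono powr_mono\<close>)

text \<open>The lower bound of \<open>sz_w_peak_l2w\<close> only involves frequencies below \<open>4 / d\<^sup>2\<close>, where the \<open>H\<^sup>1\<close> norm of the error
is at most \<open>4 / d\<^sup>2\<close> times its \<open>l\<^sup>1\<close> norm.  An error of \<open>d / 80\<close> therefore costs half of the bound.\<close>

lemma seq_growth:
  assumes s: "s \<ge> 1" and sol: "seq_solution s \<nu> U F" and d: "0 < d" "d \<le> 1" and \<nu>: "\<nu> > 0"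
    and init: "\<And>k. U 0 k = sz_w d 0 k"
    and small: "\<nu> * (400 / d ^ 4) * exp (62 * (2 / d)) \<le> d / 80"
  shows "1 / (20 * d) \<le> hs_norm s (U (sz_peak d))"
proof -
  define T where "T = sz_peak d"
  have T: "0 \<le> T" "T \<le> 2 / d" using sz_peak_bounds[OF d(1)] by (auto simp: T_def)
  have small1: "\<nu> * (400 / d ^ 4) * exp (62 * (2 / d)) \<le> 1" using small d by linarith
  have s2: "s > 1/2" using s by linarith
  note close = seq_solution_near_szego[OF s2 sol d \<nu> init small1 T]
  have "l1_norm (\<lambda>k. U T k - sz_w d T k) \<le> \<nu> * (400 / d ^ 4) * exp (62 * T)" by (rule close(2))
  also have "\<dots> \<le> \<nu> * (400 / d ^ 4) * exp (62 * (2 / d))" using T \<nu> d by (intro mult_left_mono) auto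
  also have "\<dots> \<le> d / 80" by (rule small)
  finally have r: "l1_norm (\<lambda>k. U T k - sz_w d T k) \<le> d / 80" .
  define n where "n = nat \<lfloor>1 / (2 * sz_y d (sz_peak d))\<rfloor>"
  note peak = sz_w_peak_l2w[OF d, folded n_def T_def]
  have "l2w 1 n (\<lambda>k. U T k - sz_w d T k) \<le> (1 + real n) * l1 n (\<lambda>k. U T k - sz_w d T k)" by (rule l2w_1_le_l1)
  also have "\<dots> \<le> (4 / d\<^sup>2) * (d / 80)"
  proof (rule mult_mono[OF peak(2)])
    have "l1 n (\<lambda>k. U T k - sz_w d T k) \<le> l1_norm (\<lambda>k. U T k - sz_w d T k)"
      unfolding l1_def by (rule sum_le_suminf[OF close(1)]) auto
    then show "l1 n (\<lambda>k. U T k - sz_w d T k) \<le> d / 80" using r by linarith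
  qed auto
  also have "\<dots> = 1 / (20 * d)" using d by (simp add: field_simps power2_eq_square)
  finally have e: "l2w 1 n (\<lambda>k. U T k - sz_w d T k) \<le> 1 / (20 * d)" .
  have "l2w 1 n (sz_w d T) \<le> l2w 1 n (U T) + l2w 1 n (\<lambda>k. U T k - sz_w d T k)"
    using l2w_diff[of 1 n "U T" "\<lambda>k. U T k - sz_w d T k"] by simp
  moreover have "1 / (10 * d) = 1 / (20 * d) + 1 / (20 * d)" by simp
  ultimately have "1 / (20 * d) \<le> l2w 1 n (U T)" using e peak(1) by linarith
  also have "\<dots> \<le> l2w s n (U T)" by (rule l2w_mono_s[OF s])
  also have "\<dots> \<le> hs_norm s (U T)" by (rule l2w_le_hs_norm[OF seq_solution_hs[OF sol]])
  finally show ?thesis by (simp add: T_def)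
qed

lemma hs_norm_scale:
  assumes e: "e > 0" and x: "hs_seq s x"
  shows "hs_norm s (\<lambda>k. x k / of_real e) = hs_norm s x / e"
proof -
  have "(\<Sum>k. wt s k * (cmod (x k / of_real e))\<^sup>2) = (\<Sum>k. wt s k * (cmod (x k))\<^sup>2 / e\<^sup>2)"
    using e by (simp add: norm_divide power_divide)
  also have "\<dots> = (\<Sum>k. wt s k * (cmod (x k))\<^sup>2) / e\<^sup>2"
    by (rule suminf_divide[OF x[unfolded hs_seq_def]])
  finally show ?thesis using e by (simp add: hs_norm_def real_sqrt_divide)
qed

lemma cub_scale: "cub N (\<lambda>k. x k / of_real e) k = cub N x k / of_real (e ^ 3)"
  unfolding cub_def sum_divide_distrib
  by (intro sum.cong refl) (auto simp: power3_eq_cube)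

text \<open>The cubic scaling \<open>u(t) = e v(e\<^sup>2 t)\<close>.\<close>

lemma seq_solution_scale:
  assumes sol: "seq_solution s \<nu> U F" and e: "e > 0"
  shows "seq_solution s (\<nu> / e\<^sup>2) (\<lambda>t k. U (t / e\<^sup>2) k / of_real e) (\<lambda>t k. F (t / e\<^sup>2) k / of_real (e ^ 3))"
  unfolding seq_solution_def
proof (intro conjI allI)
  fix t t0 k
  show "hs_seq s (\<lambda>k. U (t / e\<^sup>2) k / of_real e)"
    using summable_divide[OF seq_solution_hs[OF sol, unfolded hs_seq_def], of "t / e\<^sup>2" "e\<^sup>2"] e
    by (simp add: hs_seq_def norm_divide power_divide)
  have "((\<lambda>t. hs_norm s (\<lambda>k. U t k - U (t0 / e\<^sup>2) k)) \<longlongrightarrow> 0) (at (t0 / e\<^sup>2))"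
    using sol by (simp add: seq_solution_def)
  moreover have "filterlim (\<lambda>t. t / e\<^sup>2) (at (t0 / e\<^sup>2)) (at t0)"
    using e by (auto simp: filterlim_at eventually_at_filter intro!: tendsto_intros always_eventually)
  ultimately have "((\<lambda>t. hs_norm s (\<lambda>k. U (t / e\<^sup>2) k - U (t0 / e\<^sup>2) k)) \<longlongrightarrow> 0) (at t0)"
    by (rule filterlim_compose)
  then have "((\<lambda>t. hs_norm s (\<lambda>k. U (t / e\<^sup>2) k - U (t0 / e\<^sup>2) k) / e) \<longlongrightarrow> 0 / e) (at t0)"
    using e by (intro tendsto_divide tendsto_const) auto
  then show "((\<lambda>t. hs_norm s (\<lambda>k. U (t / e\<^sup>2) k / of_real e - U (t0 / e\<^sup>2) k / of_real e)) \<longlongrightarrow> 0) (at t0)"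
    by (simp add: hs_norm_scale[OF e hs_seq_diff[OF seq_solution_hs[OF sol] seq_solution_hs[OF sol]]] flip: diff_divide_distrib)
  have "((\<lambda>\<tau>. U (\<tau> / e\<^sup>2) k) has_vector_derivative (1 / e\<^sup>2) *\<^sub>R (- \<i> * (of_real (\<nu> * (real k)\<^sup>2) * U (t / e\<^sup>2) k + F (t / e\<^sup>2) k))) (at t)"
  proof -
    have "((\<lambda>\<tau>. \<tau> / e\<^sup>2) has_vector_derivative 1 / e\<^sup>2) (at t)"
      by (rule has_vector_derivative_divide[OF has_vector_derivative_id[unfolded id_def]])
    from vector_diff_chain_at[OF this seq_solution_deriv[OF sol]] show ?thesis by (simp add: o_def)
  qed
  then have "((\<lambda>\<tau>. U (\<tau> / e\<^sup>2) k / of_real e) has_vector_derivative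
     ((1 / e\<^sup>2) *\<^sub>R (- \<i> * (of_real (\<nu> * (real k)\<^sup>2) * U (t / e\<^sup>2) k + F (t / e\<^sup>2) k))) / of_real e) (at t)"
    by (rule has_vector_derivative_divide)
  then show "((\<lambda>\<tau>. U (\<tau> / e\<^sup>2) k / of_real e) has_vector_derivative
       - \<i> * (of_real (\<nu> / e\<^sup>2 * (real k)\<^sup>2) * (U (t / e\<^sup>2) k / of_real e) + F (t / e\<^sup>2) k / of_real (e ^ 3))) (at t)"
    by (rule has_vector_derivative_eq_rhs)
       (use e in \<open>simp add: scaleR_conv_of_real field_simps power2_eq_square power3_eq_cube\<close>)
  show "(\<lambda>N. cub N (\<lambda>k. U (t / e\<^sup>2) k / of_real e) k) \<longlonglongrightarrow> F (t / e\<^sup>2) k / of_real (e ^ 3)"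
    unfolding cub_scale using e by (intro tendsto_divide seq_solution_cub[OF sol] tendsto_const) auto
qed

text \<open>The parameter \<open>d\<close> of the datum.  Since \<open>1 / d\<close> is the square root of \<open>|ln \<epsilon>|\<close>, the factor \<open>exp (C / d)\<close> is
smaller than every negative power of \<open>\<epsilon>\<close>.\<close>

definition gap :: "real \<Rightarrow> real" where "gap \<epsilon> = \<bar>ln \<epsilon>\<bar> powr (- (1/2))"

definition datum :: "real \<Rightarrow> real \<Rightarrow> complex" where
  "datum \<epsilon> = (\<lambda>x. of_real \<epsilon> * cis (of_int 1 * x) + of_real (\<epsilon> * gap \<epsilon>))"

definition datum_seq :: "real \<Rightarrow> nat \<Rightarrow> complex" where
  "datum_seq \<epsilon> k = (if k = 0 then of_real (\<epsilon> * gap \<epsilon>) else if k = 1 then of_real \<epsilon> else 0)"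

lemma datum_seq_sums:
  fixes g :: "nat \<Rightarrow> 'a::real_normed_vector"
  assumes "\<And>k. k > 1 \<Longrightarrow> g k = 0" shows "g sums (g 0 + g 1)"
proof -
  have "g sums (\<Sum>k\<in>{0, 1}. g k)" by (rule sums_finite) (use assms in auto)
  then show ?thesis by simp
qed

lemma datum_seq_l1: "ell1 (datum_seq \<epsilon>)"
  by (rule sums_summable[OF datum_seq_sums]) (simp add: datum_seq_def)

lemma datum_fser: "datum \<epsilon> = fser (datum_seq \<epsilon>)"
proof
  fix x
  have "(\<lambda>k. datum_seq \<epsilon> k * cis (real k * x)) sums (datum_seq \<epsilon> 0 * cis (real 0 * x) + datum_seq \<epsilon> 1 * cis (real 1 * x))"
    by (rule datum_seq_sums) (simp add: datum_seq_def)
  from sums_unique[OF this]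
  have "fser (datum_seq \<epsilon>) x = datum_seq \<epsilon> 0 * cis (real 0 * x) + datum_seq \<epsilon> 1 * cis (real 1 * x)"
    by (simp only: fser_def)
  then show "datum \<epsilon> x = fser (datum_seq \<epsilon>) x"
    by (simp add: datum_def datum_seq_def)
qed

lemma fser_L2_plus: "ell1 c \<Longrightarrow> fser c \<in> L2_plus"
  using is_szego_fser[of "fser c"] fser_L2_circle[of c] by (auto simp: L2_plus_def fourier_coeff_fser)

lemma datum_Cinf_plus: "datum \<epsilon> \<in> Cinf_plus"
proof -
  have "datum \<epsilon> \<in> Cinf_circle" unfolding datum_def by (rule Cinf_circle_cis)
  moreover have "datum \<epsilon> \<in> L2_plus" unfolding datum_fser by (rule fser_L2_plus[OF datum_seq_l1])
  ultimately show ?thesis by (simp add: Cinf_plus_def)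
qed

lemma fourier_coeff_datum: "fourier_coeff (datum \<epsilon>) (int k) = datum_seq \<epsilon> k"
  unfolding datum_fser by (simp add: fourier_coeff_fser datum_seq_l1)

lemma Hs_norm_datum: "Hs_norm s (datum \<epsilon>) = sqrt ((\<epsilon> * gap \<epsilon>)\<^sup>2 + 2 powr s * \<epsilon>\<^sup>2)"
proof -
  have sums: "(\<lambda>k. wt s k * (cmod (datum_seq \<epsilon> k))\<^sup>2) sums ((\<epsilon> * gap \<epsilon>)\<^sup>2 + 2 powr s * \<epsilon>\<^sup>2)"
    using datum_seq_sums[of "\<lambda>k. wt s k * (cmod (datum_seq \<epsilon> k))\<^sup>2"]
    by (simp add: datum_seq_def wt_def norm_mult power_mult_distrib)
  have neg: "fourier_coeff (datum \<epsilon>) j = 0" if "j < 0" for j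
    using that unfolding datum_fser by (simp add: fourier_coeff_fser datum_seq_l1)
  have "hs_seq s (fcoeffs (datum \<epsilon>))"
    using sums_summable[OF sums] by (simp add: hs_seq_def fourier_coeff_datum)
  from hs_sum_int_nat(2)[OF neg summable_on_intI[OF neg this]]
  have "Hs_norm s (datum \<epsilon>) = hs_norm s (datum_seq \<epsilon>)" by (simp add: fourier_coeff_datum)
  also have "\<dots> = sqrt ((\<epsilon> * gap \<epsilon>)\<^sup>2 + 2 powr s * \<epsilon>\<^sup>2)"
    using sums_unique[OF sums] by (simp add: hs_norm_def)
  finally show ?thesis .
qed

lemma gap_bounds:
  assumes "0 < \<epsilon>" "\<epsilon> < exp (- 1)" shows "0 < gap \<epsilon>" "gap \<epsilon> \<le> 1"
proof -
  have "ln \<epsilon> < ln (exp (- 1))" using assms by (subst ln_less_cancel_iff) auto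
  then have l: "1 < \<bar>ln \<epsilon>\<bar>" by simp
  then show "0 < gap \<epsilon>" by (simp add: gap_def)
  have "\<bar>ln \<epsilon>\<bar> powr (- (1/2)) \<le> \<bar>ln \<epsilon>\<bar> powr 0" using l by (intro powr_mono) auto
  then show "gap \<epsilon> \<le> 1" using l by (simp add: gap_def split: if_splits)
qed

lemma datum_norm_bounds:
  assumes e: "0 < \<epsilon>" "\<epsilon> < exp (- 1)" and s: "s \<ge> 1"
  defines "C \<equiv> sqrt (1 + 2 powr s)"
  shows "inverse C * \<epsilon> \<le> Hs_norm s (datum \<epsilon>)" "Hs_norm s (datum \<epsilon>) \<le> C * \<epsilon>"
proof -
  note a = gap_bounds[OF e]
  have s1: "2 powr s \<ge> (1::real)" using s by (intro ge_one_powr_ge_zero) auto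
  have C1: "C \<ge> 1" unfolding C_def using s1 by simp
  have "inverse C * \<epsilon> \<le> 1 * \<epsilon>" using C1 e by (intro mult_right_mono) (auto simp: field_simps)
  also have "1 * \<epsilon> \<le> Hs_norm s (datum \<epsilon>)" unfolding Hs_norm_datum
    by (rule real_le_rsqrt) (use mult_right_mono[OF s1, of "\<epsilon>\<^sup>2"] in \<open>simp add: add_increasing\<close>)
  finally show "inverse C * \<epsilon> \<le> Hs_norm s (datum \<epsilon>)" .
  have "(\<epsilon> * gap \<epsilon>)\<^sup>2 \<le> \<epsilon>\<^sup>2" using a e by (intro power_mono) (auto simp: mult_left_le)
  then have "(\<epsilon> * gap \<epsilon>)\<^sup>2 + 2 powr s * \<epsilon>\<^sup>2 \<le> (1 + 2 powr s) * \<epsilon>\<^sup>2" by (simp add: algebra_simps)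
  then have "Hs_norm s (datum \<epsilon>) \<le> sqrt ((1 + 2 powr s) * \<epsilon>\<^sup>2)" unfolding Hs_norm_datum by (rule real_sqrt_le_mono)
  also have "\<dots> = C * \<epsilon>" using e by (simp add: C_def real_sqrt_mult)
  finally show "Hs_norm s (datum \<epsilon>) \<le> C * \<epsilon>" .
qed

text \<open>The peak is reached at time \<open>sz_peak d / \<epsilon>\<^sup>2 \<le> (2 / d) / \<epsilon>\<^sup>2\<close>, and the norm of the scaled solution is \<open>1 / \<epsilon>\<close> times the
original one.\<close>

lemma datum_growth:
  assumes s: "s \<ge> 1" and e: "0 < \<epsilon>" "\<epsilon> < exp (- 1)"
    and small: "\<epsilon> powr (\<alpha> - 2) * (400 / gap \<epsilon> ^ 4) * exp (62 * (2 / gap \<epsilon>)) \<le> gap \<epsilon> / 80"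
    and time: "2 / gap \<epsilon> \<le> \<epsilon> powr (- \<beta>)"
    and sol: "nls_szego_solution s (\<epsilon> powr \<alpha>) (datum \<epsilon>) u"
  shows "sup_Hs_norm s (\<epsilon> powr (- (2 + \<beta>))) u \<ge> ereal (1 / 20 * (\<epsilon> * \<bar>ln \<epsilon>\<bar> powr (1 / 2)))"
proof -
  define d where "d = gap \<epsilon>"
  have d: "0 < d" "d \<le> 1" using gap_bounds[OF e] by (auto simp: d_def)
  have s2: "s > 1/2" using s by linarith
  define U where "U = (\<lambda>t k. fourier_coeff (u t) (int k))"
  obtain F where F: "seq_solution s (\<epsilon> powr \<alpha>) U F"
    using solution_seq_solution(1)[OF s2 sol] by (auto simp: U_def)
  define V where "V = (\<lambda>t k. U (t / \<epsilon>\<^sup>2) k / of_real \<epsilon>)"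
  have V: "seq_solution s (\<epsilon> powr (\<alpha> - 2)) V (\<lambda>t k. F (t / \<epsilon>\<^sup>2) k / of_real (\<epsilon> ^ 3))"
    using seq_solution_scale[OF F e(1)] e by (simp add: V_def powr_diff)
  have "datum \<epsilon> \<in> L2_circle" unfolding datum_fser by (rule fser_L2_circle[OF datum_seq_l1])
  then have "U 0 k = datum_seq \<epsilon> k" for k
    using solution_seq_solution(3)[OF s2 sol] by (simp add: U_def fourier_coeff_datum)
  then have init: "V 0 k = sz_w d 0 k" for k
    using e by (simp add: V_def datum_seq_def sz_w_initial d_def)
  define t where "t = sz_peak d / \<epsilon>\<^sup>2"
  have "1 / (20 * d) \<le> hs_norm s (V (sz_peak d))"
    by (rule seq_growth[OF s V d _ init]) (use e small in \<open>auto simp: d_def\<close>)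
  also have "\<dots> = Hs_norm s (u t) / \<epsilon>"
    using solution_seq_solution(2)[OF s2 sol] e hs_norm_scale[OF e(1) seq_solution_hs[OF F, of t]] by (simp add: V_def U_def t_def)
  finally have "1 / (20 * d) * \<epsilon> \<le> Hs_norm s (u t)" using e by (simp add: field_simps)
  moreover have "1 / d = \<bar>ln \<epsilon>\<bar> powr (1 / 2)" by (simp add: d_def gap_def powr_minus field_simps)
  ultimately have g: "1 / 20 * (\<epsilon> * \<bar>ln \<epsilon>\<bar> powr (1 / 2)) \<le> Hs_norm s (u t)" by (simp add: mult_ac flip: \<open>1 / d = _\<close>)
  have "t \<le> (2 / d) / \<epsilon>\<^sup>2" "0 \<le> t"
    unfolding t_def using sz_peak_bounds[OF d(1)] by (intro divide_right_mono divide_nonneg_nonneg; simp)+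
  moreover have "(2 / d) / \<epsilon>\<^sup>2 \<le> \<epsilon> powr (- \<beta>) / \<epsilon>\<^sup>2" using time by (intro divide_right_mono) (auto simp: d_def)
  moreover have "\<epsilon> powr (- \<beta>) / \<epsilon>\<^sup>2 = \<epsilon> powr (- (2 + \<beta>))"
    using e powr_diff[of \<epsilon> "- \<beta>" 2] by (simp add: algebra_simps)
  ultimately have "t \<in> {- (\<epsilon> powr (- (2 + \<beta>)))..\<epsilon> powr (- (2 + \<beta>))}" by auto
  then show ?thesis unfolding sup_Hs_norm_def using g by (intro SUP_upper2[of t]) auto
qed

lemma small_dispersion_eventually:
  assumes "\<alpha> > 2"
  shows "\<forall>\<^sub>F \<epsilon> in at_right 0. \<epsilon> powr (\<alpha> - 2) * (400 / gap \<epsilon> ^ 4) * exp (62 * (2 / gap \<epsilon>)) \<le> gap \<epsilon> / 80"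
  unfolding gap_def using assms by real_asymp

lemma time_eventually:
  assumes "\<beta> > 0"
  shows "\<forall>\<^sub>F \<epsilon> in at_right 0. 2 / gap \<epsilon> \<le> \<epsilon> powr (- \<beta>)"
  unfolding gap_def using assms by real_asymp

lemma log_growth: "filterlim (\<lambda>\<epsilon>. \<epsilon> * \<bar>ln \<epsilon>\<bar> powr (1 / 2) / \<epsilon>) at_top (at_right (0::real))"
  by real_asymp

lemma growth_eventually:
  assumes "s \<ge> 1" "\<alpha> > 2" "\<beta> > 0"
  shows "\<exists>\<epsilon>1>0. \<forall>\<epsilon>. 0 < \<epsilon> \<and> \<epsilon> < \<epsilon>1 \<longrightarrow>
            (\<forall>u. nls_szego_solution s (\<epsilon> powr \<alpha>) (datum \<epsilon>) u \<longrightarrow>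
               sup_Hs_norm s (\<epsilon> powr (- (2 + \<beta>))) u \<ge> ereal (1 / 20 * (\<epsilon> * \<bar>ln \<epsilon>\<bar> powr (1 / 2))))"
proof -
  have "\<forall>\<^sub>F \<epsilon> in at_right 0. 0 < \<epsilon> \<and> \<epsilon> < exp (- 1 :: real)"
    by (auto simp: eventually_at_right_field intro!: exI[of _ "exp (- 1)"])
  with small_dispersion_eventually[OF assms(2)] time_eventually[OF assms(3)]
  have "\<forall>\<^sub>F \<epsilon> in at_right 0. \<forall>u. nls_szego_solution s (\<epsilon> powr \<alpha>) (datum \<epsilon>) u \<longrightarrow>
           sup_Hs_norm s (\<epsilon> powr (- (2 + \<beta>))) u \<ge> ereal (1 / 20 * (\<epsilon> * \<bar>ln \<epsilon>\<bar> powr (1 / 2)))"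
    by eventually_elim (blast intro: datum_growth[OF assms(1)])
  then show ?thesis by (auto simp: eventually_at_right_field)
qed

lemma long_time_growth:
  assumes s: "s \<ge> 1" and \<alpha>: "\<alpha> > 2"
  shows "\<exists>(\<epsilon>0::real) (C::real) (c::real) (u0 :: real \<Rightarrow> real \<Rightarrow> complex).
         \<epsilon>0 > 0 \<and> C > 0 \<and> c > 0 \<and>
         (\<forall>\<epsilon>. 0 < \<epsilon> \<and> \<epsilon> < \<epsilon>0 \<longrightarrow>
            u0 \<epsilon> \<in> Cinf_plus \<and>
            inverse C * \<epsilon> \<le> Hs_norm s (u0 \<epsilon>) \<and> Hs_norm s (u0 \<epsilon>) \<le> C * \<epsilon>) \<and>
         (\<forall>\<beta>>0. \<exists>\<epsilon>1>0. \<forall>\<epsilon>. 0 < \<epsilon> \<and> \<epsilon> < \<epsilon>1 \<longrightarrow>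
            (\<forall>u. nls_szego_solution s (\<epsilon> powr \<alpha>) (u0 \<epsilon>) u \<longrightarrow>
               sup_Hs_norm s (\<epsilon> powr (- (2 + \<beta>))) u
                 \<ge> ereal (c * (\<epsilon> * \<bar>ln \<epsilon>\<bar> powr (1 / 2))))) \<and>
         filterlim (\<lambda>\<epsilon>. \<epsilon> * \<bar>ln \<epsilon>\<bar> powr (1 / 2) / \<epsilon>) at_top (at_right (0::real))"
proof -
  have "sqrt (1 + 2 powr s) > 0" by (simp add: add_pos_nonneg)
  then show ?thesis
    using datum_norm_bounds[OF _ _ s] datum_Cinf_plus log_growth growth_eventually[OF s \<alpha>]
    by (intro exI[of _ "exp (- 1)"] exI[of _ "sqrt (1 + 2 powr s)"] exI[of _ "1 / 20"] exI[of _ datum] conjI) auto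
qed

theorem theorem1p3:
  fixes s :: real
  assumes "s > 1 / 2"
  shows
    "\<exists>a K::real. 0 < a \<and> a < 1 \<and> K > 0 \<and>
      (\<forall>\<alpha>\<ge>0. \<exists>\<epsilon>0>0. \<forall>\<epsilon>. 0 < \<epsilon> \<and> \<epsilon> < \<epsilon>0 \<longrightarrow>
        (\<forall>u0\<in>Hs_plus s. Hs_norm s u0 = \<epsilon> \<longrightarrow>
          (\<forall>u. nls_szego_solution s (\<epsilon> powr \<alpha>) u0 u \<longrightarrow>
             (\<alpha> \<le> 2 \<longrightarrow> sup_Hs_norm s (a * \<epsilon> powr (- (4 - \<alpha>))) u \<le> ereal (K * \<epsilon>)) \<and>
             (\<alpha> > 2 \<longrightarrow> sup_Hs_norm s (a * \<epsilon> powr (- 2)) u \<le> ereal (K * \<epsilon>))))) \<and>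
      (s \<ge> 1 \<longrightarrow> (\<forall>\<alpha>>2. \<exists>(\<epsilon>0::real) (C::real) (c::real) (u0 :: real \<Rightarrow> real \<Rightarrow> complex).
         \<epsilon>0 > 0 \<and> C > 0 \<and> c > 0 \<and>
         (\<forall>\<epsilon>. 0 < \<epsilon> \<and> \<epsilon> < \<epsilon>0 \<longrightarrow>
            u0 \<epsilon> \<in> Cinf_plus \<and>
            inverse C * \<epsilon> \<le> Hs_norm s (u0 \<epsilon>) \<and> Hs_norm s (u0 \<epsilon>) \<le> C * \<epsilon>) \<and>
         (\<forall>\<beta>>0. \<exists>\<epsilon>1>0. \<forall>\<epsilon>. 0 < \<epsilon> \<and> \<epsilon> < \<epsilon>1 \<longrightarrow>
            (\<forall>u. nls_szego_solution s (\<epsilon> powr \<alpha>) (u0 \<epsilon>) u \<longrightarrow>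
               sup_Hs_norm s (\<epsilon> powr (- (2 + \<beta>))) u
                 \<ge> ereal (c * (\<epsilon> * \<bar>ln \<epsilon>\<bar> powr (1 / 2))))) \<and>
         filterlim (\<lambda>\<epsilon>. \<epsilon> * \<bar>ln \<epsilon>\<bar> powr (1 / 2) / \<epsilon>) at_top (at_right (0::real))))"
proof (rule exI[of _ "lifespan s"], rule exI[of _ "2::real"], intro conjI)
  show "0 < lifespan s" "lifespan s < 1" "(0::real) < 2" by (simp_all add: lifespan_bounds)
qed (use long_time_bound[OF assms] long_time_growth in blast)+
end
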